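(* Let $p,q\ge 1$ be integers. If $G\times K$ is a connected subgroup of $Sp(p,q)$, where $G$ is isomorphic to either $Sp(p-1,q)$ or $Sp(p,q-1)$ and $K\cong Sp(1)$, then there exists an automorphism $$\phi:Sp(p,q)\to Sp(p,q)$$ such that $\phi(G\times K)\subset Sp(p,q)$ is the block-diagonal embedding.
   Context: $\mathbb{H}$ denotes the quaternions and $A^*=\overline{A}^t$. $Sp(p,q)=\{A\in M_{n\times n}(\mathbb{H}): A^*I_{p,q}A=I_{p,q}\}$, where $n=p+q$ and $I_{p,q}=\mathrm{diag}(I_p,-I_q)$; $Sp(n)=Sp(n,0)=Sp(0,n)$. Subgroups are Lie subgroups, and $G\times K\subset Sp(p,q)$ is an (internal) direct product. The block-diagonal embeddings are $Sp(p,q-1)\times Sp(1)\hookrightarrow Sp(p,q)$, $(g,\eta)\mapsto\mathrm{diag}(g,\eta)$, and $Sp(p-1,q)\times Sp(1)\hookrightarrow Sp(p,q)$, $(g,\eta)\mapsto\mathrm{diag}(\eta,g)$; the one corresponding to the isomorphism type of $G$ is meant. *)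

theory Defs
  imports "HOL-Analysis.Analysis" "HOL-Algebra.Coset" "Jordan_Normal_Form.Matrix"
begin

section \<open>Quaternions\<close>

text \<open>\<open>Quat a b c d\<close> is $a + b i + c j + d k$.\<close>

datatype quat = Quat (qre: real) (qi: real) (qj: real) (qk: real)

instantiation quat :: real_vector
begin
definition "0 = Quat 0 0 0 0"
definition "x + y = Quat (qre x + qre y) (qi x + qi y) (qj x + qj y) (qk x + qk y)"
definition "- x = Quat (- qre x) (- qi x) (- qj x) (- qk x)"
definition "x - y = Quat (qre x - qre y) (qi x - qi y) (qj x - qj y) (qk x - qk y)"
definition "r *\<^sub>R x = Quat (r * qre x) (r * qi x) (r * qj x) (r * qk x)"
instance
  by standard
    (auto simp: zero_quat_def plus_quat_def uminus_quat_def minus_quat_def scaleR_quat_def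
      algebra_simps)
end

instantiation quat :: real_algebra_1
begin
definition "1 = Quat 1 0 0 0"
definition "x * y = Quat
  (qre x * qre y - qi x * qi y - qj x * qj y - qk x * qk y)
  (qre x * qi y + qi x * qre y + qj x * qk y - qk x * qj y)
  (qre x * qj y - qi x * qk y + qj x * qre y + qk x * qi y)
  (qre x * qk y + qi x * qj y - qj x * qi y + qk x * qre y)"
instance
  by standard
    (auto simp: zero_quat_def one_quat_def plus_quat_def times_quat_def scaleR_quat_def
      algebra_simps)
end

definition qcnj :: "quat \<Rightarrow> quat" where
  "qcnj x = Quat (qre x) (- qi x) (- qj x) (- qk x)"

instantiation quat :: real_inner
begin
definition "inner x y = qre x * qre y + qi x * qi y + qj x * qj y + qk x * qk y"
definition "norm (x :: quat) = sqrt (inner x x)"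
definition "sgn (x :: quat) = x /\<^sub>R norm x"
definition "dist (x :: quat) y = norm (x - y)"
definition "(uniformity :: (quat \<times> quat) filter) = (INF e\<in>{0 <..}. principal {(x, y). dist x y < e})"
definition "open (U :: quat set) \<longleftrightarrow> (\<forall>x\<in>U. eventually (\<lambda>(x', y). x' = x \<longrightarrow> y \<in> U) uniformity)"
instance
proof
  fix x y z :: quat and r :: real
  show "inner x y = inner y x"
    by (simp add: inner_quat_def mult.commute)
  show "inner (x + y) z = inner x z + inner y z"
    by (simp add: inner_quat_def plus_quat_def distrib_right)
  show "inner (r *\<^sub>R x) y = r * inner x y"
    by (simp add: inner_quat_def scaleR_quat_def distrib_left)
  show "0 \<le> inner x x"
    by (simp add: inner_quat_def)
  show "inner x x = 0 \<longleftrightarrow> x = 0"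
    by (cases x) (simp add: inner_quat_def zero_quat_def add_nonneg_eq_0_iff)
qed (rule norm_quat_def sgn_quat_def dist_quat_def uniformity_quat_def open_quat_def)+
end

instantiation quat :: real_normed_div_algebra
begin
definition "inverse x = qcnj x /\<^sub>R inner x x"
definition "x div y = x * inverse (y :: quat)"
instance
proof
  have scale: "u * (r *\<^sub>R v) = r *\<^sub>R (u * v)" "(r *\<^sub>R u) * v = r *\<^sub>R (u * v)" for u v :: quat and r
    by simp_all
  have cnj: "x * qcnj x = inner x x *\<^sub>R 1" "qcnj x * x = inner x x *\<^sub>R 1" for x
    by (simp_all add: times_quat_def qcnj_def inner_quat_def scaleR_quat_def one_quat_def
        algebra_simps)
  fix x y :: quat
  show "x \<noteq> 0 \<Longrightarrow> inverse x * x = 1" "x \<noteq> 0 \<Longrightarrow> x * inverse x = 1"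
    unfolding inverse_quat_def scale cnj by simp_all
  show "x div y = x * inverse y"
    by (rule divide_quat_def)
  show "inverse (0 :: quat) = 0"
    by (simp add: inverse_quat_def)
  have "inner (x * y) (x * y) = inner x x * inner y y"
    by (simp add: inner_quat_def times_quat_def algebra_simps)
  then show "norm (x * y) = norm x * norm y"
    by (simp add: norm_quat_def real_sqrt_mult)
qed
end


section \<open>The groups Sp(p,q)\<close>

definition qadjoint :: "quat mat \<Rightarrow> quat mat" where
  "qadjoint A = map_mat qcnj (transpose_mat A)"

definition I_sig :: "nat \<Rightarrow> nat \<Rightarrow> quat mat" where
  "I_sig p q = diag_block_mat [1\<^sub>m p, - 1\<^sub>m q]"

definition Sp :: "nat \<Rightarrow> nat \<Rightarrow> quat mat monoid" where
  "Sp p q = \<lparr>carrier = {A \<in> carrier_mat (p + q) (p + q). qadjoint A * I_sig p q * A = I_sig p q},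
             mult = (*), one = 1\<^sub>m (p + q)\<rparr>"


section \<open>Topology and smooth maps\<close>

text \<open>The Euclidean topology on the space of quaternionic \<open>n \<times> n\<close> matrices.\<close>

definition mat_topology :: "nat \<Rightarrow> quat mat topology" where
  "mat_topology n = pullback_topology (carrier_mat n n)
     (\<lambda>A. restrict (($$) A) ({..<n} \<times> {..<n}))
     (product_topology (\<lambda>_. euclidean) ({..<n} \<times> {..<n}))"

text \<open>\<open>Ck n k U F\<close>: on the open set \<open>U\<close> of \<open>n \<times> n\<close> matrices, all iterated (real) directional
  derivatives of \<open>F\<close> of order at most \<open>k\<close> exist, and those of order \<open>k\<close> are continuous (hence all
  of them are), i.e. \<open>F\<close> is of class \<open>C\<^sup>k\<close>.\<close>

fun Ck :: "nat \<Rightarrow> nat \<Rightarrow> quat mat set \<Rightarrow> (quat mat \<Rightarrow> quat) \<Rightarrow> bool" where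
  "Ck n 0 U F \<longleftrightarrow> continuous_map (subtopology (mat_topology n) U) euclidean F"
| "Ck n (Suc k) U F \<longleftrightarrow>
     (\<forall>V\<in>carrier_mat n n. \<exists>F'.
        (\<forall>A\<in>U. ((\<lambda>t. F (A + of_real t \<cdot>\<^sub>m V)) has_vector_derivative F' A) (at 0)) \<and> Ck n k U F')"

text \<open>Smoothness of a map from a subset \<open>S\<close> of the \<open>n \<times> n\<close> matrices to the \<open>m \<times> m\<close> matrices:
  locally it is the restriction of a smooth map defined on an open set. As the groups \<open>Sp p q\<close> are
  closed submanifolds of the matrix space, this is smoothness in the sense of manifolds for maps
  between them.\<close>

definition smooth_on_mat :: "nat \<Rightarrow> nat \<Rightarrow> quat mat set \<Rightarrow> (quat mat \<Rightarrow> quat mat) \<Rightarrow> bool" where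
  "smooth_on_mat n m S f \<longleftrightarrow>
     (\<forall>A\<in>S. f A \<in> carrier_mat m m \<and>
       (\<exists>U F. openin (mat_topology n) U \<and> A \<in> U \<and>
          (\<forall>i<m. \<forall>j<m. \<forall>k. Ck n k U (\<lambda>B. F B $$ (i, j))) \<and>
          (\<forall>B\<in>S \<inter> U. F B = f B)))"


section \<open>Lie automorphisms, Lie subgroups, direct products\<close>

definition Lie_automorphism_Sp :: "nat \<Rightarrow> nat \<Rightarrow> (quat mat \<Rightarrow> quat mat) \<Rightarrow> bool" where
  "Lie_automorphism_Sp p q \<phi> \<longleftrightarrow>
     \<phi> \<in> iso (Sp p q) (Sp p q) \<and>
     smooth_on_mat (p + q) (p + q) (carrier (Sp p q)) \<phi> \<and>
     smooth_on_mat (p + q) (p + q) (carrier (Sp p q)) (inv_into (carrier (Sp p q)) \<phi>)"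

text \<open>\<open>G\<close> is a Lie subgroup of \<open>Sp p q\<close> which is, as a Lie group, isomorphic to \<open>Sp r s\<close>. Lie
  subgroups are understood in the general (immersed) sense: images of injective immersive
  homomorphisms of Lie groups, the Lie group structure being transported from the source. The
  subgroup need not be closed. Immersivity need not be demanded, as every injective
  homomorphism of Lie groups is an immersion.\<close>

definition Lie_subgroup_Sp_iso :: "nat \<Rightarrow> nat \<Rightarrow> quat mat set \<Rightarrow> nat \<Rightarrow> nat \<Rightarrow> bool" where
  "Lie_subgroup_Sp_iso p q G r s \<longleftrightarrow>
     (\<exists>f. f \<in> hom (Sp r s) (Sp p q) \<and>
          smooth_on_mat (r + s) (p + q) (carrier (Sp r s)) f \<and>
          inj_on f (carrier (Sp r s)) \<and> f ` carrier (Sp r s) = G)"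

text \<open>The subgroups \<open>A\<close> and \<open>B\<close> form an internal direct product (whose underlying set is then
  \<open>A <#>\<^bsub>M\<^esub> B\<close>).\<close>

definition internal_direct_product :: "('a, 'b) monoid_scheme \<Rightarrow> 'a set \<Rightarrow> 'a set \<Rightarrow> bool" where
  "internal_direct_product M A B \<longleftrightarrow>
     subgroup A M \<and> subgroup B M \<and> A \<inter> B = {\<one>\<^bsub>M\<^esub>} \<and>
     (\<forall>a\<in>A. \<forall>b\<in>B. a \<otimes>\<^bsub>M\<^esub> b = b \<otimes>\<^bsub>M\<^esub> a)"

text \<open>\<open>\<phi>(A \<times> B)\<close> is the image of the embedding \<open>e\<close> of the external product \<open>H \<times> L\<close>, the factors
  being matched.\<close>

definition maps_onto_embedding ::
  "('a, 'm) monoid_scheme \<Rightarrow> ('a \<Rightarrow> 'a) \<Rightarrow> 'a set \<Rightarrow> 'a set \<Rightarrow>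
   ('b, 'n) monoid_scheme \<Rightarrow> ('c, 'l) monoid_scheme \<Rightarrow> ('b \<Rightarrow> 'c \<Rightarrow> 'a) \<Rightarrow> bool" where
  "maps_onto_embedding M \<phi> A B H L e \<longleftrightarrow>
     \<phi> ` (A <#>\<^bsub>M\<^esub> B) = {e h l | h l. h \<in> carrier H \<and> l \<in> carrier L} \<and>
     \<phi> ` A = {e h \<one>\<^bsub>L\<^esub> | h. h \<in> carrier H} \<and>
     \<phi> ` B = {e \<one>\<^bsub>H\<^esub> l | l. l \<in> carrier L}"

end

theory Submission
  imports Defs
begin

text \<open>
  Let \<open>n = p + q\<close>. The images of the scalars \<open>\<plusminus>1\<close> in the \<open>n - 1\<close> diagonal factors \<open>Sp(1)\<close> of \<open>G\<close>,
  together with \<open>- 1 \<in> K\<close>, form a group \<open>(\<int>/2)\<^sup>n\<close> of commuting involutions. They can be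
  diagonalized in an orthogonal basis of quaternionic \<open>n\<close>-space, and since the group has \<open>2\<^sup>n\<close>
  elements it consists of all diagonal sign matrices in that basis. Hence the \<open>n\<close> commuting copies
  of \<open>Sp(1)\<close> act diagonally. Two commuting homomorphisms \<open>Sp(1) \<rightarrow> Sp(1)\<close> cannot both map \<open>- 1\<close> to
  \<open>- 1\<close>, because the image of one contains anticommuting units, whose centralizer is real; so each
  copy acts on a line of its own, and by continuity as the full \<open>Sp(1)\<close>.

  Thus \<open>K\<close> is the full \<open>Sp(1)\<close> of one line, and \<open>G\<close> acts trivially on that line. On the plane of two
  other lines, the image of a rotation or of a boost is, up to units, determined by a real function
  \<open>g\<close> with \<open>g(2 t) = 2 g(t)\<^sup>2 - 1\<close>, like \<open>cos\<close> and \<open>cosh\<close>. By the intermediate value theorem, \<open>G\<close>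
  contains all rotations or all boosts of that plane, according to the signs of the two lines; these
  generate the whole isometry group of the complement of the line of \<open>K\<close>. Reordering the lines gives
  the automorphism, up to the exchange of the signs that is possible if \<open>p = q\<close>.
\<close>

section \<open>Unit quaternions\<close>

text \<open>The argument stays inside the group: Lie algebras do not occur, and smoothness enters
  through continuity along real paths, the input of the intermediate value theorem. The form is
  indefinite, so a vector orthogonal to given ones may be isotropic and then cannot be normalized.
  Involutions get around this: for an isometric involution t the values of the form at x + t x and x
  - t x add up to four times the value at x, so a non-isotropic x has a non-isotropic
  eigencomponent. The doubling formula only yields that g becomes negative somewhere, hence only
  rotations with nonnegative cosine; the generation theorem is stated so that these suffice. Whether
  rotations could become boosts is decided by boundedness against periodicity. This fixes the
  products of the signs of two lines, and Sylvester's law of inertia then determines all signs up to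
  a common one. Noncommutativity of the entries rules out determinants, so inverses are written down
  explicitly from the form.\<close>

lemma qcnj_simps [simp]:
  "qcnj (x + y) = qcnj x + qcnj y" "qcnj (x - y) = qcnj x - qcnj y" "qcnj (- x) = - qcnj x"
  "qcnj (x * y) = qcnj y * qcnj x" "qcnj (r *\<^sub>R x) = r *\<^sub>R qcnj x" "qcnj (qcnj x) = x"
  "qcnj 0 = 0" "qcnj 1 = 1" "qcnj (of_real r) = of_real r"
  by (auto simp: qcnj_def plus_quat_def minus_quat_def uminus_quat_def times_quat_def
      scaleR_quat_def zero_quat_def one_quat_def of_real_def algebra_simps)

lemma qcnj_sum: "qcnj (sum f A) = (\<Sum>a\<in>A. qcnj (f a))"
  by (induction A rule: infinite_finite_induct) auto

lemma qre_simps [simp]: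
  "qre (x + y) = qre x + qre y" "qre (x - y) = qre x - qre y" "qre (- x) = - qre x"
  "qre (r *\<^sub>R x) = r * qre x" "qre (of_real r) = r" "qre 0 = 0" "qre 1 = 1" "qre (qcnj x) = qre x"
  by (auto simp: qcnj_def plus_quat_def minus_quat_def uminus_quat_def
      scaleR_quat_def zero_quat_def one_quat_def of_real_def)

lemma qcnj_mult_self: "qcnj x * x = of_real ((norm x)\<^sup>2)" "x * qcnj x = of_real ((norm x)\<^sup>2)"
  by (auto simp: qcnj_def times_quat_def norm_quat_def inner_quat_def of_real_def scaleR_quat_def
      one_quat_def power2_eq_square algebra_simps)

lemma norm_qcnj [simp]: "norm (qcnj x) = norm x"
  by (simp add: qcnj_def norm_quat_def inner_quat_def)

lemma qcnj_eq_iff [simp]: "qcnj x = qcnj y \<longleftrightarrow> x = y" "qcnj x = 0 \<longleftrightarrow> x = 0"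
  by (metis qcnj_simps(6)) (metis qcnj_simps(6,7))

lemma qcnj_unit: "norm x = 1 \<Longrightarrow> qcnj x * x = 1" "norm x = 1 \<Longrightarrow> x * qcnj x = 1"
  by (simp_all add: qcnj_mult_self)

lemma norm_quat_squared: "(norm x)\<^sup>2 = (qre x)\<^sup>2 + (qi x)\<^sup>2 + (qj x)\<^sup>2 + (qk x)\<^sup>2"
  by (simp add: norm_quat_def inner_quat_def power2_eq_square)

lemma abs_qre_le_norm: "\<bar>qre x\<bar> \<le> norm x"
  by (rule power2_le_imp_le) (auto simp: norm_quat_squared)

lemma qcnj_eq_self_iff: "qcnj x = x \<longleftrightarrow> x = of_real (qre x)"
  by (cases x) (auto simp: qcnj_def of_real_def scaleR_quat_def one_quat_def)

lemma norm_eq_1_of_square: "norm (x * x) = 1 \<Longrightarrow> norm (x::quat) = 1"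
  by (metis norm_ge_zero norm_mult mult_nonneg_nonneg real_sqrt_mult_self real_sqrt_abs2 real_sqrt_one abs_of_nonneg)

section \<open>Imaginary units and what commutes with them\<close>

lemma square_neg_one:
  assumes "(u::quat) * u = - 1"
  shows "norm u = 1" "qcnj u = - u" "qre u = 0"
proof -
  show n: "norm u = 1"
    by (rule norm_eq_1_of_square) (simp add: assms)
  have "u * qcnj u = u * (- u)"
    using qcnj_unit(2)[OF n] assms by simp
  then show c: "qcnj u = - u"
    using n by (metis mult_left_cancel norm_zero zero_neq_one)
  show "qre u = 0"
    by (metis c qre_simps(8) qre_simps(3) equation_minus_iff neg_equal_zero)
qed

text \<open>The imaginary part \<open>y\<close> of \<open>x\<close> and the unit \<open>u\<close>
  are commuting skew elements, so \<open>y * u\<close> is its own conjugate, hence real, and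
  \<open>y\<close> is a real multiple of \<open>u\<close>. The centralizer of an imaginary unit is
  thus a copy of the complex numbers.\<close>

lemma commute_imaginary_unit:
  assumes "(u::quat) * u = - 1" and "x * u = u * x"
  obtains a b :: real where "x = of_real a + of_real b * u"
proof -
  note u = square_neg_one[OF assms(1)]
  define y where "y = x - of_real (qre x)"
  have yu: "y * u = u * y"
    unfolding y_def by (simp add: algebra_simps assms(2) of_real_def)
  have cy: "qcnj y = - y"
    unfolding y_def by (cases x) (simp add: qcnj_def of_real_def scaleR_quat_def one_quat_def
        minus_quat_def uminus_quat_def)
  have "qcnj (y * u) = y * u"
    by (simp add: u(2) cy) (simp add: yu)
  then have r: "y * u = of_real (qre (y * u))"
    by (simp only: qcnj_eq_self_iff)
  have "y = - (y * u * u)"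
    using assms(1) by (simp add: mult.assoc)
  also have "\<dots> = of_real (- qre (y * u)) * u"
    using r by simp
  finally have "x = of_real (qre x) + of_real (- qre (y * u)) * u"
    unfolding y_def by (simp add: algebra_simps)
  then show thesis
    using that by blast
qed

text \<open>By \<open>commute_imaginary_unit\<close> the element is \<open>a + b u\<close>;
  commuting with \<open>v\<close>, which anticommutes with \<open>u\<close>, leaves only
  \<open>b = 0\<close>.\<close>

lemma commute_anticommuting_units:
  assumes "(u::quat) * u = - 1" "v * v = - 1" "u * v = - (v * u)" and "x * u = u * x" "x * v = v * x"
  shows "x = of_real (qre x)"
proof -
  obtain a b where x: "x = of_real a + of_real b * u"
    using commute_imaginary_unit[OF assms(1,4)] .
  have "b *\<^sub>R (u * v) = b *\<^sub>R (v * u)"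
    using assms(5) unfolding x by (simp add: algebra_simps of_real_def)
  then have "b *\<^sub>R (u * v) = - (b *\<^sub>R (u * v))"
    by (simp add: assms(3))
  then have "2 *\<^sub>R (b *\<^sub>R (u * v)) = 0"
    by (metis add.right_inverse scaleR_2)
  moreover have "u \<noteq> 0" "v \<noteq> 0"
    using assms(1,2) by auto
  ultimately have "b = 0"
    by auto
  then show ?thesis
    using x by simp
qed

lemma qre_mult_commute: "qre (x * y) = qre (y * x)"
  by (simp add: times_quat_def)

text \<open>\<open>A\<close> commutes with \<open>u\<close> and \<open>B * v\<close> anticommutes
  with it, and these two planes are orthogonal: the element \<open>y\<close> anticommutes with
  \<open>u\<close>, so it has no real part, and its real part is the inner product up to
  sign.\<close>

lemma norm_add_anticommuting:
  assumes u: "(u::quat) * u = - 1" "v * v = - 1" "u * v = - (v * u)"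
    and A: "A * u = u * A" and B: "B * u = u * B"
  shows "(norm (A + B * v))\<^sup>2 = (norm A)\<^sup>2 + (norm B)\<^sup>2"
proof -
  note n = square_neg_one[OF u(1)] square_neg_one[OF u(2)]
  define y where "y = A * (v * qcnj B)"
  have "qcnj B * u = u * qcnj B"
    using arg_cong[OF B, of qcnj] n by simp
  then have "u * y = A * (u * v) * qcnj B" "y * u = A * (v * u) * qcnj B"
    unfolding y_def using A by (metis mult.assoc)+
  then have "u * y = - (y * u)"
    by (simp add: u(3))
  then have "u * (u * y) = - (u * y * u)"
    by (metis mult.assoc mult_minus_right)
  moreover have "u * (u * y) = - y"
    using u(1) by (simp flip: mult.assoc)
  moreover have "qre (u * y * u) = qre (u * (u * y))"
    by (rule qre_mult_commute)
  ultimately have "qre y = 0"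
    by simp
  moreover have "inner A (B * v) = - qre y"
    using n by (simp add: y_def inner_quat_def times_quat_def qcnj_def algebra_simps)
  ultimately have "(norm (A + B * v))\<^sup>2 = (norm A)\<^sup>2 + (norm (B * v))\<^sup>2"
    by (simp add: power2_norm_eq_inner inner_add_left inner_add_right inner_commute)
  then show ?thesis
    using n by (simp add: norm_mult)
qed

section \<open>Square roots of unit quaternions\<close>

lemma add_qcnj: "x + qcnj x = of_real (2 * qre x)"
  by (cases x) (simp add: qcnj_def plus_quat_def of_real_def scaleR_quat_def one_quat_def)

text \<open>The characteristic equation of a unit: \<open>x + qcnj x\<close> is real and
  \<open>qcnj x * x = 1\<close>.\<close>

lemma unit_square:
  assumes "norm x = 1"
  shows "x * x = (2 * qre x) *\<^sub>R x - 1"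
proof -
  have "(x + qcnj x) * x = (2 * qre x) *\<^sub>R x"
    unfolding add_qcnj by (simp add: of_real_def)
  then show ?thesis
    using qcnj_unit(1)[OF assms] by (simp add: algebra_simps)
qed

text \<open>The normalized midpoint of 1 and \<open>x\<close> halves the angle: by
  \<open>unit_square\<close> the square of \<open>1 + x\<close> is \<open>2 + 2 Re x\<close> times
  \<open>x\<close>, and this factor is the squared norm of \<open>1 + x\<close>. Only the antipode
  of 1 has no such midpoint.\<close>

lemma unit_sqrt_generic:
  fixes x :: quat
  assumes "norm x = 1" "x \<noteq> - 1"
  defines "y \<equiv> (1 + x) /\<^sub>R norm (1 + x)"
  shows "norm y = 1" "y * y = x"
proof -
  define r where "r = norm (1 + x)"
  have r0: "r \<noteq> 0"
    unfolding r_def using assms(2) by (simp add: add_eq_0_iff)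
  have r2: "r\<^sup>2 = 2 + 2 * qre x"
    using norm_quat_squared[of x] norm_quat_squared[of "1 + x"] assms(1)
    by (simp add: r_def plus_quat_def one_quat_def power2_eq_square algebra_simps)
  have "(1 + x) * (1 + x) = r\<^sup>2 *\<^sub>R x"
    unfolding r2 by (simp add: algebra_simps unit_square[OF assms(1)] scaleR_2)
  then show "y * y = x"
    unfolding y_def r_def[symmetric] using r0 by (simp add: power2_eq_square mult.assoc[symmetric])
  show "norm y = 1"
    unfolding y_def using r0 by (simp add: r_def)
qed

lemma unit_sqrt_commuting:
  assumes "(u::quat) * u = - 1" "x * u = u * x" "norm x = 1"
  obtains y where "norm y = 1" "y * y = x" "y * u = u * y"
proof (cases "x = - 1")
  case True
  then show ?thesis
    using that[of u] assms square_neg_one(1)[OF assms(1)] by simp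
next
  case False
  show ?thesis
    by (rule that[OF unit_sqrt_generic[OF assms(3) False]]) (simp add: algebra_simps assms(2))
qed

definition iq :: quat where "iq = Quat 0 1 0 0"
definition jq :: quat where "jq = Quat 0 0 1 0"

lemma iq_jq: "iq * iq = - 1" "jq * jq = - 1" "iq * jq = - (jq * iq)" "norm iq = 1" "norm jq = 1"
  by (simp_all add: iq_def jq_def times_quat_def one_quat_def uminus_quat_def norm_quat_def inner_quat_def)

lemma unit_sqrt:
  assumes "norm (x::quat) = 1"
  obtains y where "norm y = 1" "y * y = x"
  using that[of iq] that[OF unit_sqrt_generic[OF assms]] iq_jq by (cases "x = - 1") auto

text \<open>Both are roots of \<open>t\<^sup>2 - 2 Re(x) t + 1\<close>.\<close>

lemma commuting_units_eq_qre:
  assumes "norm x = 1" "norm z = 1" "x * z = z * x" "qre x = qre z"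
  shows "x = z \<or> x = qcnj z"
proof -
  have "(x - z) * (x - qcnj z) = x * x - x * (z + qcnj z) + z * qcnj z + (x * z - z * x)"
    by (simp add: algebra_simps)
  also have "\<dots> = 0"
    using assms by (simp add: unit_square qcnj_unit add_qcnj of_real_def)
  finally show ?thesis
    by simp
qed

text \<open>The image of a circle under \<open>\<sigma>\<close> commutes with the imaginary unit \<open>\<sigma> e\<close>, so the real part
  determines its points up to inversion, and the intermediate value theorem makes it a full circle.\<close>

lemma hom_circle_surj:
  fixes \<sigma> :: "quat \<Rightarrow> quat"
  assumes unit: "\<And>x. norm x = 1 \<Longrightarrow> norm (\<sigma> x) = 1"
    and hom: "\<And>x y. norm x = 1 \<Longrightarrow> norm y = 1 \<Longrightarrow> \<sigma> (x * y) = \<sigma> x * \<sigma> y"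
    and neg: "\<sigma> (- 1) = - 1"
    and cont: "\<And>\<gamma> :: real \<Rightarrow> quat. continuous_on UNIV \<gamma> \<Longrightarrow> (\<And>t. norm (\<gamma> t) = 1) \<Longrightarrow>
      continuous_on UNIV (\<lambda>t. \<sigma> (\<gamma> t))"
    and e: "e * e = - 1"
    and x: "norm x = 1" "x * \<sigma> e = \<sigma> e * x"
  obtains y where "norm y = 1" "\<sigma> y = x"
proof -
  note ne = square_neg_one[OF e]
  have one: "\<sigma> 1 = 1"
    using hom[of "- 1" "- 1"] neg by simp
  define u where "u = \<sigma> e"
  have u: "u * u = - 1"
    unfolding u_def using hom[of e e] neg e ne by simp
  define \<gamma> where "\<gamma> t = of_real (cos t) + of_real (sin t) * e" for t
  have cnj\<gamma>: "qcnj (\<gamma> t) = of_real (cos t) - of_real (sin t) * e" for t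
    unfolding \<gamma>_def using ne by (simp add: of_real_def)
  have "\<gamma> t * qcnj (\<gamma> t) = 1" for t
  proof -
    have "\<gamma> t * qcnj (\<gamma> t) = ((cos t)\<^sup>2 + (sin t)\<^sup>2) *\<^sub>R 1"
      unfolding cnj\<gamma> unfolding \<gamma>_def
      using e by (simp add: of_real_def algebra_simps power2_eq_square flip: scaleR_left_distrib)
    also have "\<dots> = 1"
      by simp
    finally show ?thesis .
  qed
  then have n\<gamma>: "norm (\<gamma> t) = 1" for t
    by (metis norm_eq_1_of_square norm_mult norm_one norm_qcnj)
  have comm: "\<sigma> (\<gamma> t) * u = u * \<sigma> (\<gamma> t)" for t
  proof -
    have "\<gamma> t * e = e * \<gamma> t"
      unfolding \<gamma>_def by (simp add: of_real_def algebra_simps)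
    then show ?thesis
      unfolding u_def by (metis hom n\<gamma> ne(1))
  qed
  have c\<gamma>: "continuous_on UNIV \<gamma>"
    unfolding \<gamma>_def by (intro continuous_intros)
  have c: "continuous_on UNIV (\<lambda>t. qre (\<sigma> (\<gamma> t)))"
  proof -
    have "qre z = inner z 1" for z :: quat
      by (simp add: inner_quat_def one_quat_def)
    then show ?thesis
      by (simp add: cont[OF c\<gamma> n\<gamma>] continuous_on_inner)
  qed
  \<comment> \<open>The path runs from 1 to \<open>u\<close>, whose real part is 0, so it meets
    every real part between 0 and 1. The other \<open>x\<close> are reached through
    \<open>- x\<close>.\<close>
  have real_part: "\<exists>y. norm y = 1 \<and> \<sigma> y = x" if x: "norm x = 1" "x * u = u * x" "qre x \<ge> 0" for x
  proof -
    have "qre (\<sigma> (\<gamma> 0)) = 1" "qre (\<sigma> (\<gamma> (pi / 2))) = 0"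
      using square_neg_one(3)[OF u] by (auto simp: \<gamma>_def one u_def)
    moreover have "qre x \<le> 1"
      using abs_qre_le_norm[of x] x by simp
    ultimately obtain t where t: "qre (\<sigma> (\<gamma> t)) = qre x"
      using IVT2'[of "\<lambda>t. qre (\<sigma> (\<gamma> t))" "pi / 2" "qre x" 0] x(3) continuous_on_subset[OF c]
      by auto
    obtain a b where "x = of_real a + of_real b * u"
      using commute_imaginary_unit[OF u x(2)] .
    then have "x * \<sigma> (\<gamma> t) = \<sigma> (\<gamma> t) * x"
      using comm[of t] by (simp add: algebra_simps of_real_def)
    then consider "x = \<sigma> (\<gamma> t)" | "x = qcnj (\<sigma> (\<gamma> t))"
      using commuting_units_eq_qre[OF x(1) unit[OF n\<gamma>] _ t[symmetric]] by blast
    then show ?thesis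
    proof cases
      case 2
      have "\<sigma> (qcnj (\<gamma> t)) * \<sigma> (\<gamma> t) = x * \<sigma> (\<gamma> t)"
        using hom[of "qcnj (\<gamma> t)" "\<gamma> t"] n\<gamma>[of t] unit[OF n\<gamma>] one by (simp add: 2 qcnj_unit)
      then have "\<sigma> (qcnj (\<gamma> t)) = x"
        using unit[OF n\<gamma>, of t] by auto
      then show ?thesis
        using n\<gamma>[of t] by (metis norm_qcnj)
    qed (use n\<gamma>[of t] in auto)
  qed
  show thesis
  proof (cases "qre x \<ge> 0")
    case True
    then show ?thesis
      using real_part[of x] x that unfolding u_def by auto
  next
    case False
    then obtain y where y: "norm y = 1" "\<sigma> y = - x"
      using real_part[of "- x"] x that unfolding u_def by auto
    then have "\<sigma> (- y) = x"
      using hom[of "- 1" y] neg by simp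
    then show ?thesis
      using y that[of "- y"] by simp
  qed
qed

text \<open>Euler angles: the image contains the centralizer circles of the anticommuting units
  \<open>u\<close> and \<open>v\<close> by \<open>hom_circle_surj\<close>, and every unit is a
  product \<open>z * h * w\<close> with \<open>z\<close> and \<open>w\<close> on the circle of
  \<open>u\<close> and \<open>h\<close> on that of \<open>v\<close>.\<close>

lemma continuous_unit_hom_surj:
  fixes \<sigma> :: "quat \<Rightarrow> quat"
  assumes unit: "\<And>x. norm x = 1 \<Longrightarrow> norm (\<sigma> x) = 1"
    and hom: "\<And>x y. norm x = 1 \<Longrightarrow> norm y = 1 \<Longrightarrow> \<sigma> (x * y) = \<sigma> x * \<sigma> y"
    and neg: "\<sigma> (- 1) = - 1"
    and cont: "\<And>\<gamma> :: real \<Rightarrow> quat. continuous_on UNIV \<gamma> \<Longrightarrow> (\<And>t. norm (\<gamma> t) = 1) \<Longrightarrow>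
      continuous_on UNIV (\<lambda>t. \<sigma> (\<gamma> t))"
    and x: "norm x = 1"
  obtains y where "norm y = 1" "\<sigma> y = x"
proof -
  define u v where "u = \<sigma> iq" and "v = \<sigma> jq"
  have u: "u * u = - 1" and v: "v * v = - 1" and uv: "u * v = - (v * u)"
  proof -
    show "u * u = - 1" "v * v = - 1"
      unfolding u_def v_def by (simp_all add: hom[symmetric] iq_jq neg)
    have "u * v = \<sigma> ((- 1) * (jq * iq))"
      unfolding u_def v_def by (simp add: hom[symmetric] iq_jq)
    also have "\<dots> = - (v * u)"
      unfolding u_def v_def by (subst hom) (simp_all add: hom iq_jq norm_mult neg)
    finally show "u * v = - (v * u)" .
  qed
  note nu = square_neg_one[OF u] square_neg_one[OF v]
  define I where "I = \<sigma> ` {y. norm y = 1}"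
  have I_mult: "a * b \<in> I" if "a \<in> I" "b \<in> I" for a b
    using that unfolding I_def by (auto simp: hom[symmetric] norm_mult)
  have Iu: "a \<in> I" if "norm a = 1" "a * u = u * a" for a
    using that unfolding I_def u_def
    by (auto intro: hom_circle_surj[OF unit hom neg cont iq_jq(1), of a])
  have Iv: "a \<in> I" if "norm a = 1" "a * v = v * a" for a
    using that unfolding I_def v_def
    by (auto intro: hom_circle_surj[OF unit hom neg cont iq_jq(2), of a])
  \<comment> \<open>Since \<open>- u\<close> is the inverse of \<open>u\<close>, the element
    \<open>- u * x * u\<close> is a conjugate of \<open>x\<close>. Averaging the two gives the part
    \<open>A\<close> commuting with \<open>u\<close>; half their difference is the anticommuting
    part, written as \<open>B * v\<close>.\<close>
  define A where "A = (1/2) *\<^sub>R (x - u * x * u)"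
  define B where "B = (- 1/2) *\<^sub>R ((x + u * x * u) * v)"
  have uu: "u * (u * z) = - z" for z
    using u by (simp flip: mult.assoc)
  have vv: "z * v * v = - z" for z
    using v by (simp add: mult.assoc)
  have Au: "A * u = u * A"
    unfolding A_def by (simp add: algebra_simps u uu)
  have vu: "v * u = - (u * v)"
    using uv by simp
  have Bu: "B * u = u * B"
    unfolding B_def by (simp add: algebra_simps u uu vu)
  have xAB: "x = A + B * v"
  proof -
    have "B * v = (1/2) *\<^sub>R (x + u * x * u)"
      unfolding B_def mult_scaleR_left vv by (simp add: scaleR_add_right scaleR_diff_right)
    then show ?thesis
      unfolding A_def by (simp flip: scaleR_add_right scaleR_2)
  qed
  have AB: "(norm A)\<^sup>2 + (norm B)\<^sup>2 = 1"
    using norm_add_anticommuting[OF u v uv Au Bu] x unfolding xAB by simp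
  have polar: "\<exists>\<alpha>. norm \<alpha> = 1 \<and> \<alpha> * u = u * \<alpha> \<and> C = norm C *\<^sub>R \<alpha>" if "C * u = u * C" for C
  proof (cases "C = 0")
    case False
    then show ?thesis
      using that by (intro exI[of _ "C /\<^sub>R norm C"]) auto
  qed (auto intro!: exI[of _ 1])
  obtain \<alpha> where \<alpha>: "norm \<alpha> = 1" "\<alpha> * u = u * \<alpha>" "A = norm A *\<^sub>R \<alpha>"
    using polar[OF Au] by auto
  obtain \<beta> where \<beta>: "norm \<beta> = 1" "\<beta> * u = u * \<beta>" "B = norm B *\<^sub>R \<beta>"
    using polar[OF Bu] by auto
  have cc: "a * b = b * a" if ab: "a * u = u * a" "b * u = u * b" for a b
  proof -
    obtain c d where "a = of_real c + of_real d * u"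
      using commute_imaginary_unit[OF u ab(1)] .
    then show ?thesis
      using ab(2) by (simp add: algebra_simps of_real_def)
  qed
  have cj: "qcnj a * u = u * qcnj a" if "a * u = u * a" for a
    using that nu by (metis qcnj_simps(4) minus_equation_iff mult_minus_left mult_minus_right)
  have cv: "v * a = qcnj a * v" if a: "a * u = u * a" for a
  proof -
    obtain c d where "a = of_real c + of_real d * u"
      using commute_imaginary_unit[OF u a] .
    then show ?thesis
      using nu by (simp add: algebra_simps of_real_def vu)
  qed
  \<comment> \<open>The factors must satisfy \<open>z * w = \<alpha>\<close> and, since moving
    \<open>v\<close> past the circle of \<open>u\<close> conjugates,
    \<open>z * qcnj w = \<beta>\<close>. On this commutative circle the product of the two equations
    is \<open>z * z = \<alpha> * \<beta>\<close>.\<close>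
  have "(\<alpha> * \<beta>) * u = u * (\<alpha> * \<beta>)"
    using \<alpha> \<beta> by (metis mult.assoc)
  then obtain z where z: "norm z = 1" "z * z = \<alpha> * \<beta>" "z * u = u * z"
    using unit_sqrt_commuting[OF u, of "\<alpha> * \<beta>"] \<alpha>(1) \<beta>(1) by (metis norm_mult mult_1)
  define w where "w = qcnj z * \<alpha>"
  have wu: "w * u = u * w"
    unfolding w_def using cj[OF z(3)] \<alpha>(2) by (metis mult.assoc)
  have zw: "z * w = \<alpha>"
    unfolding w_def using qcnj_unit(2)[OF z(1)] by (simp flip: mult.assoc)
  have "z * qcnj w = qcnj \<alpha> * (z * z)"
    unfolding w_def using cc[OF z(3) cj[OF \<alpha>(2)]] by (simp flip: mult.assoc)
  then have zw': "z * qcnj w = \<beta>"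
    using z(2) qcnj_unit(1)[OF \<alpha>(1)] by (simp flip: mult.assoc)
  define h where "h = of_real (norm A) + of_real (norm B) * v"
  have "z * h * w = x"
  proof -
    have "z * h * w = norm A *\<^sub>R (z * w) + norm B *\<^sub>R (z * (v * w))"
      unfolding h_def by (simp add: algebra_simps of_real_def)
    also have "\<dots> = norm A *\<^sub>R \<alpha> + norm B *\<^sub>R (\<beta> * v)"
      using zw zw' cv[OF wu] by (simp flip: mult.assoc)
    finally show ?thesis
      using xAB \<alpha>(3) \<beta>(3) by (metis mult_scaleR_left)
  qed
  moreover have "h \<in> I"
  proof (rule Iv)
    show "h * v = v * h"
      unfolding h_def by (simp add: algebra_simps of_real_def)
    have "norm (z * h * w) = norm h"
      using z(1) \<alpha>(1) by (simp add: norm_mult w_def)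
    then show "norm h = 1"
      using \<open>z * h * w = x\<close> x by simp
  qed
  moreover have "z \<in> I" "w \<in> I"
    using Iu z wu \<alpha>(1) by (auto simp: w_def norm_mult)
  ultimately have "x \<in> I"
    using I_mult by metis
  then show thesis
    using that unfolding I_def by auto
qed

section \<open>Linear algebra over the quaternions\<close>

text \<open>Elimination of one unknown by an equation with a pivot. All coefficients stand to the
  left of the unknowns, so the argument works over any division ring.\<close>

lemma underdetermined_system:
  fixes A :: "'i \<Rightarrow> 'j \<Rightarrow> 'a::division_ring"
  assumes "finite I" "finite J" "card I < card J"
  shows "\<exists>x. (\<exists>j\<in>J. x j \<noteq> 0) \<and> (\<forall>i\<in>I. (\<Sum>j\<in>J. A i j * x j) = 0)"
  using assms
proof (induction I arbitrary: J A rule: finite_induct)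
  case empty
  then obtain j where "j \<in> J"
    by (metis card_gt_0_iff card.empty ex_in_conv)
  then show ?case
    by (intro exI[of _ "\<lambda>_. 1"]) auto
next
  case (insert i I)
  show ?case
  proof (cases "\<forall>j\<in>J. A i j = 0")
    case True
    then show ?thesis
      using insert.IH[of J A] insert.prems insert.hyps by auto
  next
    case False
    then obtain k where k: "k \<in> J" "A i k \<noteq> 0"
      by auto
    define J' where "J' = J - {k}"
    have J': "finite J'" "card I < card J'" "k \<notin> J'" "J = insert k J'"
      using k insert.prems insert.hyps by (auto simp: J'_def)
    obtain x where x: "\<exists>j\<in>J'. x j \<noteq> 0"
      "\<forall>l\<in>I. (\<Sum>j\<in>J'. (A l j - A l k * inverse (A i k) * A i j) * x j) = 0"
      using insert.IH[of J' "\<lambda>l j. A l j - A l k * inverse (A i k) * A i j"] J' by auto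
    define y where "y = x(k := - (inverse (A i k) * (\<Sum>j\<in>J'. A i j * x j)))"
    have s: "(\<Sum>j\<in>J. A l j * y j) = A l k * y k + (\<Sum>j\<in>J'. A l j * x j)" for l
    proof -
      have "(\<Sum>j\<in>J'. A l j * y j) = (\<Sum>j\<in>J'. A l j * x j)"
        by (rule sum.cong) (use J' in \<open>auto simp: y_def\<close>)
      then show ?thesis
        using J' by simp
    qed
    have "(\<Sum>j\<in>J. A i j * y j) = 0"
      unfolding s using k by (simp add: y_def flip: mult.assoc)
    moreover have "(\<Sum>j\<in>J. A l j * y j) = 0" if "l \<in> I" for l
    proof -
      have "(\<Sum>j\<in>J'. A l j * x j) - A l k * inverse (A i k) * (\<Sum>j\<in>J'. A i j * x j) = 0"
        using x(2) that by (simp add: sum_distrib_left sum_subtractf left_diff_distrib mult.assoc)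
      then show ?thesis
        unfolding s by (simp add: y_def mult.assoc)
    qed
    moreover have "\<exists>j\<in>J. y j \<noteq> 0"
      using x(1) J' by (auto simp: y_def)
    ultimately show ?thesis
      by (intro exI[of _ y]) auto
  qed
qed

section \<open>Products and one-sided inverses of matrices\<close>

declare index_mult_mat(1) [simp del]

lemma mat_mult_entry:
  assumes "A \<in> carrier_mat n n" "B \<in> carrier_mat n n" "i < n" "j < n"
  shows "(A * B) $$ (i, j) = (\<Sum>k<n. A $$ (i, k) * B $$ (k, j))"
  using assms by (simp add: index_mult_mat(1) scalar_prod_def atLeast0LessThan)

text \<open>The \<open>n\<close> columns of \<open>B\<close> and the \<open>i\<close>-th basis
  vector are dependent. Applying \<open>A\<close> expresses all coefficients through the last one,
  which is therefore nonzero, and the relation then says that \<open>B * A\<close> fixes the basis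
  vector.\<close>

lemma left_inverse_imp_right_inverse_mat:
  fixes A B :: "'a::division_ring mat"
  assumes A: "A \<in> carrier_mat n n" and B: "B \<in> carrier_mat n n" and AB: "A * B = 1\<^sub>m n"
  shows "B * A = 1\<^sub>m n"
proof (rule eq_matI)
  fix r i assume "r < dim_row (1\<^sub>m n :: 'a mat)" "i < dim_col (1\<^sub>m n :: 'a mat)"
  then have ri: "r < n" "i < n" by auto
  obtain x where x: "\<exists>j\<in>{..n}. x j \<noteq> 0"
    "\<forall>r\<in>{..<n}. (\<Sum>j\<le>n. (if j < n then B $$ (r, j) else if r = i then 1 else 0) * x j) = 0"
    using underdetermined_system[of "{..<n}" "{..n}"
      "\<lambda>r j. if j < n then B $$ (r, j) else if r = i then 1 else 0"] by auto
  have split: "(\<Sum>j<n. B $$ (r, j) * x j) = - (if r = i then x n else 0)" if "r < n" for r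
  proof -
    have "{..n} = insert n {..<n}" by auto
    moreover have "(\<Sum>j<n. (if j < n then B $$ (r, j) else if r = i then 1 else 0) * x j)
        = (\<Sum>j<n. B $$ (r, j) * x j)"
      by (rule sum.cong) auto
    ultimately show ?thesis
      using x(2)[rule_format, of r] that by (auto simp: eq_neg_iff_add_eq_0 add.commute)
  qed
  have xs: "x s = - (A $$ (s, i) * x n)" if s: "s < n" for s
  proof -
    have "x s = (\<Sum>j<n. (A * B) $$ (s, j) * x j)"
      using s by (simp add: AB mult_delta_left)
    also have "\<dots> = (\<Sum>j<n. \<Sum>k<n. A $$ (s, k) * (B $$ (k, j) * x j))"
      using s by (simp add: mat_mult_entry[OF A B] sum_distrib_right mult.assoc)
    also have "\<dots> = (\<Sum>k<n. A $$ (s, k) * (\<Sum>j<n. B $$ (k, j) * x j))"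
      by (subst sum.swap) (simp add: sum_distrib_left)
    also have "\<dots> = (\<Sum>k<n. A $$ (s, k) * - (if k = i then x n else 0))"
      by (rule sum.cong) (auto simp: split)
    also have "\<dots> = - (A $$ (s, i) * x n)"
      using ri by (simp add: sum_negf mult_delta_right)
    finally show ?thesis .
  qed
  have xn: "x n \<noteq> 0"
  proof
    assume "x n = 0"
    then have "x j = 0" if "j \<le> n" for j
      using xs[of j] that by (cases "j = n") auto
    then show False
      using x(1) by auto
  qed
  have "(B * A) $$ (r, i) * x n = (\<Sum>j<n. B $$ (r, j) * (A $$ (j, i) * x n))"
    using ri by (simp add: mat_mult_entry[OF B A] sum_distrib_right mult.assoc)
  also have "\<dots> = - (\<Sum>j<n. B $$ (r, j) * x j)"
    unfolding sum_negf[symmetric] by (rule sum.cong) (auto simp: xs)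
  also have "\<dots> = (if r = i then 1 else 0) * x n"
    using split[OF ri(1)] by simp
  finally show "(B * A) $$ (r, i) = 1\<^sub>m n $$ (r, i)"
    using xn ri by simp
qed (use A B in auto)

section \<open>Frames of diagonal hermitian forms and their inverses\<close>

definition signs :: "(nat \<Rightarrow> real) \<Rightarrow> bool" where
  "signs e \<longleftrightarrow> (\<forall>i. e i = 1 \<or> e i = - 1)"

lemma signs_nonzero: "signs e \<Longrightarrow> e i \<noteq> 0"
  unfolding signs_def by (metis zero_neq_neg_one zero_neq_one)

lemma signs_square: "signs e \<Longrightarrow> e i * e i = 1"
  unfolding signs_def by (metis mult_1 mult_minus_left mult_minus_right minus_minus)


text \<open>\<open>frames n b e\<close> consists of the matrices \<open>P\<close> with \<open>P\<^sup>* diag(b) P = diag(e)\<close>. Their columns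
  are the orthogonal bases of the hermitian form \<open>diag(b)\<close> on which it takes the values \<open>e\<close>.\<close>

definition frames :: "nat \<Rightarrow> (nat \<Rightarrow> real) \<Rightarrow> (nat \<Rightarrow> real) \<Rightarrow> quat mat set" where
  "frames n b e = {P \<in> carrier_mat n n. \<forall>i<n. \<forall>j<n.
     (\<Sum>k<n. b k *\<^sub>R (qcnj (P $$ (k, i)) * P $$ (k, j))) = (if i = j then of_real (e i) else 0)}"

abbreviation isom :: "nat \<Rightarrow> (nat \<Rightarrow> real) \<Rightarrow> quat mat set" where
  "isom n e \<equiv> frames n e e"

text \<open>The matrix diag(e) P^* diag(b). As a sign is its own inverse, the frame condition P^*
  diag(b) P = diag(e) says that this is a left inverse of \<open>P\<close>.\<close>

definition finv :: "nat \<Rightarrow> (nat \<Rightarrow> real) \<Rightarrow> (nat \<Rightarrow> real) \<Rightarrow> quat mat \<Rightarrow> quat mat" where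
  "finv n b e P = mat n n (\<lambda>(i, j). (e i * b j) *\<^sub>R qcnj (P $$ (j, i)))"

lemma finv_carrier [simp]: "finv n b e P \<in> carrier_mat n n" "dim_row (finv n b e P) = n"
  "dim_col (finv n b e P) = n"
  by (auto simp: finv_def)

lemma finv_entry [simp]: "i < n \<Longrightarrow> j < n \<Longrightarrow> finv n b e P $$ (i, j) = (e i * b j) *\<^sub>R qcnj (P $$ (j, i))"
  by (simp add: finv_def)

lemma frames_carrier: "P \<in> frames n b e \<Longrightarrow> P \<in> carrier_mat n n"
  by (simp add: frames_def)

lemma frames_column:
  "P \<in> frames n b e \<Longrightarrow> i < n \<Longrightarrow> j < n \<Longrightarrow>
    (\<Sum>k<n. b k *\<^sub>R (qcnj (P $$ (k, i)) * P $$ (k, j))) = (if i = j then of_real (e i) else 0)"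
  by (simp add: frames_def)

lemma frames_iff_finv:
  assumes "signs e"
  shows "P \<in> frames n b e \<longleftrightarrow> P \<in> carrier_mat n n \<and> finv n b e P * P = 1\<^sub>m n"
proof -
  have "(finv n b e P * P) $$ (i, j) = e i *\<^sub>R (\<Sum>k<n. b k *\<^sub>R (qcnj (P $$ (k, i)) * P $$ (k, j)))"
    if "P \<in> carrier_mat n n" "i < n" "j < n" for i j
    using that by (simp add: mat_mult_entry[of _ n] scaleR_sum_right)
  moreover have "e i *\<^sub>R x = (if i = j then 1 else 0) \<longleftrightarrow> x = (if i = j then of_real (e i) else 0)" for i j and x :: quat
    using assms unfolding signs_def of_real_def
    by (cases "e i = 1") (auto simp: minus_equation_iff[of x] eq_commute[of "- 1"])
  moreover have "dim_row P = n \<and> dim_col P = n" if "P \<in> carrier_mat n n"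
    using that by auto
  ultimately show ?thesis
    unfolding frames_def by (simp add: mat_eq_iff cong: conj_cong)
qed

lemma finv_finv:
  assumes "signs b" "signs e" "P \<in> carrier_mat n n"
  shows "finv n e b (finv n b e P) = P"
proof (rule eq_matI)
  fix i j assume "i < dim_row P" "j < dim_col P"
  moreover have "b i * e j * (e j * b i) = (b i * b i) * (e j * e j)"
    by (simp only: ac_simps)
  ultimately show "finv n e b (finv n b e P) $$ (i, j) = P $$ (i, j)"
    using assms by (simp add: signs_square)
qed (use assms in auto)

lemma finv_left: "signs e \<Longrightarrow> P \<in> frames n b e \<Longrightarrow> finv n b e P * P = 1\<^sub>m n"
  by (simp add: frames_iff_finv)

lemma finv_right: "signs e \<Longrightarrow> P \<in> frames n b e \<Longrightarrow> P * finv n b e P = 1\<^sub>m n"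
  by (rule left_inverse_imp_right_inverse_mat) (auto simp: finv_left frames_carrier)

text \<open>\<open>finv\<close> is involutive, so this is the frame condition read for the right
  inverse; the content is that one-sided inverses are two-sided.\<close>

lemma finv_in_frames:
  "signs b \<Longrightarrow> signs e \<Longrightarrow> P \<in> frames n b e \<Longrightarrow> finv n b e P \<in> frames n e b"
  by (simp add: frames_iff_finv[of b] finv_finv finv_right frames_carrier)

lemma finv_mult:
  assumes "signs e" and P: "P \<in> carrier_mat n n" and Q: "Q \<in> carrier_mat n n"
  shows "finv n b g (P * Q) = finv n e g Q * finv n b e P"
proof (rule eq_matI)
  fix i j assume "i < dim_row (finv n e g Q * finv n b e P)" "j < dim_col (finv n e g Q * finv n b e P)"
  then have ij: "i < n" "j < n" by auto
  have e: "g i * e k * (e k * b j) = g i * b j" for k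
  proof -
    have "g i * e k * (e k * b j) = (e k * e k) * (g i * b j)"
      by (simp only: ac_simps)
    then show ?thesis
      by (simp add: signs_square[OF assms(1)])
  qed
  have "(finv n e g Q * finv n b e P) $$ (i, j)
      = (\<Sum>k<n. (g i * e k * (e k * b j)) *\<^sub>R (qcnj (Q $$ (k, i)) * qcnj (P $$ (j, k))))"
    using ij by (simp add: mat_mult_entry[of _ n] ac_simps)
  then show "finv n b g (P * Q) $$ (i, j) = (finv n e g Q * finv n b e P) $$ (i, j)"
    using ij unfolding e by (simp add: mat_mult_entry[OF P Q] qcnj_sum scaleR_sum_right)
qed (use P Q in auto)

lemma frames_mult:
  assumes s: "signs e" "signs g" and P: "P \<in> frames n b e" and Q: "Q \<in> frames n e g"
  shows "P * Q \<in> frames n b g"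
proof -
  note c = frames_carrier[OF P] frames_carrier[OF Q]
  have "finv n e g Q * finv n b e P * (P * Q) = finv n e g Q * (finv n b e P * P) * Q"
    using c by (simp add: assoc_mult_mat[of _ n n _ n _ n] mult_carrier_mat[of _ n n _ n])
  also have "\<dots> = 1\<^sub>m n"
    using c by (simp add: finv_left[OF s(1) P] finv_left[OF s(2) Q])
  finally show ?thesis
    using c s by (simp add: frames_iff_finv finv_mult[OF s(1) c])
qed

lemma one_in_frames: "1\<^sub>m n \<in> isom n e"
  unfolding frames_def by (auto simp: if_distrib[of "scaleR _"] if_distrib[of qcnj] mult_delta_left
      of_real_def cong: if_cong)

definition qdiag :: "nat \<Rightarrow> (nat \<Rightarrow> quat) \<Rightarrow> quat mat" where
  "qdiag n d = mat n n (\<lambda>(i, j). if i = j then d i else 0)"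

lemma qdiag_carrier [simp]: "qdiag n d \<in> carrier_mat n n" "dim_row (qdiag n d) = n" "dim_col (qdiag n d) = n"
  by (auto simp: qdiag_def)

lemma qdiag_entry [simp]: "i < n \<Longrightarrow> j < n \<Longrightarrow> qdiag n d $$ (i, j) = (if i = j then d i else 0)"
  by (simp add: qdiag_def)

lemma qdiag_mult_entry [simp]:
  assumes "A \<in> carrier_mat n n" "i < n" "j < n"
  shows "(qdiag n d * A) $$ (i, j) = d i * A $$ (i, j)" "(A * qdiag n d) $$ (i, j) = A $$ (i, j) * d j"
  using assms by (simp_all add: mat_mult_entry[of _ n] mult_delta_left mult_delta_right)

lemma qdiag_mult: "qdiag n d * qdiag n d' = qdiag n (\<lambda>i. d i * d' i)"
  by (rule eq_matI) auto

lemma qdiag_one: "qdiag n (\<lambda>_. 1) = 1\<^sub>m n"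
  by (rule eq_matI) auto

lemma qdiag_cong: "(\<And>i. i < n \<Longrightarrow> d i = d' i) \<Longrightarrow> qdiag n d = qdiag n d'"
  by (rule eq_matI) auto

lemma qdiag_in_frames: "(\<And>i. i < n \<Longrightarrow> norm (d i) = 1) \<Longrightarrow> qdiag n d \<in> isom n e"
  unfolding frames_def
  by (auto simp: if_distrib[of "scaleR _"] if_distrib[of qcnj] mult_delta_left
      of_real_def qcnj_unit cong: if_cong)

lemma frames_isolated_column_norm:
  assumes e: "signs e" and X: "X \<in> isom n e" and c: "c < n"
    and z: "\<And>a. a < n \<Longrightarrow> a \<noteq> c \<Longrightarrow> X $$ (a, c) = 0"
  shows "norm (X $$ (c, c)) = 1"
proof -
  have "(\<Sum>k<n. e k *\<^sub>R (qcnj (X $$ (k, c)) * X $$ (k, c))) = e c *\<^sub>R (qcnj (X $$ (c, c)) * X $$ (c, c))"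
    using c by (subst sum.remove[of _ c]) (auto simp: z)
  then have "e c *\<^sub>R of_real ((norm (X $$ (c, c)))\<^sup>2) = (of_real (e c) :: quat)"
    using frames_column[OF X c c] by (simp add: qcnj_mult_self)
  then have "e c * (norm (X $$ (c, c)))\<^sup>2 = e c"
    by (metis of_real_def of_real_eq_iff scaleR_scaleR)
  then have "(norm (X $$ (c, c)))\<^sup>2 = 1"
    using e unfolding signs_def by (metis mult_cancel_left1 mult_minus1 neg_equal_iff_equal one_neq_zero)
  then show ?thesis
    by (simp add: power2_eq_1_iff) (metis norm_ge_zero le_minus_one_simps(3))
qed

lemma qdiag_in_framesD:
  assumes "signs e" "qdiag n d \<in> isom n e" "i < n"
  shows "norm (d i) = 1"
  using frames_isolated_column_norm[OF assms] assms(3) by simp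

section \<open>Hermitian forms\<close>

definition hform :: "nat \<Rightarrow> (nat \<Rightarrow> real) \<Rightarrow> (nat \<Rightarrow> quat) \<Rightarrow> (nat \<Rightarrow> quat) \<Rightarrow> quat" where
  "hform n b x y = (\<Sum>k<n. b k *\<^sub>R (qcnj (x k) * y k))"

text \<open>Vectors are functions on all of \<open>nat\<close> of which only the values below
  \<open>n\<close> count, so vector equations appear pointwise below \<open>n\<close>. Matrices act
  on the left, quaternionic scalars on the right.\<close>

definition mat_app :: "nat \<Rightarrow> quat mat \<Rightarrow> (nat \<Rightarrow> quat) \<Rightarrow> nat \<Rightarrow> quat" where
  "mat_app n A x i = (\<Sum>j<n. A $$ (i, j) * x j)"

lemma hform_cong:
  "(\<And>k. k < n \<Longrightarrow> x k = x' k) \<Longrightarrow> (\<And>k. k < n \<Longrightarrow> y k = y' k) \<Longrightarrow> hform n b x y = hform n b x' y'"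
  by (simp add: hform_def)

lemma hform_simps:
  "hform n b x (\<lambda>k. y k + z k) = hform n b x y + hform n b x z"
  "hform n b (\<lambda>k. x k + y k) z = hform n b x z + hform n b y z"
  "hform n b x (\<lambda>k. y k - z k) = hform n b x y - hform n b x z"
  "hform n b (\<lambda>k. x k - y k) z = hform n b x z - hform n b y z"
  "hform n b x (\<lambda>k. r *\<^sub>R y k) = r *\<^sub>R hform n b x y"
  "hform n b (\<lambda>k. r *\<^sub>R x k) y = r *\<^sub>R hform n b x y"
  "hform n b x (\<lambda>k. y k * \<mu>) = hform n b x y * \<mu>"
  "hform n b (\<lambda>k. x k * \<mu>) y = qcnj \<mu> * hform n b x y"
  by (simp_all add: hform_def sum.distrib sum_subtractf algebra_simps scaleR_sum_right
      sum_distrib_left sum_distrib_right)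

lemma hform_sum: "hform n b x (\<lambda>k. \<Sum>a\<in>S. y a k) = (\<Sum>a\<in>S. hform n b x (y a))"
  unfolding hform_def by (subst sum.swap) (simp add: sum_distrib_left scaleR_sum_right)

lemma hform_sum_left: "hform n b (\<lambda>k. \<Sum>a\<in>S. y a k) x = (\<Sum>a\<in>S. hform n b (y a) x)"
  unfolding hform_def by (subst sum.swap) (simp add: qcnj_sum sum_distrib_right scaleR_sum_right)

lemma hform_cnj: "qcnj (hform n b x y) = hform n b y x"
  by (simp add: hform_def qcnj_sum)

lemma hform_self_real: "hform n b x x = of_real (qre (hform n b x x))"
  using hform_cnj[of n b x x] by (simp add: qcnj_eq_self_iff)

lemma mat_app_mult:
  assumes "A \<in> carrier_mat n n" "B \<in> carrier_mat n n" "i < n"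
  shows "mat_app n (A * B) x i = mat_app n A (mat_app n B x) i"
proof -
  have "mat_app n (A * B) x i = (\<Sum>j<n. \<Sum>k<n. A $$ (i, k) * (B $$ (k, j) * x j))"
    unfolding mat_app_def using assms by (simp add: mat_mult_entry[OF assms(1,2)] sum_distrib_right mult.assoc)
  also have "\<dots> = mat_app n A (mat_app n B x) i"
    unfolding mat_app_def by (subst sum.swap) (simp add: sum_distrib_left)
  finally show ?thesis .
qed

lemma mat_app_cong: "(\<And>k. k < n \<Longrightarrow> x k = y k) \<Longrightarrow> mat_app n A x i = mat_app n A y i"
  by (simp add: mat_app_def)

lemma mat_app_one: "i < n \<Longrightarrow> mat_app n (1\<^sub>m n) x i = x i"
  by (simp add: mat_app_def mult_delta_left)

lemma mat_app_simps:
  "mat_app n A (\<lambda>k. x k + y k) i = mat_app n A x i + mat_app n A y i"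
  "mat_app n A (\<lambda>k. x k - y k) i = mat_app n A x i - mat_app n A y i"
  "mat_app n A (\<lambda>k. r *\<^sub>R x k) i = r *\<^sub>R mat_app n A x i"
  by (simp_all add: mat_app_def sum.distrib sum_subtractf algebra_simps scaleR_sum_right)

lemma hform_mat_app:
  assumes "A \<in> frames n b e"
  shows "hform n b (mat_app n A x) (mat_app n A y) = hform n e x y"
proof -
  have "hform n b (mat_app n A x) (mat_app n A y)
      = (\<Sum>k<n. \<Sum>i<n. \<Sum>j<n. b k *\<^sub>R (qcnj (x i) * (qcnj (A $$ (k, i)) * A $$ (k, j)) * y j))"
    unfolding hform_def mat_app_def
    by (simp add: qcnj_sum sum_distrib_right sum_distrib_left scaleR_sum_right mult.assoc)
      (rule sum.cong[OF refl], rule sum.swap)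
  also have "\<dots> = (\<Sum>i<n. \<Sum>j<n. \<Sum>k<n. b k *\<^sub>R (qcnj (x i) * (qcnj (A $$ (k, i)) * A $$ (k, j)) * y j))"
    by (subst sum.swap) (intro sum.cong refl sum.swap)
  also have "\<dots> = (\<Sum>i<n. \<Sum>j<n. qcnj (x i) *
      (\<Sum>k<n. b k *\<^sub>R (qcnj (A $$ (k, i)) * A $$ (k, j))) * y j)"
    by (simp add: sum_distrib_left sum_distrib_right)
  also have "\<dots> = (\<Sum>i<n. \<Sum>j<n. if i = j then e i *\<^sub>R (qcnj (x i) * y i) else 0)"
    by (intro sum.cong refl) (auto simp: frames_column[OF assms] of_real_def)
  also have "\<dots> = hform n e x y"
    by (simp add: hform_def)
  finally show ?thesis .
qed

text \<open>Sylvester's law of inertia. With more positive values in \<open>e\<close> than in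
  \<open>b\<close>, some nonzero combination of the \<open>e\<close>-positive columns of
  \<open>P\<close> has vanishing \<open>b\<close>-positive coordinates; the form would be both
  positive and nonpositive on it.\<close>

lemma frames_inertia_le:
  assumes "signs b" "signs e" and P: "P \<in> frames n b e"
  shows "card {i. i < n \<and> e i = 1} \<le> card {i. i < n \<and> b i = 1}"
proof (rule ccontr)
  assume neg: "\<not> ?thesis"
  let ?I = "{i. i < n \<and> b i = 1}" and ?J = "{i. i < n \<and> e i = 1}"
  obtain x where x: "\<exists>j\<in>?J. x j \<noteq> 0" "\<forall>i\<in>?I. (\<Sum>j\<in>?J. P $$ (i, j) * x j) = 0"
    using underdetermined_system[of ?I ?J "\<lambda>i j. P $$ (i, j)"] neg by auto
  define y where "y j = (if j \<in> ?J then x j else 0)" for j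
  define z where "z = mat_app n P y"
  have z0: "z i = 0" if "i < n" "b i = 1" for i
  proof -
    have "z i = (\<Sum>j\<in>?J. P $$ (i, j) * x j)"
      unfolding z_def mat_app_def y_def by (rule sum.mono_neutral_cong_right) auto
    then show ?thesis using x that by auto
  qed
  have q: "qre (hform n c w w) = (\<Sum>k<n. c k * (norm (w k))\<^sup>2)" for c w
  proof -
    have "hform n c w w = of_real (\<Sum>k<n. c k * (norm (w k))\<^sup>2)"
      unfolding hform_def of_real_sum
      by (rule sum.cong) (auto simp: qcnj_mult_self of_real_def)
    then show ?thesis by (simp only: qre_simps)
  qed
  have "(\<Sum>k<n. b k * (norm (z k))\<^sup>2) = (\<Sum>k<n. e k * (norm (y k))\<^sup>2)"
    using hform_mat_app[OF P, of y y] unfolding q[symmetric] z_def by simp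
  moreover have "(\<Sum>k<n. b k * (norm (z k))\<^sup>2) \<le> 0"
  proof (rule sum_nonpos)
    fix k assume "k \<in> {..<n}"
    then show "b k * (norm (z k))\<^sup>2 \<le> 0"
      using z0[of k] assms(1) unfolding signs_def by (cases "b k = 1") (auto simp: spec[of _ k])
  qed
  moreover have "(\<Sum>k<n. e k * (norm (y k))\<^sup>2) > 0"
  proof -
    obtain j where j: "j < n" "e j = 1" "x j \<noteq> 0"
      using x(1) by auto
    have "e j * (norm (y j))\<^sup>2 > 0"
      using j by (simp add: y_def)
    then show ?thesis
      using j by (intro sum_pos2[of _ j]) (simp_all add: y_def)
  qed
  ultimately show False by simp
qed

lemma frames_inertia:
  assumes "signs b" "signs e" "P \<in> frames n b e"
  shows "card {i. i < n \<and> e i = 1} = card {i. i < n \<and> b i = 1}"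
  using frames_inertia_le[OF assms] frames_inertia_le[OF assms(2,1) finv_in_frames[OF assms]] by simp

section \<open>Simultaneous diagonalization of commuting involutions\<close>

definition eigen :: "nat \<Rightarrow> quat mat \<Rightarrow> (nat \<Rightarrow> quat) \<Rightarrow> bool" where
  "eigen n t x \<longleftrightarrow> (\<exists>s\<in>{1, - 1 :: real}. \<forall>i<n. mat_app n t x i = s *\<^sub>R x i)"

text \<open>An isometric involution is self-adjoint: apply \<open>t\<close> to both arguments of the
  form.\<close>

lemma hform_involution_swap:
  assumes "t \<in> isom n b" "t * t = 1\<^sub>m n"
  shows "hform n b (mat_app n t x) y = hform n b x (mat_app n t y)"
proof -
  have "hform n b x (mat_app n t y) = hform n b (mat_app n t x) (mat_app n t (mat_app n t y))"
    by (rule hform_mat_app[OF assms(1), symmetric])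
  also have "\<dots> = hform n b (mat_app n t x) y"
    using frames_carrier[OF assms(1)]
    by (intro hform_cong) (simp_all add: assms(2) mat_app_one flip: mat_app_mult)
  finally show ?thesis ..
qed

text \<open>Self-adjointness moves \<open>t\<close> onto the eigenvector, so the orthogonal
  complement of \<open>v\<close> is stable under \<open>t\<close>.\<close>

lemma eigen_orthogonal_invariant:
  assumes t: "t \<in> isom n b" "t * t = 1\<^sub>m n" and v: "eigen n t v" "hform n b v x = 0"
  shows "hform n b v (mat_app n t x) = 0"
proof -
  obtain s where s: "\<forall>i<n. mat_app n t v i = s *\<^sub>R v i"
    using v(1) unfolding eigen_def by blast
  have "hform n b v (mat_app n t x) = hform n b (\<lambda>k. s *\<^sub>R v k) x"
    unfolding hform_involution_swap[OF t, symmetric] using s by (intro hform_cong) auto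
  then show ?thesis
    using v(2) by (simp add: hform_simps)
qed

lemma eigen_scaleR: "eigen n t x \<Longrightarrow> eigen n t (\<lambda>k. r *\<^sub>R x k)"
  unfolding eigen_def by (auto simp: mat_app_simps)

text \<open>One of the components \<open>x \<plusminus> t x\<close> of a vector \<open>x\<close> is non-isotropic if \<open>x\<close> is.\<close>

lemma common_eigenvector:
  assumes "finite S" and S: "\<And>t. t \<in> S \<Longrightarrow> t \<in> isom n b" "\<And>t. t \<in> S \<Longrightarrow> t * t = 1\<^sub>m n"
    and comm: "\<And>t u. t \<in> S \<Longrightarrow> u \<in> S \<Longrightarrow> t * u = u * t"
    and v: "\<And>a t. a \<in> M \<Longrightarrow> t \<in> S \<Longrightarrow> eigen n t (v a)"
    and x: "hform n b x x \<noteq> 0" "\<And>a. a \<in> M \<Longrightarrow> hform n b (v a) x = 0"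
  shows "\<exists>x. hform n b x x \<noteq> 0 \<and> (\<forall>a\<in>M. hform n b (v a) x = 0) \<and> (\<forall>t\<in>S. eigen n t x)"
  using assms
proof (induction S rule: finite_induct)
  case empty
  then show ?case by auto
next
  case (insert t S)
  then obtain x where x: "hform n b x x \<noteq> 0" "\<forall>a\<in>M. hform n b (v a) x = 0" "\<forall>t\<in>S. eigen n t x"
    by auto
  define y z where "y = mat_app n t x" and "z r = (\<lambda>k. x k + r *\<^sub>R y k)" for r
  have t: "t \<in> isom n b" "t * t = 1\<^sub>m n"
    using insert.prems by auto
  have yy: "hform n b y y = hform n b x x"
    unfolding y_def by (rule hform_mat_app[OF t(1)])
  \<comment> \<open>Parallelogram identity, with \<open>t\<close> isometric: \<open>x + t x\<close>
    and \<open>x - t x\<close> cannot both be isotropic.\<close>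
  have "hform n b (z 1) (z 1) + hform n b (z (- 1)) (z (- 1)) = 4 *\<^sub>R hform n b x x"
  proof -
    have "hform n b (z 1) (z 1) + hform n b (z (- 1)) (z (- 1)) =
      2 *\<^sub>R hform n b x x + 2 *\<^sub>R hform n b y y"
      unfolding z_def hform_simps by (simp add: scaleR_2)
    then show ?thesis
      by (simp add: yy flip: scaleR_left_distrib)
  qed
  then obtain r where r: "r = 1 \<or> r = - 1" "hform n b (z r) (z r) \<noteq> 0"
    using x(1) by (metis add.right_neutral scaleR_eq_0_iff zero_neq_numeral)
  have "hform n b (v a) (z r) = 0" if "a \<in> M" for a
    using eigen_orthogonal_invariant[OF t, of "v a" x] x(2) insert.prems(4)[OF that] that
    by (simp add: z_def hform_simps y_def)
  moreover have "eigen n t (z r)"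
  proof -
    have "mat_app n t (z r) i = r *\<^sub>R z r i" if "i < n" for i
    proof -
      have "mat_app n t y i = x i"
        unfolding y_def using that frames_carrier[OF t(1)]
        by (simp add: t(2) mat_app_one flip: mat_app_mult)
      then show ?thesis
        using r(1) unfolding z_def mat_app_simps by (auto simp: y_def)
    qed
    then show ?thesis
      using r(1) unfolding eigen_def by auto
  qed
  \<comment> \<open>The eigenspaces of \<open>u\<close> are stable under the commuting
    \<open>t\<close>, so \<open>z r\<close> stays in the one that contains \<open>x\<close>.\<close>
  moreover have "eigen n u (z r)" if u: "u \<in> S" for u
  proof -
    obtain s where s: "s \<in> {1, - 1}" "\<forall>i<n. mat_app n u x i = s *\<^sub>R x i"
      using x(3) u unfolding eigen_def by blast
    have uc: "u \<in> carrier_mat n n"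
      using frames_carrier[of u] insert.prems(1)[of u] u by auto
    have "mat_app n u y i = s *\<^sub>R y i" if "i < n" for i
    proof -
      have "mat_app n u y i = mat_app n (t * u) x i"
        unfolding y_def using that uc frames_carrier[OF t(1)] insert.prems(3)[of t u] u
        by (simp flip: mat_app_mult)
      also have "\<dots> = mat_app n t (\<lambda>k. s *\<^sub>R x k) i"
        using that uc frames_carrier[OF t(1)] s(2) by (simp add: mat_app_mult cong: mat_app_cong)
      finally show ?thesis
        by (simp add: mat_app_simps y_def)
    qed
    then have "\<forall>i<n. mat_app n u (z r) i = s *\<^sub>R z r i"
      using s(2) unfolding z_def mat_app_simps by (simp add: algebra_simps)
    then show ?thesis
      using s(1) unfolding eigen_def by auto
  qed
  ultimately show ?case
    using r(2) by (intro exI[of _ "z r"]) auto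
qed

text \<open>Counting gives a nonzero \<open>y\<close> orthogonal to all \<open>v a\<close>, but it
  may be isotropic. Nondegeneracy supplies another such vector \<open>u\<close> whose product with
  \<open>y\<close> is 1. Then \<open>u\<close>, \<open>y\<close> and \<open>u + y\<close> cannot all
  be isotropic, since the value at the sum exceeds the sum of the values by 2.\<close>

lemma nonisotropic_orthogonal_vector:
  assumes b: "signs b" and "m < n"
    and v: "\<And>a c. a < m \<Longrightarrow> c < m \<Longrightarrow> hform n b (v a) (v c) = (if a = c then of_real (e a) else 0)"
    and e: "signs e"
  shows "\<exists>x. hform n b x x \<noteq> 0 \<and> (\<forall>a<m. hform n b (v a) x = 0)"
proof -
  obtain y where y: "\<exists>j\<in>{..<n}. y j \<noteq> 0" "\<forall>a\<in>{..<m}. (\<Sum>j<n. b j *\<^sub>R qcnj (v a j) * y j) = 0"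
    using underdetermined_system[of "{..<m}" "{..<n}" "\<lambda>a j. b j *\<^sub>R qcnj (v a j)"] \<open>m < n\<close> by auto
  have vy: "hform n b (v a) y = 0" if "a < m" for a
    using y(2) that by (simp add: hform_def)
  obtain j where j: "j < n" "y j \<noteq> 0"
    using y(1) by auto
  define w where "w k = (if k = j then 1 else 0 :: quat)" for k
  have "hform n b w y = b j *\<^sub>R y j"
    unfolding hform_def w_def using j by (subst sum.remove[of _ j]) auto
  then have wy: "hform n b w y \<noteq> 0"
    using j signs_nonzero[OF b] by simp
  \<comment> \<open>Orthogonal projection away from the \<open>v a\<close>; the product with
    \<open>y\<close> does not change, because \<open>y\<close> is orthogonal to them.\<close>
  define z where "z k = w k - (\<Sum>a<m. v a k * (e a *\<^sub>R hform n b (v a) w))" for k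
  have vz: "hform n b (v c) z = 0" if "c < m" for c
  proof -
    have "hform n b (v c) z = hform n b (v c) w
        - (\<Sum>a<m. hform n b (v c) (v a) * (e a *\<^sub>R hform n b (v a) w))"
      unfolding z_def hform_simps(3) hform_sum hform_simps(7) ..
    also have "(\<Sum>a<m. hform n b (v c) (v a) * (e a *\<^sub>R hform n b (v a) w)) = hform n b (v c) w"
      using that signs_square[OF e] by (simp add: v mult_delta_left of_real_def if_distrib[of "scaleR _"] cong: if_cong)
    finally show ?thesis by simp
  qed
  have zy: "hform n b z y = hform n b w y"
  proof -
    have "hform n b z y = hform n b w y
        - (\<Sum>a<m. qcnj (e a *\<^sub>R hform n b (v a) w) * hform n b (v a) y)"
      unfolding z_def hform_simps(4) hform_sum_left hform_simps(8) ..
    then show ?thesis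
      by (simp add: vy)
  qed
  define \<mu> where "\<mu> = hform n b z y"
  \<comment> \<open>The form is conjugate-linear in its left argument, hence the conjugate in the
    normalizing factor.\<close>
  define u where "u k = z k * qcnj (inverse \<mu>)" for k
  have "\<mu> \<noteq> 0"
    unfolding \<mu>_def zy using wy .
  then have uy: "hform n b u y = 1"
    unfolding u_def hform_simps by (simp flip: \<mu>_def)
  then have yu: "hform n b y u = 1"
    using hform_cnj[of n b u y] by simp
  have vu: "hform n b (v a) u = 0" if "a < m" for a
    unfolding u_def hform_simps using vz[OF that] by simp
  define s where "s k = u k + y k" for k
  have vs: "hform n b (v a) s = 0" if "a < m" for a
    unfolding s_def hform_simps using vu[OF that] vy[OF that] by simp
  have "hform n b s s = hform n b u u + hform n b y y + 2"
    unfolding s_def hform_simps uy yu by simp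
  then have "hform n b u u \<noteq> 0 \<or> hform n b y y \<noteq> 0 \<or> hform n b s s \<noteq> 0"
    by (metis add.left_neutral zero_neq_numeral)
  then show ?thesis
    using vu vy vs by blast
qed

text \<open>Common eigenvectors are added one at a time. The complement of those found contains a
  non-isotropic vector, \<open>common_eigenvector\<close> makes it a common eigenvector, and after
  scaling its value under the form is a sign, which is its entry in \<open>e\<close>.\<close>

lemma simultaneous_diagonalization:
  assumes b: "signs b" and "finite S" and S: "\<And>t. t \<in> S \<Longrightarrow> t \<in> isom n b" "\<And>t. t \<in> S \<Longrightarrow> t * t = 1\<^sub>m n"
    and comm: "\<And>t u. t \<in> S \<Longrightarrow> u \<in> S \<Longrightarrow> t * u = u * t"
  obtains P e where "signs e" "P \<in> frames n b e"
    "\<And>t c. t \<in> S \<Longrightarrow> c < n \<Longrightarrow> eigen n t (\<lambda>i. P $$ (i, c))"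
proof -
  have "\<exists>v e. signs e \<and> (\<forall>a<m. \<forall>c<m. hform n b (v a) (v c) = (if a = c then of_real (e a) else 0)) \<and>
      (\<forall>a<m. \<forall>t\<in>S. eigen n t (v a))" if "m \<le> n" for m
    using that
  proof (induction m)
    case 0
    show ?case
      by (intro exI[of _ undefined] exI[of _ "\<lambda>_. 1"]) (auto simp: signs_def)
  next
    case (Suc m)
    then obtain v e where "signs e \<and>
        (\<forall>a<m. \<forall>c<m. hform n b (v a) (v c) = (if a = c then of_real (e a) else 0)) \<and>
        (\<forall>a<m. \<forall>t\<in>S. eigen n t (v a))"
      using Suc_leD by blast
    then have v: "signs e"
      "\<And>a c. a < m \<Longrightarrow> c < m \<Longrightarrow> hform n b (v a) (v c) = (if a = c then of_real (e a) else 0)"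
      "\<And>a t. a < m \<Longrightarrow> t \<in> S \<Longrightarrow> eigen n t (v a)"
      by auto
    obtain x0 where x0: "hform n b x0 x0 \<noteq> 0" "\<forall>a<m. hform n b (v a) x0 = 0"
      using nonisotropic_orthogonal_vector[OF b, of m n v e] v Suc.prems by auto
    obtain x where x: "hform n b x x \<noteq> 0" "\<forall>a\<in>{..<m}. hform n b (v a) x = 0" "\<forall>t\<in>S. eigen n t x"
      using common_eigenvector[OF \<open>finite S\<close> S comm, of "{..<m}" v x0] v(3) x0 by auto
    define r where "r = qre (hform n b x x)"
    have r: "hform n b x x = of_real r" "r \<noteq> 0"
      using hform_self_real[of n b x] x(1) by (auto simp: r_def)
    define y where "y k = (1 / sqrt \<bar>r\<bar>) *\<^sub>R x k" for k
    have yy: "hform n b y y = of_real (sgn r)"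
    proof -
      have "hform n b y y = ((1 / sqrt \<bar>r\<bar>) * (1 / sqrt \<bar>r\<bar>)) *\<^sub>R of_real r"
        unfolding y_def hform_simps r by simp
      also have "(1 / sqrt \<bar>r\<bar>) * (1 / sqrt \<bar>r\<bar>) = 1 / \<bar>r\<bar>"
        by simp
      also have "(1 / \<bar>r\<bar>) *\<^sub>R of_real r = (of_real (r / \<bar>r\<bar>) :: quat)"
        by (simp add: of_real_def)
      also have "r / \<bar>r\<bar> = sgn r"
        using r(2) by (auto simp: sgn_if abs_if)
      finally show ?thesis .
    qed
    have vy: "hform n b (v a) y = 0" "hform n b y (v a) = 0" if "a < m" for a
    proof -
      show "hform n b (v a) y = 0"
        unfolding y_def hform_simps using x(2) that by simp
      then show "hform n b y (v a) = 0"
        using hform_cnj[of n b "v a" y] by simp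
    qed
    have "signs (e(m := sgn r))"
      using v(1) r(2) by (auto simp: signs_def sgn_if)
    moreover have "\<forall>a<Suc m. \<forall>c<Suc m. hform n b ((v(m := y)) a) ((v(m := y)) c) =
        (if a = c then of_real ((e(m := sgn r)) a) else 0)"
      using v(2) vy yy by (auto simp: less_Suc_eq)
    moreover have "\<forall>a<Suc m. \<forall>t\<in>S. eigen n t ((v(m := y)) a)"
      using v(3) x(3) eigen_scaleR unfolding y_def by (auto simp: less_Suc_eq)
    ultimately show ?case
      by blast
  qed
  then obtain v e where v: "signs e"
    "\<forall>a<n. \<forall>c<n. hform n b (v a) (v c) = (if a = c then of_real (e a) else 0)"
    "\<forall>a<n. \<forall>t\<in>S. eigen n t (v a)"
    by blast
  define P where "P = mat n n (\<lambda>(i, c). v c i)"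
  have "P \<in> frames n b e"
    using v(2) by (auto simp: frames_def P_def hform_def)
  moreover have "eigen n t (\<lambda>i. P $$ (i, c))" if "t \<in> S" "c < n" for t c
  proof -
    have "mat_app n t (\<lambda>i. P $$ (i, c)) i = mat_app n t (v c) i" for i
      by (rule mat_app_cong) (use that in \<open>simp add: P_def\<close>)
    then show ?thesis
      using v(3) that by (auto simp: eigen_def P_def)
  qed
  ultimately show thesis
    using that v(1) by blast
qed

text \<open>For a frame \<open>P\<close> this is the map \<open>A\<close> written in the basis of
  the columns of \<open>P\<close>; isometries of diag(b) become isometries of diag(e).\<close>

definition mconj :: "nat \<Rightarrow> (nat \<Rightarrow> real) \<Rightarrow> (nat \<Rightarrow> real) \<Rightarrow> quat mat \<Rightarrow> quat mat \<Rightarrow> quat mat" where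
  "mconj n b e P A = finv n b e P * A * P"

context
  fixes n b e P
  assumes b: "signs b" and e: "signs e" and P: "P \<in> frames n b e"
begin

lemma mconj_carrier: "A \<in> carrier_mat n n \<Longrightarrow> mconj n b e P A \<in> carrier_mat n n"
  unfolding mconj_def using frames_carrier[OF P] by auto

lemma mconj_mult:
  assumes "A \<in> carrier_mat n n" "B \<in> carrier_mat n n"
  shows "mconj n b e P (A * B) = mconj n b e P A * mconj n b e P B"
proof -
  note c = frames_carrier[OF P] assms
  note a = assoc_mult_mat[of _ n n _ n _ n] mult_carrier_mat[of _ n n _ n]
  have "mconj n b e P A * mconj n b e P B = finv n b e P * A * (P * finv n b e P) * (B * P)"
    unfolding mconj_def using c by (simp add: a)
  also have "\<dots> = mconj n b e P (A * B)"
    unfolding mconj_def finv_right[OF e P] using c by (simp add: a)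
  finally show ?thesis ..
qed

lemma mconj_one: "mconj n b e P (1\<^sub>m n) = 1\<^sub>m n"
  unfolding mconj_def using frames_carrier[OF P] finv_left[OF e P] by simp

lemma mconj_frames: "A \<in> isom n b \<Longrightarrow> mconj n b e P A \<in> isom n e"
  unfolding mconj_def by (intro frames_mult[of b] b e P finv_in_frames)

lemma mconj_inverse:
  assumes "A \<in> carrier_mat n n"
  shows "mconj n e b (finv n b e P) (mconj n b e P A) = A"
proof -
  note c = frames_carrier[OF P] assms
  note a = assoc_mult_mat[of _ n n _ n _ n] mult_carrier_mat[of _ n n _ n]
  have "mconj n e b (finv n b e P) (mconj n b e P A) = (P * finv n b e P) * A * (P * finv n b e P)"
    unfolding mconj_def finv_finv[OF b e c(1)] using c by (simp add: a)
  then show ?thesis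
    unfolding finv_right[OF e P] using c by simp
qed

lemma mconj_inj: "inj_on (mconj n b e P) (carrier_mat n n)"
  by (rule inj_on_inverseI) (rule mconj_inverse)

lemma mconj_eigenvectors:
  assumes t: "t \<in> carrier_mat n n" and ev: "\<And>c. c < n \<Longrightarrow> eigen n t (\<lambda>i. P $$ (i, c))"
  obtains s where "signs s" "mconj n b e P t = qdiag n (\<lambda>c. of_real (s c))"
proof -
  have "\<forall>c. \<exists>s. (s = 1 \<or> s = - 1) \<and> (c < n \<longrightarrow> (\<forall>i<n. mat_app n t (\<lambda>i. P $$ (i, c)) i = s *\<^sub>R P $$ (i, c)))"
  proof
    fix c
    show "\<exists>s. (s = 1 \<or> s = - 1) \<and> (c < n \<longrightarrow> (\<forall>i<n. mat_app n t (\<lambda>i. P $$ (i, c)) i = s *\<^sub>R P $$ (i, c)))"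
    proof (cases "c < n")
      case True
      then obtain s where "s \<in> {1, - 1 :: real}" "\<forall>i<n. mat_app n t (\<lambda>i. P $$ (i, c)) i = s *\<^sub>R P $$ (i, c)"
        using ev[of c] unfolding eigen_def by blast
      then show ?thesis
        by blast
    qed blast
  qed
  from choice[OF this] obtain s where
    "\<forall>c. (s c = 1 \<or> s c = - 1) \<and> (c < n \<longrightarrow> (\<forall>i<n. mat_app n t (\<lambda>i. P $$ (i, c)) i = s c *\<^sub>R P $$ (i, c)))" ..
  then have s: "\<And>c. s c = 1 \<or> s c = - 1"
    "\<And>c i. c < n \<Longrightarrow> i < n \<Longrightarrow> mat_app n t (\<lambda>i. P $$ (i, c)) i = s c *\<^sub>R P $$ (i, c)"
    by blast+
  note c = frames_carrier[OF P] t
  have "t * P = P * qdiag n (\<lambda>c. of_real (s c))"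
    using c s(2) by (intro eq_matI) (auto simp: mat_mult_entry[of _ n] mat_app_def of_real_def mult_delta_right)
  then have "mconj n b e P t = finv n b e P * P * qdiag n (\<lambda>c. of_real (s c))"
    unfolding mconj_def using c by (simp add: assoc_mult_mat[of _ n n _ n _ n])
  then have "mconj n b e P t = qdiag n (\<lambda>c. of_real (s c))"
    by (simp add: finv_left[OF e P])
  then show thesis
    using that s(1) unfolding signs_def by blast
qed

end

lemma frames_reindex:
  assumes P: "P \<in> frames n b e" and \<pi>: "bij_betw \<pi> {..<n} {..<n}"
  defines "P' \<equiv> mat n n (\<lambda>(i, j). P $$ (i, \<pi> j))"
  shows "P' \<in> frames n b (e \<circ> \<pi>)"
    and "\<And>A i j. A \<in> carrier_mat n n \<Longrightarrow> i < n \<Longrightarrow> j < n \<Longrightarrow>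
      mconj n b (e \<circ> \<pi>) P' A $$ (i, j) = mconj n b e P A $$ (\<pi> i, \<pi> j)"
proof -
  have \<pi>': "\<pi> i < n" "\<pi> i = \<pi> j \<longleftrightarrow> i = j" if "i < n" "j < n" for i j
    using \<pi> that by (auto simp: bij_betw_def inj_on_def)
  show "P' \<in> frames n b (e \<circ> \<pi>)"
    using frames_column[OF P] \<pi>' by (auto simp: frames_def P'_def)
  show "mconj n b (e \<circ> \<pi>) P' A $$ (i, j) = mconj n b e P A $$ (\<pi> i, \<pi> j)"
    if "A \<in> carrier_mat n n" "i < n" "j < n" for A i j
    using that \<pi>'(1)[OF that(2,2)] \<pi>'(1)[OF that(3,3)] frames_carrier[OF P]
    unfolding mconj_def P'_def
    by (simp add: mat_mult_entry[of _ n] mult_carrier_mat[of _ n n _ n])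
qed

section \<open>Commuting copies of Sp(1) act on separate lines\<close>

lemma quat_eq_uminus_iff: "x = - x \<longleftrightarrow> x = 0" "- x = x \<longleftrightarrow> x = 0" for x :: quat
  by (cases x; auto simp: uminus_quat_def zero_quat_def)+

lemma real_unit_square:
  assumes "norm w = 1" "w = of_real (qre w)"
  shows "w * w = 1"
proof -
  have "w * w = of_real (qre w * qre w)"
    by (subst (1 2) assms(2)) simp
  also have "qre w * qre w = 1"
    by (metis assms norm_of_real abs_mult_self_eq mult_1)
  finally show ?thesis by simp
qed

text \<open>\<open>T i\<close> stands for the i-th copy of Sp(1) and \<open>\<tau> A\<close> for the
  product of the involutions \<open>T i (- 1)\<close> over \<open>A\<close>. The count of the
  overview is carried out on subsets: sending \<open>A\<close> to the set \<open>N A\<close> of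
  lines on which \<open>\<tau> A\<close> is -1 is an injective map of a finite power set into
  itself, hence onto.\<close>

lemma torus_diagonalization:
  fixes T :: "nat \<Rightarrow> quat \<Rightarrow> quat mat" and \<tau> :: "nat set \<Rightarrow> quat mat"
  assumes b: "signs b"
    and T: "\<And>i x. i < n \<Longrightarrow> norm x = 1 \<Longrightarrow> T i x \<in> isom n b"
    and T_mult: "\<And>i x y. i < n \<Longrightarrow> norm x = 1 \<Longrightarrow> norm y = 1 \<Longrightarrow> T i (x * y) = T i x * T i y"
    and T_comm: "\<And>i j x y. i < n \<Longrightarrow> j < n \<Longrightarrow> i \<noteq> j \<Longrightarrow> norm x = 1 \<Longrightarrow> norm y = 1 \<Longrightarrow>
      T i x * T j y = T j y * T i x"
    and \<tau>: "\<And>A. A \<subseteq> {..<n} \<Longrightarrow> \<tau> A \<in> isom n b" "\<And>A. A \<subseteq> {..<n} \<Longrightarrow> \<tau> A * \<tau> A = 1\<^sub>m n"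
      "\<And>A B. A \<subseteq> {..<n} \<Longrightarrow> B \<subseteq> {..<n} \<Longrightarrow> \<tau> A * \<tau> B = \<tau> B * \<tau> A"
    and \<tau>_inj: "inj_on \<tau> (Pow {..<n})" and \<tau>_empty: "\<tau> {} = 1\<^sub>m n"
    and \<tau>_T: "\<And>i. i < n \<Longrightarrow> \<tau> {i} = T i (- 1)"
    and \<tau>_comm: "\<And>i x A. i < n \<Longrightarrow> norm x = 1 \<Longrightarrow> A \<subseteq> {..<n} \<Longrightarrow> T i x * \<tau> A = \<tau> A * T i x"
  obtains P e \<sigma> where "signs e" "P \<in> frames n b e"
    "\<And>i x. i < n \<Longrightarrow> norm x = 1 \<Longrightarrow> mconj n b e P (T i x) = qdiag n (\<lambda>c. if c = i then \<sigma> i x else 1)"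
    "\<And>i x. i < n \<Longrightarrow> norm x = 1 \<Longrightarrow> norm (\<sigma> i x) = 1"
    "\<And>i x y. i < n \<Longrightarrow> norm x = 1 \<Longrightarrow> norm y = 1 \<Longrightarrow> \<sigma> i (x * y) = \<sigma> i x * \<sigma> i y"
    "\<And>i. i < n \<Longrightarrow> \<sigma> i (- 1) = - 1"
proof -
  let ?S = "\<tau> ` Pow {..<n}"
  have S: "finite ?S" "\<And>t. t \<in> ?S \<Longrightarrow> t \<in> isom n b" "\<And>t. t \<in> ?S \<Longrightarrow> t * t = 1\<^sub>m n"
    "\<And>t u. t \<in> ?S \<Longrightarrow> u \<in> ?S \<Longrightarrow> t * u = u * t"
    by (auto intro: \<tau>)
  have "\<exists>P e. signs e \<and> P \<in> frames n b e \<and> (\<forall>t\<in>?S. \<forall>c<n. eigen n t (\<lambda>i. P $$ (i, c)))"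
  proof (rule simultaneous_diagonalization[OF b S])
    fix P e
    assume "signs e" "P \<in> frames n b e"
      and "\<And>t c. t \<in> ?S \<Longrightarrow> c < n \<Longrightarrow> eigen n t (\<lambda>i. P $$ (i, c))"
    then show ?thesis by blast
  qed
  then obtain P e where e: "signs e" and P: "P \<in> frames n b e"
    and ev: "\<And>A c. A \<in> Pow {..<n} \<Longrightarrow> c < n \<Longrightarrow> eigen n (\<tau> A) (\<lambda>i. P $$ (i, c))"
    by (metis imageI)
  let ?C = "mconj n b e P"
  note C_mult = mconj_mult[OF b e P] and C_inj = mconj_inj[OF b e P]
  have "\<forall>A. \<exists>s. A \<in> Pow {..<n} \<longrightarrow> signs s \<and> ?C (\<tau> A) = qdiag n (\<lambda>c. of_real (s c))"
  proof
    fix A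
    show "\<exists>s. A \<in> Pow {..<n} \<longrightarrow> signs s \<and> ?C (\<tau> A) = qdiag n (\<lambda>c. of_real (s c))"
    proof (cases "A \<in> Pow {..<n}")
      case True
      then have "\<tau> A \<in> carrier_mat n n"
        by (auto intro: frames_carrier \<tau>)
      then show ?thesis
        using mconj_eigenvectors[OF b e P _ ev[OF True]] by blast
    qed blast
  qed
  from choice[OF this] obtain s where
    s: "\<And>A. A \<in> Pow {..<n} \<Longrightarrow> signs (s A)" "\<And>A. A \<in> Pow {..<n} \<Longrightarrow> ?C (\<tau> A) = qdiag n (\<lambda>c. of_real (s A c))"
    by blast
  define N where "N A = {c. c < n \<and> s A c = - 1}" for A
  have "inj_on N (Pow {..<n})"
  proof (rule inj_onI)
    fix A B assume AB: "A \<in> Pow {..<n}" "B \<in> Pow {..<n}" and NAB: "N A = N B"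
    have "s A c = s B c" if "c < n" for c
    proof -
      have "s A c = - 1 \<longleftrightarrow> s B c = - 1"
        using NAB that by (auto simp: N_def)
      then show ?thesis
        using s(1)[OF AB(1)] s(1)[OF AB(2)] unfolding signs_def by metis
    qed
    then have "?C (\<tau> A) = ?C (\<tau> B)"
      using s(2) AB by (auto intro: qdiag_cong)
    then have "\<tau> A = \<tau> B"
      using C_inj AB frames_carrier[OF \<tau>(1)] by (auto dest!: inj_onD)
    then show "A = B"
      using inj_onD[OF \<tau>_inj _ AB] by simp
  qed
  moreover have "N ` Pow {..<n} \<subseteq> Pow {..<n}"
    by (auto simp: N_def)
  ultimately have N_surj: "N ` Pow {..<n} = Pow {..<n}"
    by (simp add: endo_inj_surj)
  \<comment> \<open>A set with \<open>N A = {c}\<close> gives the reflection in line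
    \<open>c\<close>, and what commutes with it has no entry linking \<open>c\<close> to another
    line.\<close>
  have diag_entry: "?C (T i x) $$ (c, d) = 0" if "i < n" "norm x = 1" "c < n" "d < n" "c \<noteq> d" for i x c d
  proof -
    have "{c} \<in> N ` Pow {..<n}"
      unfolding N_surj using that by auto
    then obtain A where A: "A \<in> Pow {..<n}" "N A = {c}"
      by auto
    then have "s A c = - 1" "s A d \<noteq> - 1"
      using that by (auto simp: N_def)
    then have sA: "s A c = - 1" "s A d = 1"
      using s(1)[OF A(1)] unfolding signs_def by auto
    have AA: "A \<subseteq> {..<n}"
      using A by auto
    note cT = frames_carrier[OF T[OF that(1,2)]]
    note c\<tau> = frames_carrier[OF \<tau>(1)[OF AA]]
    have "?C (T i x) * ?C (\<tau> A) = ?C (\<tau> A) * ?C (T i x)"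
      by (simp flip: C_mult add: cT c\<tau> \<tau>_comm[OF that(1,2) AA])
    then have "(?C (T i x) * ?C (\<tau> A)) $$ (c, d) = (?C (\<tau> A) * ?C (T i x)) $$ (c, d)"
      by simp
    then show ?thesis
      using that mconj_carrier[OF b e P cT]
      by (simp add: s(2)[OF A(1)] sA quat_eq_uminus_iff)
  qed
  define \<rho> where "\<rho> i x c = ?C (T i x) $$ (c, c)" for i x c
  have C_T: "?C (T i x) = qdiag n (\<rho> i x)" if "i < n" "norm x = 1" for i x
    using mconj_carrier[OF b e P frames_carrier[OF T[OF that]]] diag_entry[OF that]
    by (intro eq_matI) (auto simp: \<rho>_def)
  have \<rho>_norm: "norm (\<rho> i x c) = 1" if "i < n" "norm x = 1" "c < n" for i x c
    using qdiag_in_framesD[OF e _ that(3)] mconj_frames[OF b e P T[OF that(1,2)]] C_T[OF that(1,2)] by simp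
  have \<rho>_mult: "\<rho> i (x * y) c = \<rho> i x c * \<rho> i y c" if "i < n" "norm x = 1" "norm y = 1" "c < n" for i x y c
  proof -
    have "?C (T i (x * y)) = qdiag n (\<lambda>c. \<rho> i x c * \<rho> i y c)"
      using that frames_carrier[OF T] by (simp add: T_mult C_mult C_T qdiag_mult)
    then show ?thesis
      using that by (simp add: \<rho>_def)
  qed
  have \<rho>_comm: "\<rho> i x c * \<rho> j y c = \<rho> j y c * \<rho> i x c"
    if "i < n" "j < n" "i \<noteq> j" "norm x = 1" "norm y = 1" "c < n" for i j x y c
  proof -
    have "qdiag n (\<rho> i x) * qdiag n (\<rho> j y) = qdiag n (\<rho> j y) * qdiag n (\<rho> i x)"
      using that T_comm[of i j x y] frames_carrier[OF T] by (simp flip: C_T C_mult)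
    then have "(qdiag n (\<rho> i x) * qdiag n (\<rho> j y)) $$ (c, c) = (qdiag n (\<rho> j y) * qdiag n (\<rho> i x)) $$ (c, c)"
      by simp
    then show ?thesis
      using that by simp
  qed
  have neg: "\<rho> i (- 1) c = - 1 \<longleftrightarrow> c \<in> N {i}" if "i < n" "c < n" for i c
  proof -
    have "\<rho> i (- 1) c = of_real (s {i} c)"
      using s(2)[of "{i}"] that by (simp add: \<rho>_def \<tau>_T)
    moreover have "of_real (s {i} c) = (- 1 :: quat) \<longleftrightarrow> s {i} c = - 1"
      using of_real_eq_iff[of "s {i} c" "- 1", where 'a = quat] by simp
    ultimately show ?thesis
      using that by (simp add: N_def)
  qed
  \<comment> \<open>On a line where \<open>T j (- 1)\<close> is -1, the images of \<open>iq\<close>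
    and \<open>jq\<close> under copy \<open>j\<close> are anticommuting imaginary units, so every
    other copy acts there by reals.\<close>
  have central: "\<rho> i x c = of_real (qre (\<rho> i x c))"
    if "i < n" "j < n" "i \<noteq> j" "norm x = 1" "c \<in> N {j}" for i j x c
  proof -
    have c: "c < n"
      using that by (auto simp: N_def)
    have m: "\<rho> j y c * \<rho> j z c = \<rho> j (y * z) c" if "norm y = 1" "norm z = 1" for y z
      using \<rho>_mult[OF \<open>j < n\<close> that c] by simp
    have n1: "\<rho> j (- 1) c = - 1"
      using neg[OF that(2) c] that(5) by simp
    show ?thesis
    proof (rule commute_anticommuting_units)
      show "\<rho> j iq c * \<rho> j iq c = - 1" "\<rho> j jq c * \<rho> j jq c = - 1"
        by (simp_all add: m iq_jq n1)
      have "\<rho> j (- 1) c * (\<rho> j jq c * \<rho> j iq c) = \<rho> j ((- 1) * (jq * iq)) c"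
        by (simp only: m iq_jq norm_mult norm_minus_cancel norm_one mult_1)
      then show "\<rho> j iq c * \<rho> j jq c = - (\<rho> j jq c * \<rho> j iq c)"
        by (simp add: n1) (simp add: m iq_jq)
    qed (use that c \<rho>_comm iq_jq in auto)
  qed
  \<comment> \<open>Otherwise the image of \<open>iq\<close> under copy \<open>i\<close> would be a
    real unit, of square 1, although its square is the image -1 of -1.\<close>
  have disjoint: "i = j" if "i < n" "j < n" "c \<in> N {i}" "c \<in> N {j}" for i j c
  proof (rule ccontr)
    assume "i \<noteq> j"
    have c: "c < n"
      using that by (auto simp: N_def)
    have "\<rho> i iq c * \<rho> i iq c = 1"
      using real_unit_square[OF \<rho>_norm central[OF that(1,2) \<open>i \<noteq> j\<close> _ that(4)]] that c iq_jq by auto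
    moreover have "\<rho> i iq c * \<rho> i iq c = - 1"
      using neg[OF that(1) c] that(3) by (simp flip: \<rho>_mult[OF that(1) iq_jq(4) iq_jq(4) c] add: iq_jq)
    ultimately show False
      by simp
  qed
  have "\<exists>c. c \<in> N {i}" if "i < n" for i
  proof (rule ccontr)
    assume "\<not> ?thesis"
    then have "s {i} c = 1" if "c < n" for c
      using s(1)[of "{i}"] \<open>i < n\<close> that by (auto simp: N_def signs_def)
    then have "?C (\<tau> {i}) = qdiag n (\<lambda>_. 1)"
      using s(2)[of "{i}"] that by (auto intro: qdiag_cong)
    then have "?C (\<tau> {i}) = ?C (\<tau> {})"
      by (simp add: qdiag_one \<tau>_empty mconj_one[OF b e P])
    then have "\<tau> {i} = \<tau> {}"
      using C_inj that frames_carrier[OF \<tau>(1), of "{i}"] frames_carrier[OF \<tau>(1), of "{}"]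
      by (auto dest!: inj_onD)
    then show False
      using inj_onD[OF \<tau>_inj, of "{i}" "{}"] that by simp
  qed
  \<comment> \<open>The sets \<open>N {i}\<close> are nonempty, disjoint and as many as there are
    lines, so copy \<open>i\<close> owns exactly one line, \<open>k i\<close>.\<close>
  then obtain k where k: "\<And>i. i < n \<Longrightarrow> k i \<in> N {i}"
    by metis
  have "inj_on k {..<n}"
    using k disjoint by (intro inj_onI) (metis lessThan_iff)
  moreover have "k ` {..<n} \<subseteq> {..<n}"
    using k by (auto simp: N_def)
  ultimately have bij: "bij_betw k {..<n} {..<n}"
    by (simp add: bij_betw_def endo_inj_surj)
  have k_less: "k i < n" if "i < n" for i
    using k[OF that] by (simp add: N_def)
  \<comment> \<open>On the line of another copy the values are real units, and every unit quaternion
    is a square, so they are 1.\<close>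
  have trivial: "\<rho> i x (k j) = 1" if "i < n" "j < n" "i \<noteq> j" and x: "norm x = 1" for i j x
  proof -
    obtain y where y: "norm y = 1" "y * y = x"
      using unit_sqrt[OF x] .
    have "\<rho> i y (k j) * \<rho> i y (k j) = 1"
      by (rule real_unit_square[OF \<rho>_norm central[OF that(1-3) _ k]]) (use that y k_less in auto)
    then show ?thesis
      using \<rho>_mult[of i y y "k j"] that y k_less by simp
  qed
  \<comment> \<open>The columns are reordered so that copy \<open>i\<close> acts on line
    \<open>i\<close>.\<close>
  define P' where "P' = mat n n (\<lambda>(i, j). P $$ (i, k j))"
  show thesis
  proof (rule that[of "e \<circ> k" P' "\<lambda>i x. \<rho> i x (k i)"])
    show "signs (e \<circ> k)"
      using e by (simp add: signs_def)
    show "P' \<in> frames n b (e \<circ> k)"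
      unfolding P'_def by (rule frames_reindex[OF P bij])
    show "mconj n b (e \<circ> k) P' (T i x) = qdiag n (\<lambda>c. if c = i then \<rho> i x (k i) else 1)"
      if "i < n" "norm x = 1" for i x
    proof (rule eq_matI)
      fix a c assume "a < dim_row (qdiag n (\<lambda>c. if c = i then \<rho> i x (k i) else 1))"
        "c < dim_col (qdiag n (\<lambda>c. if c = i then \<rho> i x (k i) else 1))"
      then have ac: "a < n" "c < n" by auto
      moreover have "k a = k c \<longleftrightarrow> a = c"
        using bij ac by (auto simp: bij_betw_def inj_on_def)
      ultimately show "mconj n b (e \<circ> k) P' (T i x) $$ (a, c)
          = qdiag n (\<lambda>c. if c = i then \<rho> i x (k i) else 1) $$ (a, c)"
        unfolding P'_def using frames_reindex(2)[OF P bij frames_carrier[OF T[OF that]] ac]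
          that k_less trivial[of i a x] by (auto simp: C_T)
    qed (use that in \<open>simp_all add: mconj_def P'_def\<close>)
    show "norm (\<rho> i x (k i)) = 1" if "i < n" "norm x = 1" for i x
      using \<rho>_norm that k_less by simp
    show "\<rho> i (x * y) (k i) = \<rho> i x (k i) * \<rho> i y (k i)" if "i < n" "norm x = 1" "norm y = 1" for i x y
      using \<rho>_mult that k_less by simp
    show "\<rho> i (- 1) (k i) = - 1" if "i < n" for i
      using neg[OF that k_less] k that by simp
  qed
qed

section \<open>Generators\<close>

text \<open>One notation covers rotations and boosts: \<open>e = 1\<close> is the circle and any
  other value, in practice -1, the hyperbola.\<close>

definition tcos :: "real \<Rightarrow> real \<Rightarrow> real" where "tcos e t = (if e = 1 then cos t else cosh t)"
definition tsin :: "real \<Rightarrow> real \<Rightarrow> real" where "tsin e t = (if e = 1 then sin t else sinh t)"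

lemma tcos_tsin:
  assumes "e = 1 \<or> e = - 1"
  shows "tcos e (s + t) = tcos e s * tcos e t - e * tsin e s * tsin e t"
    "tsin e (s + t) = tsin e s * tcos e t + tcos e s * tsin e t"
    "(tcos e t)\<^sup>2 + e * (tsin e t)\<^sup>2 = 1"
  using assms by (auto simp: tcos_def tsin_def cos_add sin_add cosh_add sinh_add cosh_square_eq)

lemma tcos_tsin_simps [simp]:
  "tcos e 0 = 1" "tsin e 0 = 0" "tcos e (- t) = tcos e t" "tsin e (- t) = - tsin e t"
  by (auto simp: tcos_def tsin_def)

text \<open>The angle that turns the vector \<open>(X, Y)\<close> into the first axis. A boost
  preserves the difference of the squares and therefore needs \<open>Y < X\<close>; its parameter,
  the inverse hyperbolic tangent of \<open>- Y / X\<close>, is expressed through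
  \<open>arsinh\<close>.\<close>

lemma turn_angle:
  assumes "e = 1 \<or> e = - 1" "X \<ge> 0" "Y > 0" "e = 1 \<or> Y < X"
  obtains t where "tcos e t \<ge> 0" "tsin e t * X + tcos e t * Y = 0"
proof (cases "e = 1")
  case True
  show ?thesis
  proof (cases "X = 0")
    case True
    then show ?thesis
      using that[of "pi / 2"] \<open>e = 1\<close> by (simp add: tcos_def tsin_def)
  next
    case False
    let ?t = "arctan (- Y / X)"
    have "cos ?t > 0"
      using arctan_bounded[of "- Y / X"] by (intro cos_gt_zero_pi) auto
    moreover have "sin ?t = (- Y / X) * cos ?t"
      using tan_arctan[of "- Y / X"] \<open>cos ?t > 0\<close> unfolding tan_def by (simp add: field_simps)
    ultimately show ?thesis
      using that[of ?t] \<open>e = 1\<close> False by (simp add: tcos_def tsin_def)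
  qed
next
  case False
  define r where "r = sqrt (X\<^sup>2 - Y\<^sup>2)"
  have "X\<^sup>2 > Y\<^sup>2"
    using assms False by (intro power_strict_mono) auto
  then have r: "r > 0" "X\<^sup>2 = Y\<^sup>2 + r\<^sup>2"
    by (auto simp: r_def)
  let ?t = "arsinh (- Y / r)"
  have s: "sinh ?t = - Y / r"
    by (rule sinh_arsinh_real)
  have "(cosh ?t)\<^sup>2 = (X / r)\<^sup>2"
    unfolding cosh_square_eq s power_divide r(2) using r(1) by (simp add: add_divide_distrib)
  then have "cosh ?t = X / r"
    using assms r by (simp add: power2_eq_iff_nonneg)
  then show ?thesis
    using that[of ?t] s assms r(1) False by (simp add: tcos_def tsin_def)
qed

text \<open>Here \<open>e\<close> is meant to be the product of the signs of the lines
  \<open>i\<close> and \<open>j\<close>, which gives a rotation for equal signs and a boost for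
  opposite ones.\<close>

definition turn :: "nat \<Rightarrow> real \<Rightarrow> nat \<Rightarrow> nat \<Rightarrow> real \<Rightarrow> quat mat" where
  "turn n e i j t = mat n n (\<lambda>(a, b). if a = b then (if a = i \<or> a = j then of_real (tcos e t) else 1)
     else if a = i \<and> b = j then of_real (- e * tsin e t)
     else if a = j \<and> b = i then of_real (tsin e t) else 0)"

lemma turn_carrier [simp]: "turn n e i j t \<in> carrier_mat n n" "dim_row (turn n e i j t) = n"
  "dim_col (turn n e i j t) = n"
  by (auto simp: turn_def)

lemma turn_entry: "a < n \<Longrightarrow> b < n \<Longrightarrow> turn n e i j t $$ (a, b) =
    (if a = b then (if a = i \<or> a = j then of_real (tcos e t) else 1)
     else if a = i \<and> b = j then of_real (- e * tsin e t)
     else if a = j \<and> b = i then of_real (tsin e t) else 0)"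
  by (simp add: turn_def)

lemma turn_mult_entry:
  assumes A: "A \<in> carrier_mat n n" and ij: "i < n" "j < n" "i \<noteq> j" and ab: "a < n" "b < n"
  shows "(turn n e i j t * A) $$ (a, b) =
    (if a = i then tcos e t *\<^sub>R A $$ (i, b) - (e * tsin e t) *\<^sub>R A $$ (j, b)
     else if a = j then tsin e t *\<^sub>R A $$ (i, b) + tcos e t *\<^sub>R A $$ (j, b) else A $$ (a, b))"
proof -
  have two: "(\<Sum>k<n. turn n e i j t $$ (a, k) * A $$ (k, b))
      = turn n e i j t $$ (a, i) * A $$ (i, b) + turn n e i j t $$ (a, j) * A $$ (j, b)" if "a = i \<or> a = j"
  proof -
    have "(\<Sum>k<n. turn n e i j t $$ (a, k) * A $$ (k, b)) = (\<Sum>k\<in>{i, j}. turn n e i j t $$ (a, k) * A $$ (k, b))"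
      by (rule sum.mono_neutral_right) (use that ij ab in \<open>auto simp: turn_entry\<close>)
    then show ?thesis
      using ij by simp
  qed
  have one: "(\<Sum>k<n. turn n e i j t $$ (a, k) * A $$ (k, b)) = A $$ (a, b)" if "a \<noteq> i" "a \<noteq> j"
  proof -
    have "(\<Sum>k<n. turn n e i j t $$ (a, k) * A $$ (k, b)) = (\<Sum>k\<in>{a}. turn n e i j t $$ (a, k) * A $$ (k, b))"
      by (rule sum.mono_neutral_right) (use that ij ab in \<open>auto simp: turn_entry\<close>)
    then show ?thesis
      using that ab by (simp add: turn_entry)
  qed
  show ?thesis
  proof (cases "a = i \<or> a = j")
    case True
    then show ?thesis
      unfolding mat_mult_entry[OF turn_carrier(1) A ab] two[OF True] using ij ab
      by (auto simp: turn_entry of_real_def)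
  next
    case False
    then show ?thesis
      unfolding mat_mult_entry[OF turn_carrier(1) A ab] by (simp add: one)
  qed
qed

lemma turn_add:
  assumes "e = 1 \<or> e = - 1" "i < n" "j < n" "i \<noteq> j"
  shows "turn n e i j s * turn n e i j t = turn n e i j (s + t)"
  using assms(2-4)
  by (intro eq_matI) (auto simp: turn_mult_entry turn_entry tcos_tsin[OF assms(1)] of_real_def
      scaleR_left_distrib scaleR_left_diff_distrib mult_ac algebra_simps)

lemma turn_zero: "turn n e i j 0 = 1\<^sub>m n"
  by (rule eq_matI) (auto simp: turn_entry)

lemma finv_turn:
  assumes "signs \<alpha>" "i \<noteq> j"
  shows "finv n \<alpha> \<alpha> (turn n (\<alpha> i * \<alpha> j) i j t) = turn n (\<alpha> i * \<alpha> j) i j (- t)"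
proof (rule eq_matI)
  fix a b assume "a < dim_row (turn n (\<alpha> i * \<alpha> j) i j (- t))" "b < dim_col (turn n (\<alpha> i * \<alpha> j) i j (- t))"
  then have "a < n" "b < n" by auto
  moreover have "\<alpha> i * \<alpha> j * (\<alpha> i * \<alpha> j) = (\<alpha> i * \<alpha> i) * (\<alpha> j * \<alpha> j)"
    by (simp only: ac_simps)
  ultimately show "finv n \<alpha> \<alpha> (turn n (\<alpha> i * \<alpha> j) i j t) $$ (a, b) = turn n (\<alpha> i * \<alpha> j) i j (- t) $$ (a, b)"
    using assms signs_square[OF assms(1)]
    by (auto simp: turn_entry of_real_def mult.commute[of "\<alpha> j" "\<alpha> i"] simp flip: mult.assoc)
qed auto

lemma signs_mult: "signs \<alpha> \<Longrightarrow> \<alpha> i * \<alpha> j = 1 \<or> \<alpha> i * \<alpha> j = - 1"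
  unfolding signs_def by (metis mult_1 mult_minus_left minus_minus)

lemma turn_in_frames:
  assumes "signs \<alpha>" "i < n" "j < n" "i \<noteq> j"
  shows "turn n (\<alpha> i * \<alpha> j) i j t \<in> isom n \<alpha>"
  using assms by (simp add: frames_iff_finv finv_turn turn_add signs_mult turn_zero)

text \<open>The isometry group of the span of the lines in \<open>J\<close>, extended by the
  identity on the other lines.\<close>

definition block :: "nat \<Rightarrow> (nat \<Rightarrow> real) \<Rightarrow> nat set \<Rightarrow> quat mat set" where
  "block n e J = {A \<in> isom n e. \<forall>a<n. \<forall>b<n. \<not> (a \<in> J \<and> b \<in> J) \<longrightarrow>
     A $$ (a, b) = (if a = b then 1 else 0)}"

text \<open>The other columns are orthogonal to column \<open>i\<close>, which is a basis vector, so
  row \<open>i\<close> vanishes off the diagonal as well.\<close>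

lemma block_remove:
  assumes e: "signs e" and B: "B \<in> block n e J" and i: "i < n"
    and col: "\<And>a. a < n \<Longrightarrow> B $$ (a, i) = (if a = i then 1 else 0)"
  shows "B \<in> block n e (J - {i})"
proof -
  have F: "B \<in> isom n e"
    using B by (simp add: block_def)
  have row: "B $$ (i, b) = 0" if "b < n" "b \<noteq> i" for b
  proof -
    have "(\<Sum>k<n. e k *\<^sub>R (qcnj (B $$ (k, i)) * B $$ (k, b))) = e i *\<^sub>R B $$ (i, b)"
      using i by (subst sum.remove[of _ i]) (auto simp: col)
    then have "e i *\<^sub>R B $$ (i, b) = 0"
      using frames_column[OF F i that(1)] that by simp
    then show ?thesis
      using signs_nonzero[OF e] by simp
  qed
  show ?thesis
    using B row col F i unfolding block_def by auto
qed

lemma block_qdiag_mult: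
  assumes "signs e" "B \<in> block n e J" "i \<in> J" "norm x = 1"
  shows "qdiag n (\<lambda>c. if c = i then x else 1) * B \<in> block n e J"
proof -
  have B: "B \<in> isom n e"
    using assms(2) by (simp add: block_def)
  have "qdiag n (\<lambda>c. if c = i then x else 1) * B \<in> isom n e"
    by (rule frames_mult[OF assms(1,1) qdiag_in_frames B]) (simp add: assms)
  then show ?thesis
    using assms frames_carrier[OF B] by (auto simp: block_def)
qed

lemma block_turn_mult:
  assumes "signs e" "B \<in> block n e J" "i \<in> J" "j \<in> J" "i < n" "j < n" "i \<noteq> j"
  shows "turn n (e i * e j) i j t * B \<in> block n e J"
proof -
  have B: "B \<in> isom n e"
    using assms(2) by (simp add: block_def)
  have "turn n (e i * e j) i j t * B \<in> isom n e"
    by (rule frames_mult[OF assms(1,1) turn_in_frames[OF assms(1,5-7)] B])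
  then show ?thesis
    using assms frames_carrier[OF B] by (auto simp: block_def turn_mult_entry)
qed

lemma unit_phase: "\<exists>u. norm u = 1 \<and> u * v = of_real (norm v)" for v :: quat
proof (cases "v = 0")
  case False
  have "(qcnj v /\<^sub>R norm v) * v = of_real (norm v)"
    using False by (simp add: qcnj_mult_self of_real_def power2_eq_square)
  then show ?thesis
    using False by (intro exI[of _ "qcnj v /\<^sub>R norm v"]) simp
qed (auto intro: exI[of _ 1])

text \<open>Gaussian elimination: among the matrices \<open>h A\<close> with \<open>h \<in> H\<close>, one whose \<open>i\<close>-th column has the
  fewest nonzero entries must have the \<open>i\<close>-th basis vector as that column, up to a generator.\<close>

lemma generation:
  assumes e: "signs e" and J: "J \<subseteq> {..<n}"
    and H: "H \<subseteq> isom n e" and H_one: "1\<^sub>m n \<in> H"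
    and H_mult: "\<And>A B. A \<in> H \<Longrightarrow> B \<in> H \<Longrightarrow> A * B \<in> H"
    and H_inv: "\<And>A. A \<in> H \<Longrightarrow> finv n e e A \<in> H"
    and H_unit: "\<And>i x. i \<in> J \<Longrightarrow> norm x = 1 \<Longrightarrow> qdiag n (\<lambda>c. if c = i then x else 1) \<in> H"
    and H_turn: "\<And>i j t. i \<in> J \<Longrightarrow> j \<in> J \<Longrightarrow> i \<noteq> j \<Longrightarrow> tcos (e i * e j) t \<ge> 0 \<Longrightarrow>
      turn n (e i * e j) i j t \<in> H"
  shows "block n e J \<subseteq> H"
proof -
  have "finite J"
    using J finite_subset by blast
  then show ?thesis
    using J H_unit H_turn
  proof (induction J rule: finite_remove_induct)
    case empty
    have "A = 1\<^sub>m n" if "A \<in> block n e {}" for A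
      using that frames_carrier[of A n e e] by (intro eq_matI) (auto simp: block_def)
    then show ?case
      using H_one by auto
  next
    case (remove J)
    obtain i where i: "i \<in> J" "i < n"
      using remove.hyps remove.prems(1) by blast
    have IH: "block n e (J - {i}) \<subseteq> H"
      using remove.IH[OF i(1)] remove.prems by auto
    show ?case
    proof
      fix A assume A: "A \<in> block n e J"
      \<comment> \<open>The matrices reachable from \<open>A\<close> by elements of
        \<open>H\<close>; membership in the block keeps column \<open>i\<close> supported in
        \<open>J\<close>.\<close>
      define R where "R B \<longleftrightarrow> B \<in> block n e J \<and> (\<exists>h\<in>H. B = h * A)" for B
      have A_carrier: "A \<in> carrier_mat n n"
        using A frames_carrier by (auto simp: block_def)
      have R_carrier: "B \<in> carrier_mat n n" if "R B" for B
        using that frames_carrier by (auto simp: block_def R_def)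
      have R_step: "R (g * B)" if "R B" "g \<in> H" "g * B \<in> block n e J" for g B
      proof -
        obtain h where h: "h \<in> H" "B = h * A"
          using \<open>R B\<close> by (auto simp: R_def)
        then have "g * B = (g * h) * A"
          using assoc_mult_mat[of g n n h n A n] that(2) H A_carrier frames_carrier by (metis subsetD)
        then show ?thesis
          using that h H_mult unfolding R_def by blast
      qed
      have R_unit: "R (qdiag n (\<lambda>c. if c = x then u else 1) * B)" if "R B" "x \<in> J" "norm u = 1" for B x u
        using that remove.prems(2)[of x u] R_step block_qdiag_mult[OF e, of B n J x u] by (auto simp: R_def)
      have R_turn: "R (turn n (e x * e y) x y t * B)"
        if "R B" "x \<in> J" "y \<in> J" "x \<noteq> y" "tcos (e x * e y) t \<ge> 0" for B x y t
      proof (rule R_step[OF that(1)])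
        show "turn n (e x * e y) x y t \<in> H"
          using that remove.prems(3) by blast
        show "turn n (e x * e y) x y t * B \<in> block n e J"
          using that remove.prems(1) by (intro block_turn_mult[OF e]) (auto simp: R_def)
      qed
      have R_phase: "\<exists>B'. R B' \<and> B' $$ (x, i) = of_real (norm (B $$ (x, i))) \<and>
          (\<forall>a<n. a \<noteq> x \<longrightarrow> B' $$ (a, i) = B $$ (a, i))" if B: "R B" "x \<in> J" for B x
      proof -
        obtain u where u: "norm u = 1" "u * B $$ (x, i) = of_real (norm (B $$ (x, i)))"
          using unit_phase by blast
        have "x < n"
          using B remove.prems by auto
        then show ?thesis
          using R_unit[OF B u(1)] R_carrier[OF B(1)] i u by (intro exI[of _ "qdiag n (\<lambda>c. if c = x then u else 1) * B"]) auto
      qed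
      \<comment> \<open>Units first make both entries real and nonnegative, so that a real turn can
        cancel the one at \<open>y\<close>. For opposite signs the turn is a boost, which can only
        cancel the smaller entry.\<close>
      have R_elim: "\<exists>B'. R B' \<and> B' $$ (y, i) = 0 \<and> (\<forall>a<n. a \<noteq> x \<longrightarrow> a \<noteq> y \<longrightarrow> B' $$ (a, i) = B $$ (a, i))"
        if B: "R B" and xy: "x \<in> J" "y \<in> J" "x \<noteq> y" "B $$ (y, i) \<noteq> 0"
          and sm: "e x = e y \<or> norm (B $$ (y, i)) < norm (B $$ (x, i))" for B x y
      proof -
        have n: "x < n" "y < n"
          using xy remove.prems by auto
        obtain B1 where B1: "R B1" "B1 $$ (x, i) = of_real (norm (B $$ (x, i)))"
          "\<forall>a<n. a \<noteq> x \<longrightarrow> B1 $$ (a, i) = B $$ (a, i)"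
          using R_phase[OF B xy(1)] by blast
        obtain B2 where B2: "R B2" "B2 $$ (y, i) = of_real (norm (B1 $$ (y, i)))"
          "\<forall>a<n. a \<noteq> y \<longrightarrow> B2 $$ (a, i) = B1 $$ (a, i)"
          using R_phase[OF B1(1) xy(2)] by blast
        define X Y where "X = norm (B $$ (x, i))" and "Y = norm (B $$ (y, i))"
        have B2xy: "B2 $$ (x, i) = of_real X" "B2 $$ (y, i) = of_real Y"
          using B1 B2 n xy by (auto simp: X_def Y_def)
        have "e x * e y = 1 \<or> Y < X"
          using sm signs_square[OF e] by (auto simp: X_def Y_def)
        then obtain t where t: "tcos (e x * e y) t \<ge> 0" "tsin (e x * e y) t * X + tcos (e x * e y) t * Y = 0"
          using turn_angle[OF signs_mult[OF e], of X Y x y] xy unfolding X_def Y_def by auto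
        let ?B = "turn n (e x * e y) x y t * B2"
        have "?B $$ (y, i) = of_real (tsin (e x * e y) t * X + tcos (e x * e y) t * Y)"
          using turn_mult_entry[OF R_carrier[OF B2(1)] n xy(3) n(2) i(2)] xy B2xy by (simp add: of_real_def scaleR_left_distrib)
        then have "?B $$ (y, i) = 0"
          using t by simp
        moreover have "?B $$ (a, i) = B $$ (a, i)" if "a < n" "a \<noteq> x" "a \<noteq> y" for a
          using turn_mult_entry[OF R_carrier[OF B2(1)] n xy(3) that(1) i(2)] that B1 B2 by auto
        ultimately show ?thesis
          using R_turn[OF B2(1) xy(1-3) t(1)] by blast
      qed
      define S where "S B = {a \<in> J. B $$ (a, i) \<noteq> 0}" for B :: "quat mat"
      have fin: "finite (S B)" for B
        using \<open>finite J\<close> by (simp add: S_def)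
      have S_col: "(\<Sum>a\<in>S B. e a * (norm (B $$ (a, i)))\<^sup>2) = e i" if "R B" for B
      proof -
        have B: "B \<in> block n e J"
          using that by (simp add: R_def)
        then have "(\<Sum>k<n. e k *\<^sub>R (qcnj (B $$ (k, i)) * B $$ (k, i))) = of_real (e i)"
          using frames_column[of B n e e i i] i by (simp add: block_def)
        then have "of_real (\<Sum>k<n. e k * (norm (B $$ (k, i)))\<^sup>2) = (of_real (e i) :: quat)"
          by (simp add: qcnj_mult_self scaleR_conv_of_real)
        then have "(\<Sum>k<n. e k * (norm (B $$ (k, i)))\<^sup>2) = e i"
          by (simp only: of_real_eq_iff)
        moreover have "B $$ (k, i) = 0" if "k < n" "k \<notin> J" for k
          using B i that unfolding block_def by auto
        then have "(\<Sum>k<n. e k * (norm (B $$ (k, i)))\<^sup>2) = (\<Sum>a\<in>S B. e a * (norm (B $$ (a, i)))\<^sup>2)"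
          using remove.prems(1) unfolding S_def by (intro sum.mono_neutral_right) auto
        ultimately show ?thesis by simp
      qed
      have "R A"
        using A H_one A_carrier left_mult_one_mat[of A n n] unfolding R_def by metis
      then obtain B where B: "R B" "\<And>B'. R B' \<Longrightarrow> card (S B) \<le> card (S B')"
        using ex_has_least_nat[of R A "\<lambda>B. card (S B)"] by blast
      \<comment> \<open>A further cancellation would contradict minimality. By symmetry, distinct
        nonzero entries have opposite signs and equal norms.\<close>
      have irreducible: "e x \<noteq> e y \<and> \<not> norm (B $$ (y, i)) < norm (B $$ (x, i))"
        if xy: "x \<in> S B" "y \<in> S B" "x \<noteq> y" for x y
      proof (rule ccontr)
        assume "\<not> ?thesis"
        then obtain B' where B': "R B'" "B' $$ (y, i) = 0" "\<forall>a<n. a \<noteq> x \<longrightarrow> a \<noteq> y \<longrightarrow> B' $$ (a, i) = B $$ (a, i)"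
          using R_elim[OF B(1), of x y] xy unfolding S_def by blast
        then have "S B' \<subseteq> S B - {y}"
          using that remove.prems unfolding S_def by auto
        then have "card (S B') < card (S B)"
          using that(2) fin by (metis card_Diff1_less card_mono finite_Diff order.strict_trans1)
        then show False
          using B(2)[OF B'(1)] by simp
      qed
      have "S B \<noteq> {}"
        using S_col[OF B(1)] signs_nonzero[OF e] by (metis sum.empty)
      then obtain x where x: "x \<in> S B" by auto
      \<comment> \<open>With only two signs available there are at most two entries, and two of
        opposite sign and equal norm would make column \<open>i\<close> isotropic, against
        \<open>S_col\<close>.\<close>
      have Sx: "S B = {x}"
      proof (rule ccontr)
        assume "S B \<noteq> {x}"
        then obtain y where y: "y \<in> S B" "y \<noteq> x"
          using x by auto
        have exy: "e y = - e x"
          using irreducible[OF x y(1)] y(2) e unfolding signs_def by (metis minus_minus)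
        have "z = x \<or> z = y" if "z \<in> S B" for z
          using irreducible[OF that x] irreducible[OF that y(1)] exy e unfolding signs_def by (metis minus_minus)
        then have "S B = {x, y}"
          using x y by auto
        moreover have "norm (B $$ (y, i)) = norm (B $$ (x, i))"
          using irreducible[OF x y(1)] irreducible[OF y(1) x] y(2) by auto
        ultimately have "e i = 0"
          using S_col[OF B(1)] exy y(2) by simp
        then show False
          using signs_nonzero[OF e] by simp
      qed
      have "e x * (norm (B $$ (x, i)))\<^sup>2 = e i"
        using S_col[OF B(1)] Sx by simp
      then have "e x * e i = (e x * e x) * (norm (B $$ (x, i)))\<^sup>2"
        by (simp add: mult.assoc)
      then have "e x * e i \<ge> 0"
        by (simp add: signs_square[OF e])
      then have "e x * e i = 1"
        using signs_mult[OF e, of x i] by auto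
      then have "e x * (e i * e i) = e i"
        by (simp only: mult.assoc[symmetric])
      then have ex: "e x = e i"
        by (simp add: signs_square[OF e])
      \<comment> \<open>The signs at \<open>x\<close> and \<open>i\<close> agree, so the plane of
        the two lines has rotations, and one of them moves the remaining entry from \<open>x\<close>
        to \<open>i\<close>.\<close>
      have "\<exists>B'. R B' \<and> S B' \<subseteq> {i}"
      proof (cases "x = i")
        case True
        then show ?thesis
          using B(1) Sx by blast
      next
        case False
        have xJ: "x \<in> J" "B $$ (x, i) \<noteq> 0"
          using x by (auto simp: S_def)
        obtain B' where B': "R B'" "B' $$ (x, i) = 0" "\<forall>a<n. a \<noteq> i \<longrightarrow> a \<noteq> x \<longrightarrow> B' $$ (a, i) = B $$ (a, i)"
          using R_elim[OF B(1) i(1) xJ(1) not_sym[OF False] xJ(2) disjI1[OF ex[symmetric]]] by blast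
        have "a = i" if "a \<in> S B'" for a
        proof (rule ccontr)
          assume "a \<noteq> i"
          moreover have "a \<in> J" "a < n" "a \<noteq> x"
            using that B'(2) remove.prems(1) by (auto simp: S_def)
          ultimately have "a \<in> S B"
            using that B'(3) by (simp add: S_def)
          then show False
            using Sx \<open>a \<noteq> x\<close> by simp
        qed
        then show ?thesis
          using B'(1) by blast
      qed
      then obtain B' where B': "R B'" "S B' \<subseteq> {i}"
        by blast
      obtain B1 where B1: "R B1" "B1 $$ (i, i) = of_real (norm (B' $$ (i, i)))"
        "\<forall>a<n. a \<noteq> i \<longrightarrow> B1 $$ (a, i) = B' $$ (a, i)"
        using R_phase[OF B'(1) i(1)] by blast
      have "e i \<noteq> 0"
        by (rule signs_nonzero[OF e])
      have "a = i" if "a \<in> S B1" for a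
      proof (rule ccontr)
        assume "a \<noteq> i"
        moreover have "a < n"
          using that remove.prems(1) by (auto simp: S_def)
        ultimately have "a \<in> S B'"
          using that B1(3) by (simp add: S_def)
        then show False
          using B'(2) \<open>a \<noteq> i\<close> by blast
      qed
      then have "S B1 \<subseteq> {i}"
        by blast
      then have "S B1 = {i}"
        using S_col[OF B1(1)] \<open>e i \<noteq> 0\<close> by (metis subset_singleton_iff sum.empty)
      then have "(norm (B1 $$ (i, i)))\<^sup>2 = 1"
        using S_col[OF B1(1)] \<open>e i \<noteq> 0\<close> by simp
      then have "B1 $$ (i, i) = 1"
        using B1(2) by (simp add: power2_eq_1_iff) (metis norm_ge_zero le_minus_one_simps(3))
      moreover have B1J: "B1 \<in> block n e J"
        using B1 by (simp add: R_def)
      ultimately have "B1 \<in> block n e (J - {i})"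
      proof (intro block_remove[OF e B1J i(2)])
        fix a assume "a < n"
        then show "B1 $$ (a, i) = (if a = i then 1 else 0)"
          using \<open>B1 $$ (i, i) = 1\<close> \<open>S B1 = {i}\<close> B1J i unfolding S_def block_def by (cases "a \<in> J") auto
      qed
      then have "B1 \<in> H"
        using IH by auto
      obtain h where h: "h \<in> H" "B1 = h * A"
        using B1 by (auto simp: R_def)
      have hF: "h \<in> isom n e"
        using h H by auto
      have "finv n e e h * B1 = A"
        unfolding h(2) using frames_carrier[OF hF] A_carrier
        by (simp add: finv_left[OF e hF] flip: assoc_mult_mat[of _ n n _ n _ n])
      then show "A \<in> H"
        using H_mult[OF H_inv[OF h(1)] \<open>B1 \<in> H\<close>] by simp
    qed
  qed
qed

section \<open>Functions with the doubling formula of the cosine\<close>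

lemma attains_between:
  fixes g :: "real \<Rightarrow> real"
  assumes "continuous_on UNIV g" "g x \<le> c" "c \<le> g y"
  shows "\<exists>t. g t = c"
proof -
  have "connected (range g)"
    by (rule connected_continuous_image[OF assms(1) connected_UNIV])
  then have "c \<in> range g"
    using connectedD_interval[of "range g" "g x" "g y" c] assms by auto
  then show ?thesis by auto
qed

text \<open>\<open>g (2 * t) - 1\<close> is \<open>2 * (g t + 1)\<close> times
  \<open>g t - 1\<close>, so the distance from 1 at least doubles as long as \<open>g\<close> is
  nonnegative.\<close>

lemma double_angle_iterate:
  fixes g :: "real \<Rightarrow> real"
  assumes double: "\<And>t. g (2 * t) = 2 * (g t)\<^sup>2 - 1" and pos: "\<And>k. 0 \<le> g (2 ^ k * t)"
  shows "2 ^ k * \<bar>g t - 1\<bar> \<le> \<bar>g (2 ^ k * t) - 1\<bar>"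
proof (induction k)
  case (Suc k)
  let ?x = "g (2 ^ k * t)"
  have "g (2 ^ Suc k * t) - 1 = 2 * (?x + 1) * (?x - 1)"
    using double[of "2 ^ k * t"] by (simp add: mult.assoc power2_eq_square algebra_simps)
  then have "\<bar>g (2 ^ Suc k * t) - 1\<bar> = (2 * (?x + 1)) * \<bar>?x - 1\<bar>"
    using pos[of k] by (simp add: abs_mult)
  moreover have "2 * \<bar>?x - 1\<bar> \<le> (2 * (?x + 1)) * \<bar>?x - 1\<bar>"
    using pos[of k] by (intro mult_right_mono) auto
  ultimately show ?case
    using Suc.IH by simp
qed simp

text \<open>Values in the unit interval have distance at most 1 from 1, so the doubling distance
  forces \<open>g\<close> to become negative somewhere; on the way from there to 0 it takes all
  values between 0 and 1.\<close>

lemma double_angle_bounded: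
  fixes g :: "real \<Rightarrow> real"
  assumes cont: "continuous_on UNIV g" and zero: "g 0 = 1"
    and double: "\<And>t. g (2 * t) = 2 * (g t)\<^sup>2 - 1"
    and bound: "\<And>t. \<bar>g t\<bar> \<le> 1" and t0: "g t0 \<noteq> 1" and c: "0 \<le> c" "c \<le> 1"
  shows "\<exists>t. g t = c"
proof -
  have "\<exists>k. g (2 ^ k * t0) < 0"
  proof (rule ccontr)
    assume "\<not> ?thesis"
    then have pos: "0 \<le> g (2 ^ k * t0)" for k
      by (simp add: not_less)
    obtain k where "1 / \<bar>g t0 - 1\<bar> < 2 ^ k"
      using real_arch_pow[of 2 "1 / \<bar>g t0 - 1\<bar>"] by auto
    then have "1 < 2 ^ k * \<bar>g t0 - 1\<bar>"
      using t0 by (simp add: divide_less_eq)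
    also have "\<dots> \<le> \<bar>g (2 ^ k * t0) - 1\<bar>"
      by (rule double_angle_iterate[of g, OF double pos])
    also have "\<dots> \<le> 1"
      using bound[of "2 ^ k * t0"] pos[of k] by linarith
    finally show False by simp
  qed
  then obtain k where "g (2 ^ k * t0) < 0" ..
  then show ?thesis
    using attains_between[OF cont, of "2 ^ k * t0" c 0] zero c by simp
qed

text \<open>Here \<open>g\<close> stays positive, so the doubling never stops and \<open>g\<close>
  is unbounded.\<close>

lemma double_angle_unbounded:
  fixes g :: "real \<Rightarrow> real"
  assumes cont: "continuous_on UNIV g" and zero: "g 0 = 1"
    and double: "\<And>t. g (2 * t) = 2 * (g t)\<^sup>2 - 1"
    and bound: "\<And>t. 1 \<le> g t" and t0: "g t0 \<noteq> 1" and c: "1 \<le> c"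
  shows "\<exists>t. g t = c"
proof -
  obtain k where "c / \<bar>g t0 - 1\<bar> < 2 ^ k"
    using real_arch_pow[of 2 "c / \<bar>g t0 - 1\<bar>"] by auto
  then have "c < 2 ^ k * \<bar>g t0 - 1\<bar>"
    using t0 by (simp add: divide_less_eq)
  also have "\<dots> \<le> \<bar>g (2 ^ k * t0) - 1\<bar>"
    by (rule double_angle_iterate[of g, OF double]) (use bound order_trans zero_le_one in blast)
  also have "\<dots> \<le> g (2 ^ k * t0)"
    using bound[of "2 ^ k * t0"] by simp
  finally show ?thesis
    using attains_between[OF cont, of 0 c "2 ^ k * t0"] zero c by simp
qed

section \<open>Units acting on one line\<close>

definition unit_at :: "nat \<Rightarrow> nat \<Rightarrow> quat \<Rightarrow> quat mat" where
  "unit_at n i x = qdiag n (\<lambda>c. if c = i then x else 1)"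

lemma unit_at_carrier [simp]: "unit_at n i x \<in> carrier_mat n n" "dim_row (unit_at n i x) = n"
  "dim_col (unit_at n i x) = n"
  by (auto simp: unit_at_def)

lemma unit_at_entry [simp]:
  "a < n \<Longrightarrow> b < n \<Longrightarrow> unit_at n i x $$ (a, b) = (if a = b then if a = i then x else 1 else 0)"
  by (simp add: unit_at_def)

lemma unit_at_mult_entry [simp]:
  assumes "A \<in> carrier_mat n n" "a < n" "b < n"
  shows "(unit_at n i x * A) $$ (a, b) = (if a = i then x * A $$ (a, b) else A $$ (a, b))"
    "(A * unit_at n i x) $$ (a, b) = (if b = i then A $$ (a, b) * x else A $$ (a, b))"
  using assms by (auto simp: unit_at_def)

lemma unit_at_in_frames: "norm x = 1 \<Longrightarrow> unit_at n i x \<in> isom n e"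
  unfolding unit_at_def by (rule qdiag_in_frames) simp

text \<open>Commuting with -1 on line \<open>c\<close> separates this line from the others, and
  commuting with all its units makes the diagonal entry real, of norm 1. The sign stays open; it
  disappears later, when elements are written as squares.\<close>

lemma commutes_unit_at:
  assumes e: "signs e" and X: "X \<in> isom n e" and c: "c < n"
    and comm: "\<And>x. norm x = 1 \<Longrightarrow> X * unit_at n c x = unit_at n c x * X"
  shows "a < n \<Longrightarrow> a \<noteq> c \<Longrightarrow> X $$ (a, c) = 0" "a < n \<Longrightarrow> a \<noteq> c \<Longrightarrow> X $$ (c, a) = 0"
    "X $$ (c, c) * X $$ (c, c) = 1"
proof -
  note cX = frames_carrier[OF X]
  have ent: "(X * unit_at n c x) $$ (a, b) = (unit_at n c x * X) $$ (a, b)" if "norm x = 1" for x a b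
    using comm[OF that] by simp
  show z: "X $$ (a, c) = 0" if "a < n" "a \<noteq> c" for a
    using ent[of "- 1" a c] that c cX by (simp add: quat_eq_uminus_iff)
  show "X $$ (c, a) = 0" if "a < n" "a \<noteq> c" for a
    using ent[of "- 1" c a] that c cX by (simp add: quat_eq_uminus_iff)
  have "X $$ (c, c) * x = x * X $$ (c, c)" if "norm x = 1" for x
    using ent[OF that, of c c] c cX by simp
  then have re: "X $$ (c, c) = of_real (qre (X $$ (c, c)))"
    by (intro commute_anticommuting_units[OF iq_jq(1-3)]) (simp_all add: iq_jq)
  show "X $$ (c, c) * X $$ (c, c) = 1"
    by (rule real_unit_square[OF frames_isolated_column_norm[OF e X c z] re])
qed

lemma mult_isolated_entry:
  assumes "A \<in> carrier_mat n n" "B \<in> carrier_mat n n" "c < n"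
    and "\<And>a. a < n \<Longrightarrow> a \<noteq> c \<Longrightarrow> A $$ (c, a) = 0"
  shows "(A * B) $$ (c, c) = A $$ (c, c) * B $$ (c, c)"
  unfolding mat_mult_entry[OF assms(1,2,3,3)] using assms(3,4) by (subst sum.remove[of _ c]) auto

lemma frames_idempotent:
  assumes "signs e" "A \<in> isom n e" "A * A = A"
  shows "A = 1\<^sub>m n"
proof -
  note c = frames_carrier[OF assms(2)]
  have "finv n e e A * (A * A) = finv n e e A * A"
    by (simp add: assms(3))
  then show ?thesis
    using c by (simp add: finv_left[OF assms(1,2)] flip: assoc_mult_mat[of _ n n _ n _ n])
qed

lemma finv_unique:
  assumes "signs e" "A \<in> isom n e" "B \<in> carrier_mat n n" "B * A = 1\<^sub>m n"
  shows "B = finv n e e A"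
proof -
  note c = frames_carrier[OF assms(2)]
  have "B = B * (A * finv n e e A)"
    using assms(3) by (simp add: finv_right[OF assms(1,2)])
  also have "\<dots> = (B * A) * finv n e e A"
    using c assms(3) by (simp add: assoc_mult_mat[of _ n n _ n _ n])
  finally show ?thesis
    by (simp add: assms(4))
qed

lemma turn_commutes_unit_at:
  assumes "c \<noteq> i" "c \<noteq> j"
  shows "turn n e i j t * unit_at n c x = unit_at n c x * turn n e i j t"
  using assms by (intro eq_matI) (auto simp: turn_entry)

text \<open>Reflecting one axis inverts rotations and boosts alike. This provides a second
  expression for the inverse of a turn.\<close>

lemma turn_conj_reflection:
  assumes "i \<noteq> j"
  shows "unit_at n i (- 1) * turn n e i j t * unit_at n i (- 1) = turn n e i j (- t)"
  using assms by (intro eq_matI) (auto simp: turn_entry mult_carrier_mat[of _ n n _ n])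

section \<open>Homomorphisms normalized on the diagonal\<close>

text \<open>The situation after diagonalization: \<open>G\<close> is the embedding in the adapted
  basis, \<open>\<sigma> i\<close> its effect on the units of line \<open>i\<close>, and line
  \<open>m\<close> belongs to the commuting Sp(1). Continuity is stated along real paths, entry by
  entry, ready for the intermediate value theorem.\<close>

locale normalized_hom =
  fixes m n :: nat and \<alpha> e :: "nat \<Rightarrow> real" and G :: "quat mat \<Rightarrow> quat mat"
    and \<sigma> :: "nat \<Rightarrow> quat \<Rightarrow> quat"
  assumes n: "n = Suc m" and \<alpha>: "signs \<alpha>" and e: "signs e"
    and G_frames: "\<And>A. A \<in> isom m \<alpha> \<Longrightarrow> G A \<in> isom n e"
    and G_mult: "\<And>A B. A \<in> isom m \<alpha> \<Longrightarrow> B \<in> isom m \<alpha> \<Longrightarrow> G (A * B) = G A * G B"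
    and G_inj: "inj_on G (isom m \<alpha>)"
    and G_cont: "\<And>X i j. (\<And>t::real. X t \<in> isom m \<alpha>) \<Longrightarrow>
      (\<And>a b. a < m \<Longrightarrow> b < m \<Longrightarrow> continuous_on UNIV (\<lambda>t. X t $$ (a, b))) \<Longrightarrow> i < n \<Longrightarrow> j < n \<Longrightarrow>
      continuous_on UNIV (\<lambda>t. G (X t) $$ (i, j))"
    and G_unit: "\<And>i x. i < m \<Longrightarrow> norm x = 1 \<Longrightarrow> G (unit_at m i x) = unit_at n i (\<sigma> i x)"
    and \<sigma>_neg: "\<And>i. i < m \<Longrightarrow> \<sigma> i (- 1) = - 1"
    and \<sigma>_surj: "\<And>i y. i < m \<Longrightarrow> norm y = 1 \<Longrightarrow> \<exists>x. norm x = 1 \<and> \<sigma> i x = y"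
    and G_comm: "\<And>A x. A \<in> isom m \<alpha> \<Longrightarrow> norm x = 1 \<Longrightarrow> G A * unit_at n m x = unit_at n m x * G A"
begin

lemma G_carrier: "A \<in> isom m \<alpha> \<Longrightarrow> G A \<in> carrier_mat n n"
  by (rule frames_carrier[OF G_frames])

lemma G_one: "G (1\<^sub>m m) = 1\<^sub>m n"
proof (rule frames_idempotent[OF e G_frames[OF one_in_frames]])
  show "G (1\<^sub>m m) * G (1\<^sub>m m) = G (1\<^sub>m m)"
    using G_mult[OF one_in_frames one_in_frames] by simp
qed

lemma G_isolated:
  assumes A: "A \<in> isom m \<alpha>"
  shows "a < n \<Longrightarrow> a \<noteq> m \<Longrightarrow> G A $$ (a, m) = 0" "a < n \<Longrightarrow> a \<noteq> m \<Longrightarrow> G A $$ (m, a) = 0"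
    "G A $$ (m, m) * G A $$ (m, m) = 1"
proof -
  have "m < n"
    by (simp add: n)
  note I = commutes_unit_at[OF e G_frames[OF A] this G_comm[OF A]]
  show "a < n \<Longrightarrow> a \<noteq> m \<Longrightarrow> G A $$ (a, m) = 0" "a < n \<Longrightarrow> a \<noteq> m \<Longrightarrow> G A $$ (m, a) = 0"
    "G A $$ (m, m) * G A $$ (m, m) = 1"
    using I by blast+
qed

lemma G_mult_corner:
  "A \<in> isom m \<alpha> \<Longrightarrow> B \<in> isom m \<alpha> \<Longrightarrow> G (A * B) $$ (m, m) = G A $$ (m, m) * G B $$ (m, m)"
  unfolding G_mult by (rule mult_isolated_entry) (auto simp: n G_carrier[unfolded n] G_isolated[unfolded n])

lemma turn_half:
  "i < m \<Longrightarrow> j < m \<Longrightarrow> i \<noteq> j \<Longrightarrow> turn m (\<alpha> i * \<alpha> j) i j t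
    = turn m (\<alpha> i * \<alpha> j) i j (t / 2) * turn m (\<alpha> i * \<alpha> j) i j (t / 2)"
  using turn_add[OF signs_mult[OF \<alpha>], of i m j i j "t / 2" "t / 2"] by simp

text \<open>The corner entry is multiplicative with square 1, and it is trivial on generators: units
  of the first \<open>m\<close> lines do not touch line \<open>m\<close>, and a turn is the square
  of its half. So \<open>generation\<close> applies to the kernel \<open>H\<close>.\<close>

lemma G_corner: "A \<in> isom m \<alpha> \<Longrightarrow> G A $$ (m, m) = 1"
proof -
  define H where "H = {A \<in> isom m \<alpha>. G A $$ (m, m) = 1}"
  have "block m \<alpha> {..<m} \<subseteq> H"
  proof (rule generation[OF \<alpha>])
    show "1\<^sub>m m \<in> H"
      by (simp add: H_def one_in_frames G_one n)
    show "A * B \<in> H" if "A \<in> H" "B \<in> H" for A B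
      using that frames_mult[OF \<alpha> \<alpha>] by (simp add: H_def G_mult_corner)
    show "finv m \<alpha> \<alpha> A \<in> H" if "A \<in> H" for A
      using that G_mult_corner[of "finv m \<alpha> \<alpha> A" A] finv_in_frames[OF \<alpha> \<alpha>, of A m]
      by (simp add: H_def finv_left[OF \<alpha>] G_one n)
    show "qdiag m (\<lambda>c. if c = i then x else 1) \<in> H" if "i \<in> {..<m}" "norm x = 1" for i x
      using that unit_at_in_frames[of x m i \<alpha>] G_unit[of i x] by (simp add: H_def n flip: unit_at_def)
    show "turn m (\<alpha> i * \<alpha> j) i j t \<in> H" if "i \<in> {..<m}" "j \<in> {..<m}" "i \<noteq> j" for i j t
    proof -
      have f: "turn m (\<alpha> i * \<alpha> j) i j s \<in> isom m \<alpha>" for s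
        using turn_in_frames[OF \<alpha>] that by simp
      have "G (turn m (\<alpha> i * \<alpha> j) i j t) $$ (m, m) = 1"
        using that by (subst turn_half) (simp_all add: G_mult_corner f G_isolated)
      then show ?thesis
        using f by (simp add: H_def)
    qed
  qed (auto simp: H_def)
  then show "A \<in> isom m \<alpha> \<Longrightarrow> G A $$ (m, m) = 1"
    by (auto simp: block_def H_def)
qed

lemma G_block: "A \<in> isom m \<alpha> \<Longrightarrow> G A \<in> block n e {..<m}"
  using G_frames G_corner G_isolated by (auto simp: block_def n less_Suc_eq)

section \<open>The image of the turns in the plane of two lines\<close>

context
  fixes i j
  assumes ij: "i < m" "j < m" "i \<noteq> j"
begin

lemma ij_n: "i < n" "j < n"
  using ij n by auto

abbreviation "X t \<equiv> turn m (\<alpha> i * \<alpha> j) i j t"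

lemma X_frames: "X t \<in> isom m \<alpha>"
  by (rule turn_in_frames[OF \<alpha> ij])

lemma GX_add: "G (X s) * G (X t) = G (X (s + t))"
  using G_mult[OF X_frames X_frames] turn_add[OF signs_mult[OF \<alpha>] ij] by simp

text \<open>A turn commutes with the units of each line outside its plane. As
  \<open>\<sigma> c\<close> is onto, or by \<open>G_comm\<close> if \<open>c = m\<close>, its image
  commutes with all units of line \<open>c\<close>; halving the angle makes the sign there
  1.\<close>

lemma GX_isolated:
  assumes c: "c < n" "c \<noteq> i" "c \<noteq> j"
  shows "a < n \<Longrightarrow> a \<noteq> c \<Longrightarrow> G (X t) $$ (a, c) = 0" "a < n \<Longrightarrow> a \<noteq> c \<Longrightarrow> G (X t) $$ (c, a) = 0"
    "G (X t) $$ (c, c) = 1"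
proof -
  have comm: "G (X t) * unit_at n c y = unit_at n c y * G (X t)" if y: "norm y = 1" for y t
  proof (cases "c = m")
    case True
    then show ?thesis
      using G_comm[OF X_frames y] by simp
  next
    case False
    then have "c < m"
      using c n by simp
    then obtain x where x: "norm x = 1" "\<sigma> c x = y"
      using \<sigma>_surj y by blast
    have "G (X t * unit_at m c x) = G (unit_at m c x * X t)"
      by (simp add: turn_commutes_unit_at c)
    then show ?thesis
      using x \<open>c < m\<close> by (simp add: G_mult X_frames unit_at_in_frames G_unit)
  qed
  note I = commutes_unit_at[OF e G_frames[OF X_frames] c(1) comm]
  show "a < n \<Longrightarrow> a \<noteq> c \<Longrightarrow> G (X t) $$ (a, c) = 0" "a < n \<Longrightarrow> a \<noteq> c \<Longrightarrow> G (X t) $$ (c, a) = 0"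
    using I by blast+
  have "G (X t) = G (X (t / 2)) * G (X (t / 2))"
    by (simp add: GX_add)
  then have "G (X t) $$ (c, c) = G (X (t / 2)) $$ (c, c) * G (X (t / 2)) $$ (c, c)"
    using mult_isolated_entry[OF G_carrier[OF X_frames] G_carrier[OF X_frames] c(1) I(2)] by simp
  then show "G (X t) $$ (c, c) = 1"
    using I(3) by simp
qed

lemma sum_pair: "(\<And>k. k < n \<Longrightarrow> k \<noteq> i \<Longrightarrow> k \<noteq> j \<Longrightarrow> h k = 0) \<Longrightarrow> (\<Sum>k<n. h k) = h i + (h j :: quat)"
proof -
  assume "\<And>k. k < n \<Longrightarrow> k \<noteq> i \<Longrightarrow> k \<noteq> j \<Longrightarrow> h k = 0"
  then have "(\<Sum>k<n. h k) = (\<Sum>k\<in>{i, j}. h k)"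
    using ij n by (intro sum.mono_neutral_right) auto
  then show ?thesis
    using ij by simp
qed

text \<open>In the plane of \<open>i\<close> and \<open>j\<close>, the first column of the image
  turns out to be \<open>(g t, b t)\<close>; \<open>g\<close> and the norm of \<open>b\<close> take
  the places of \<open>tcos\<close> and the absolute value of \<open>tsin\<close>.\<close>

definition "g t = qre (G (X t) $$ (i, i))"
definition "b t = G (X t) $$ (j, i)"

lemma GX_minus: "G (X (- t)) = finv n e e (G (X t))"
  by (rule finv_unique[OF e G_frames[OF X_frames] G_carrier[OF X_frames]]) (simp add: GX_add turn_zero G_one)

lemma GX_reflect: "G (X (- t)) = unit_at n i (- 1) * G (X t) * unit_at n i (- 1)"
proof -
  have u: "unit_at m i (- 1) \<in> isom m \<alpha>"
    by (rule unit_at_in_frames) simp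
  have "G (X (- t)) = G (unit_at m i (- 1) * X t * unit_at m i (- 1))"
    by (simp add: turn_conj_reflection ij)
  then show ?thesis
    using ij by (simp add: G_mult u X_frames frames_mult[OF \<alpha> \<alpha> u X_frames] G_unit \<sigma>_neg)
qed

text \<open>The inverse of \<open>G (X t)\<close> is its adjoint with respect to the form, and also
  its conjugate by the reflection in line \<open>i\<close>. Comparing both makes the entry at
  \<open>(i, i)\<close> real and expresses the one at \<open>(i, j)\<close> through
  \<open>b t\<close>.\<close>

lemma GX_entries: "G (X t) $$ (i, i) = of_real (g t)"
  "G (X t) $$ (i, j) = - ((e i * e j) *\<^sub>R qcnj (b t))"
proof -
  have eq: "finv n e e (G (X t)) $$ (a, c) = (unit_at n i (- 1) * G (X t) * unit_at n i (- 1)) $$ (a, c)" for a c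
    by (simp only: GX_minus[symmetric] GX_reflect)
  note c = G_carrier[OF X_frames]
  have "qcnj (G (X t) $$ (i, i)) = G (X t) $$ (i, i)"
    using eq[of i i] ij_n c by (simp add: mult_carrier_mat[of _ n n _ n] signs_square[OF e])
  then show "G (X t) $$ (i, i) = of_real (g t)"
    unfolding g_def by (simp only: qcnj_eq_self_iff)
  show "G (X t) $$ (i, j) = - ((e i * e j) *\<^sub>R qcnj (b t))"
    using eq[of i j] ij_n c ij by (simp add: mult_carrier_mat[of _ n n _ n] b_def)
qed

text \<open>The form has the value \<open>e i\<close> on column \<open>i\<close> of an
  isometry.\<close>

lemma g_b: "(g t)\<^sup>2 + (e i * e j) * (norm (b t))\<^sup>2 = 1"
proof -
  have "(\<Sum>k<n. e k *\<^sub>R (qcnj (G (X t) $$ (k, i)) * G (X t) $$ (k, i)))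
      = e i *\<^sub>R of_real ((g t)\<^sup>2) + e j *\<^sub>R (of_real ((norm (b t))\<^sup>2) :: quat)"
    by (subst sum_pair) (use ij_n GX_isolated in \<open>auto simp: GX_entries b_def[symmetric] qcnj_mult_self power2_eq_square\<close>)
  then have "of_real (e i * (g t)\<^sup>2 + e j * (norm (b t))\<^sup>2) = (of_real (e i) :: quat)"
    using frames_column[OF G_frames[OF X_frames] ij_n(1,1), of t] by (simp add: scaleR_conv_of_real)
  then have eq: "e i * (g t)\<^sup>2 + e j * (norm (b t))\<^sup>2 = e i"
    by (simp only: of_real_eq_iff)
  have "e i * (e i * (g t)\<^sup>2 + e j * (norm (b t))\<^sup>2) = 1"
    unfolding eq by (rule signs_square[OF e])
  moreover have "e i * (e i * (g t)\<^sup>2 + e j * (norm (b t))\<^sup>2)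
      = (e i * e i) * (g t)\<^sup>2 + (e i * e j) * (norm (b t))\<^sup>2"
    by (simp only: distrib_left mult.assoc)
  ultimately show ?thesis
    by (simp add: signs_square[OF e])
qed

text \<open>The entry at \<open>(i, i)\<close> of the square of \<open>G (X t)\<close>, with the
  norm of \<open>b t\<close> eliminated by \<open>g_b\<close>.\<close>

lemma g_double: "g (2 * t) = 2 * (g t)\<^sup>2 - 1"
proof -
  note c = G_carrier[OF X_frames]
  have "G (X (2 * t)) $$ (i, i) = (G (X t) * G (X t)) $$ (i, i)"
    by (simp add: GX_add)
  also have "\<dots> = of_real ((g t)\<^sup>2) - (e i * e j) *\<^sub>R (qcnj (b t) * b t)"
    unfolding mat_mult_entry[OF c c ij_n(1,1)]
    by (subst sum_pair) (use ij_n GX_isolated in \<open>auto simp: GX_entries b_def[symmetric] power2_eq_square\<close>)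
  also have "\<dots> = of_real ((g t)\<^sup>2 - (e i * e j) * (norm (b t))\<^sup>2)"
    by (simp add: qcnj_mult_self scaleR_conv_of_real)
  finally have "g (2 * t) = (g t)\<^sup>2 - (e i * e j) * (norm (b t))\<^sup>2"
    unfolding g_def by (simp only: qre_simps)
  then show ?thesis
    using g_b[of t] by simp
qed

lemma g_zero: "g 0 = 1"
  using ij by (simp add: g_def turn_zero G_one n)

lemma tcos_tsin_continuous: "continuous_on UNIV (tcos c)" "continuous_on UNIV (tsin c)"
  by (cases "c = 1"; auto simp: tcos_def[abs_def] tsin_def[abs_def] intro!: continuous_intros)+

lemma g_cont: "continuous_on UNIV g"
proof -
  have "continuous_on UNIV (\<lambda>t. G (X t) $$ (i, i))"
  proof (rule G_cont)
    show "continuous_on UNIV (\<lambda>t. X t $$ (a, c))" if "a < m" "c < m" for a c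
    proof -
      consider "a = c" "a = i \<or> a = j" | "a = c" "a \<noteq> i" "a \<noteq> j" | "a \<noteq> c" "a = i" "c = j"
        | "a \<noteq> c" "a = j" "c = i" | "a \<noteq> c" "\<not> (a = i \<and> c = j)" "\<not> (a = j \<and> c = i)"
        by blast
      then show ?thesis
        using that ij(3)
        by cases (auto simp: turn_entry simp del: of_real_mult of_real_minus
            intro!: continuous_on_of_real continuous_on_mult_left continuous_on_minus tcos_tsin_continuous)
    qed
  qed (use X_frames ij n in auto)
  then have "continuous_on UNIV (\<lambda>t. inner (G (X t) $$ (i, i)) 1)"
    by (intro continuous_intros)
  moreover have "inner x 1 = qre x" for x :: quat
    by (simp add: inner_quat_def one_quat_def)
  ultimately show ?thesis
    by (simp add: g_def[abs_def])
qed

text \<open>Then \<open>b t = 0\<close>, so \<open>G (X t)\<close> commutes with the reflection in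
  line \<open>i\<close>. Injectivity carries this back to \<open>X t\<close>, whose off-diagonal
  entries must vanish.\<close>

lemma g_eq_1D: "g t = 1 \<Longrightarrow> tsin (\<alpha> i * \<alpha> j) t = 0"
proof -
  assume g1: "g t = 1"
  then have "(e i * e j) * (norm (b t))\<^sup>2 = 0"
    using g_b[of t] by simp
  then have b0: "b t = 0"
    using signs_mult[OF e, of i j] by auto
  have "G (X t) * unit_at n i (- 1) = unit_at n i (- 1) * G (X t)"
  proof (rule eq_matI)
    fix a c assume "a < dim_row (unit_at n i (- 1) * G (X t))" "c < dim_col (unit_at n i (- 1) * G (X t))"
    then have ac: "a < n" "c < n"
      using G_carrier[OF X_frames, of t] by auto
    have "G (X t) $$ (a, i) = 0" if "a \<noteq> i"
      using b0 that GX_isolated(2)[of a i t] ac ij_n by (cases "a = j") (auto simp: b_def)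
    moreover have "G (X t) $$ (i, c) = 0" if "c \<noteq> i"
      using b0 that GX_isolated(1)[of c i t] ac ij_n by (cases "c = j") (auto simp: GX_entries)
    ultimately show "(G (X t) * unit_at n i (- 1)) $$ (a, c) = (unit_at n i (- 1) * G (X t)) $$ (a, c)"
      using ac G_carrier[OF X_frames] by auto
  qed (use G_carrier[OF X_frames, of t] in auto)
  then have "G (X t * unit_at m i (- 1)) = G (unit_at m i (- 1) * X t)"
    using ij by (simp add: G_mult X_frames unit_at_in_frames G_unit \<sigma>_neg)
  then have "X t * unit_at m i (- 1) = unit_at m i (- 1) * X t"
    by (rule inj_onD[OF G_inj]) (simp_all add: frames_mult[OF \<alpha> \<alpha>] X_frames unit_at_in_frames)
  then have "(X t * unit_at m i (- 1)) $$ (j, i) = (unit_at m i (- 1) * X t) $$ (j, i)"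
    by simp
  then show ?thesis
    using ij by (simp add: turn_entry quat_eq_uminus_iff)
qed

text \<open>The point \<open>pi / 2\<close> suits both cases: neither \<open>sin\<close> nor
  \<open>sinh\<close> vanishes there.\<close>

lemma g_nontrivial: "g (pi / 2) \<noteq> 1"
  using g_eq_1D[of "pi / 2"] by (auto simp: tsin_def split: if_splits)

text \<open>Rotations cannot become boosts, nor boosts rotations. If the image plane is definite,
  \<open>g\<close> has a zero \<open>t\<close>, and doubling twice gives
  \<open>g (4 * t) = 1\<close>; for boosts this forces \<open>t = 0\<close>, where \<open>g\<close>
  is 1. If the image plane is indefinite and the source periodic, \<open>g (2 * pi) = 1\<close>, and
  halving twice gives \<open>g (pi / 2) = 1\<close>.\<close>

lemma signs_match_attains:
  shows signs_match: "e i * e j = \<alpha> i * \<alpha> j"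
    and g_attains: "0 \<le> tcos (e i * e j) \<theta> \<Longrightarrow> \<exists>t. g t = tcos (e i * e j) \<theta>"
proof -
  have "e i * e j = \<alpha> i * \<alpha> j \<and> (0 \<le> tcos (e i * e j) \<theta> \<longrightarrow> (\<exists>t. g t = tcos (e i * e j) \<theta>))"
  proof (cases "e i * e j = 1")
    case True
    have "(g t)\<^sup>2 \<le> 1" for t
      using g_b[of t] True by (metis le_add_same_cancel1 mult_1 zero_le_power2)
    then have "\<bar>g t\<bar> \<le> 1" for t
      by (simp add: abs_square_le_1)
    note att = double_angle_bounded[OF g_cont g_zero g_double this g_nontrivial]
    have "\<alpha> i * \<alpha> j = 1"
    proof (rule ccontr)
      assume neg: "\<alpha> i * \<alpha> j \<noteq> 1"
      obtain t where t: "g t = 0"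
        using att[of 0] by auto
      have "g (2 * (2 * t)) = 1"
        unfolding g_double t by simp
      then have "sinh (4 * t) = 0"
        using g_eq_1D[of "4 * t"] neg by (simp add: tsin_def)
      then show False
        using t g_zero by simp
    qed
    moreover have "\<exists>t. g t = tcos (e i * e j) \<theta>" if "0 \<le> tcos (e i * e j) \<theta>"
      using att that True by (simp add: tcos_def)
    ultimately show ?thesis
      using True by simp
  next
    case False
    then have neg: "e i * e j = - 1"
      using signs_mult[OF e, of i j] by simp
    have sq: "(g t)\<^sup>2 \<ge> 1" for t
      using g_b[of t] unfolding neg by (simp add: diff_eq_eq)
    \<comment> \<open>Every \<open>g t\<close> is a doubled value, which excludes
      \<open>g t \<le> - 1\<close>.\<close>
    have ge: "g t \<ge> 1" for t
      using g_double[of "t / 2"] sq[of "t / 2"] by simp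
    have "\<alpha> i * \<alpha> j = - 1"
    proof (rule ccontr)
      assume "\<alpha> i * \<alpha> j \<noteq> - 1"
      then have pos: "\<alpha> i * \<alpha> j = 1"
        using signs_mult[OF \<alpha>, of i j] by simp
      have "tcos 1 (2 * pi) = 1" "tsin 1 (2 * pi) = 0"
        by (simp_all add: tcos_def tsin_def)
      then have "X (2 * pi) = X 0"
        unfolding pos by (intro eq_matI) (simp_all add: turn_entry)
      then have "g (2 * pi) = 1"
        using g_zero unfolding g_def by simp
      then have "g pi = 1"
        using g_double[of pi] ge[of pi] by (auto simp: power2_eq_1_iff)
      then have "g (pi / 2) = 1"
        using g_double[of "pi / 2"] ge[of "pi / 2"] by (auto simp: power2_eq_1_iff)
      then show False
        using g_nontrivial by simp
    qed
    moreover have "\<exists>t. g t = tcos (e i * e j) \<theta>"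
      using double_angle_unbounded[OF g_cont g_zero g_double ge g_nontrivial, of "cosh \<theta>"] neg
      by (simp add: tcos_def cosh_real_ge_1)
    ultimately show ?thesis
      using neg by simp
  qed
  then show "e i * e j = \<alpha> i * \<alpha> j" "0 \<le> tcos (e i * e j) \<theta> \<Longrightarrow> \<exists>t. g t = tcos (e i * e j) \<theta>"
    by auto
qed

text \<open>Choose \<open>t\<close> so that \<open>g t\<close> is the wanted cosine. Then
  \<open>b t\<close> is the wanted sine \<open>s\<close> times a unit \<open>w\<close>, and
  conjugation with the unit \<open>w\<close> on line \<open>j\<close>, which lies in the image
  because \<open>\<sigma> j\<close> is onto, replaces \<open>w\<close> by 1.\<close>

lemma turn_in_image:
  assumes "0 \<le> tcos (e i * e j) \<theta>"
  shows "turn n (e i * e j) i j \<theta> \<in> G ` isom m \<alpha>"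
proof -
  let ?\<epsilon> = "e i * e j"
  have \<epsilon>: "?\<epsilon> = 1 \<or> ?\<epsilon> = - 1"
    by (rule signs_mult[OF e])
  obtain t where t: "g t = tcos ?\<epsilon> \<theta>"
    using g_attains[OF assms] by blast
  define s where "s = tsin ?\<epsilon> \<theta>"
  have "?\<epsilon> * (norm (b t))\<^sup>2 = ?\<epsilon> * s\<^sup>2"
    using g_b[of t] tcos_tsin(3)[OF \<epsilon>, of \<theta>] unfolding t s_def by linarith
  then have bs: "(norm (b t))\<^sup>2 = s\<^sup>2"
    using \<epsilon> by auto
  show ?thesis
  proof (cases "s = 0")
    \<comment> \<open>Here \<open>b t\<close> has no phase to remove, but the turn is the identity,
      as its cosine is nonnegative.\<close>
    case True
    then have "(tcos ?\<epsilon> \<theta>)\<^sup>2 = 1"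
      using tcos_tsin(3)[OF \<epsilon>, of \<theta>] by (simp add: s_def)
    then have cos1: "tcos ?\<epsilon> \<theta> = 1"
      using assms unfolding power2_eq_1_iff by linarith
    have sin0: "tsin ?\<epsilon> \<theta> = 0"
      using True by (simp add: s_def)
    have "turn n ?\<epsilon> i j \<theta> $$ (a, c) = 1\<^sub>m n $$ (a, c)" if "a < n" "c < n" for a c
      unfolding turn_entry[OF that] cos1 sin0 using that by simp
    then have "turn n ?\<epsilon> i j \<theta> = G (1\<^sub>m m)"
      unfolding G_one by (intro eq_matI) auto
    then show ?thesis
      using imageI[OF one_in_frames, of G m \<alpha>] by simp
  next
    case False
    define w where "w = b t /\<^sub>R s"
    have b: "b t = s *\<^sub>R w"
      using False by (simp add: w_def)
    have "norm (b t) = \<bar>s\<bar>"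
      using bs norm_ge_zero[of "b t"] unfolding power2_eq_iff by linarith
    then have w: "norm w = 1"
      using False by (simp add: w_def)
    \<comment> \<open>Orthogonality of the columns \<open>i\<close> and \<open>j\<close>; cancelling
      \<open>b t\<close> is possible because \<open>s\<close> is nonzero.\<close>
    have jj: "G (X t) $$ (j, j) = of_real (g t)"
    proof -
      have "(\<Sum>k<n. e k *\<^sub>R (qcnj (G (X t) $$ (k, i)) * G (X t) $$ (k, j)))
          = e i *\<^sub>R (of_real (g t) * (- (?\<epsilon> *\<^sub>R qcnj (b t)))) + e j *\<^sub>R (qcnj (b t) * G (X t) $$ (j, j))"
        by (subst sum_pair) (use ij_n GX_isolated in \<open>auto simp: GX_entries b_def[symmetric]\<close>)
      then have "e i *\<^sub>R (of_real (g t) * (- (?\<epsilon> *\<^sub>R qcnj (b t)))) + e j *\<^sub>R (qcnj (b t) * G (X t) $$ (j, j)) = 0"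
        using frames_column[OF G_frames[OF X_frames] ij_n, of t] ij by simp
      moreover have "e i *\<^sub>R (of_real (g t) * (- (?\<epsilon> *\<^sub>R qcnj (b t)))) = - (e j *\<^sub>R (qcnj (b t) * of_real (g t)))"
        using signs_square[OF e, of i] by (simp add: of_real_def mult.commute[of "g t"] flip: mult.assoc)
      ultimately have "e j *\<^sub>R (qcnj (b t) * (G (X t) $$ (j, j) - of_real (g t))) = 0"
        by (simp add: algebra_simps)
      moreover have "e j \<noteq> 0" "b t \<noteq> 0"
        using signs_square[OF e, of j] False w by (auto simp: b)
      ultimately show ?thesis
        by simp
    qed
    obtain x y where xy: "norm x = 1" "\<sigma> j x = w" "norm y = 1" "\<sigma> j y = qcnj w"
      using \<sigma>_surj[OF ij(2)] w by (metis norm_qcnj)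
    have ww: "qcnj w * w = 1"
      using w by (rule qcnj_unit)
    have "turn n ?\<epsilon> i j \<theta> = unit_at n j (qcnj w) * G (X t) * unit_at n j w"
    proof (rule eq_matI)
      fix a c assume "a < dim_row (unit_at n j (qcnj w) * G (X t) * unit_at n j w)"
        "c < dim_col (unit_at n j (qcnj w) * G (X t) * unit_at n j w)"
      then have ac: "a < n" "c < n" by auto
      consider "a \<noteq> i" "a \<noteq> j" | "c \<noteq> i" "c \<noteq> j" | "a \<in> {i, j}" "c \<in> {i, j}" by auto
      then show "turn n ?\<epsilon> i j \<theta> $$ (a, c) = (unit_at n j (qcnj w) * G (X t) * unit_at n j w) $$ (a, c)"
      proof cases
        case 1
        then show ?thesis
          using ac GX_isolated[of a] G_carrier[OF X_frames]
          by (cases "a = c") (auto simp: turn_entry mult_carrier_mat[of _ n n _ n])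
      next
        case 2
        then show ?thesis
          using ac GX_isolated[of c] G_carrier[OF X_frames]
          by (cases "a = c") (auto simp: turn_entry mult_carrier_mat[of _ n n _ n])
      next
        case 3
        have "G (X t) $$ (j, i) = s *\<^sub>R w"
          using b unfolding b_def .
        moreover have "G (X t) $$ (i, j) = - ((?\<epsilon> * s) *\<^sub>R qcnj w)"
          unfolding GX_entries b by simp
        ultimately show ?thesis
          using 3 ac ij G_carrier[OF X_frames] ww
          by (auto simp: turn_entry mult_carrier_mat[of _ n n _ n] GX_entries(1) jj t s_def[symmetric] of_real_def)
      qed
    qed auto
    also have "\<dots> = G (unit_at m j y * X t * unit_at m j x)"
      using xy ij by (simp add: G_mult X_frames unit_at_in_frames frames_mult[OF \<alpha> \<alpha>] G_unit)
    finally show ?thesis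
      using X_frames xy by (auto intro!: frames_mult[OF \<alpha> \<alpha>] unit_at_in_frames)
  qed
qed

end

lemma G_image: "G ` isom m \<alpha> = block n e {..<m}"
proof
  show "G ` isom m \<alpha> \<subseteq> block n e {..<m}"
    using G_block by blast
  show "block n e {..<m} \<subseteq> G ` isom m \<alpha>"
  proof (rule generation[OF e])
    show "G ` isom m \<alpha> \<subseteq> isom n e"
      using G_frames by blast
    show "1\<^sub>m n \<in> G ` isom m \<alpha>"
      using G_one one_in_frames by (metis imageI)
    show "A * B \<in> G ` isom m \<alpha>" if "A \<in> G ` isom m \<alpha>" "B \<in> G ` isom m \<alpha>" for A B
      using that frames_mult[OF \<alpha> \<alpha>] by (auto simp flip: G_mult)
    show "finv n e e A \<in> G ` isom m \<alpha>" if A: "A \<in> G ` isom m \<alpha>" for A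
    proof -
      obtain B where B: "B \<in> isom m \<alpha>" "A = G B"
        using A by blast
      have f: "finv m \<alpha> \<alpha> B \<in> isom m \<alpha>"
        by (rule finv_in_frames[OF \<alpha> \<alpha> B(1)])
      have "G (finv m \<alpha> \<alpha> B) = finv n e e A"
        unfolding B(2)
        by (rule finv_unique[OF e G_frames[OF B(1)] G_carrier[OF f]])
          (simp add: finv_left[OF \<alpha> B(1)] G_one flip: G_mult[OF f B(1)])
      then show ?thesis
        using f by (metis imageI)
    qed
    show "qdiag n (\<lambda>c. if c = i then x else 1) \<in> G ` isom m \<alpha>" if "i \<in> {..<m}" and x: "norm x = 1" for i x
    proof -
      obtain y where y: "norm y = 1" "\<sigma> i y = x"
        using \<sigma>_surj[of i x] \<open>i \<in> {..<m}\<close> x by auto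
      then have "G (unit_at m i y) = qdiag n (\<lambda>c. if c = i then x else 1)"
        using \<open>i \<in> {..<m}\<close> by (simp add: G_unit flip: unit_at_def)
      then show ?thesis
        using unit_at_in_frames[OF y(1)] by (metis imageI)
    qed
    show "turn n (e i * e j) i j t \<in> G ` isom m \<alpha>"
      if "i \<in> {..<m}" "j \<in> {..<m}" "i \<noteq> j" "0 \<le> tcos (e i * e j) t" for i j t
      using turn_in_image that by simp
  qed (auto simp: n)
qed

end

lemma mconj_entry_continuous:
  fixes Y :: "real \<Rightarrow> quat mat"
  assumes P: "P \<in> frames n b e" and Y: "\<And>t. Y t \<in> carrier_mat n n"
    and cont: "\<And>i j. i < n \<Longrightarrow> j < n \<Longrightarrow> continuous_on UNIV (\<lambda>t. Y t $$ (i, j))"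
    and ij: "i < n" "j < n"
  shows "continuous_on UNIV (\<lambda>t. mconj n b e P (Y t) $$ (i, j))"
proof -
  have "mconj n b e P (Y t) $$ (i, j) =
      (\<Sum>k<n. (\<Sum>l<n. finv n b e P $$ (i, l) * Y t $$ (l, k)) * P $$ (k, j))" for t
    unfolding mconj_def using ij Y frames_carrier[OF P]
    by (simp add: mat_mult_entry[of _ n] mult_carrier_mat[of _ n n _ n])
  then show ?thesis
    by (simp only:) (intro continuous_intros cont; simp)
qed

section \<open>Commuting homomorphisms\<close>

text \<open>The product in concrete form: \<open>f\<close> embeds the larger factor and
  \<open>k\<close> the unit quaternions, \<open>comm\<close> says that the factors commute, and
  \<open>triv\<close> that they meet trivially.\<close>

locale commuting_homs =
  fixes m n :: nat and \<alpha> \<beta> :: "nat \<Rightarrow> real" and f :: "quat mat \<Rightarrow> quat mat" and k :: "quat \<Rightarrow> quat mat"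
  assumes n: "n = Suc m" and \<alpha>: "signs \<alpha>" and \<beta>: "signs \<beta>"
    and f_frames: "\<And>A. A \<in> isom m \<alpha> \<Longrightarrow> f A \<in> isom n \<beta>"
    and f_mult: "\<And>A B. A \<in> isom m \<alpha> \<Longrightarrow> B \<in> isom m \<alpha> \<Longrightarrow> f (A * B) = f A * f B"
    and f_inj: "inj_on f (isom m \<alpha>)"
    and f_cont: "\<And>X i j. (\<And>t::real. X t \<in> isom m \<alpha>) \<Longrightarrow>
      (\<And>a b. a < m \<Longrightarrow> b < m \<Longrightarrow> continuous_on UNIV (\<lambda>t. X t $$ (a, b))) \<Longrightarrow> i < n \<Longrightarrow> j < n \<Longrightarrow>
      continuous_on UNIV (\<lambda>t. f (X t) $$ (i, j))"
    and k_frames: "\<And>x. norm x = 1 \<Longrightarrow> k x \<in> isom n \<beta>"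
    and k_mult: "\<And>x y. norm x = 1 \<Longrightarrow> norm y = 1 \<Longrightarrow> k (x * y) = k x * k y"
    and k_inj: "inj_on k {x. norm x = 1}"
    and k_cont: "\<And>\<gamma> i j. continuous_on UNIV (\<gamma> :: real \<Rightarrow> quat) \<Longrightarrow> (\<And>t. norm (\<gamma> t) = 1) \<Longrightarrow> i < n \<Longrightarrow> j < n \<Longrightarrow>
      continuous_on UNIV (\<lambda>t. k (\<gamma> t) $$ (i, j))"
    and comm: "\<And>A x. A \<in> isom m \<alpha> \<Longrightarrow> norm x = 1 \<Longrightarrow> f A * k x = k x * f A"
    and triv: "\<And>A x. A \<in> isom m \<alpha> \<Longrightarrow> norm x = 1 \<Longrightarrow> f A = k x \<Longrightarrow> f A = 1\<^sub>m n"
begin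

lemma f_carrier: "A \<in> isom m \<alpha> \<Longrightarrow> f A \<in> carrier_mat n n"
  by (rule frames_carrier[OF f_frames])

lemma k_carrier: "norm x = 1 \<Longrightarrow> k x \<in> carrier_mat n n"
  by (rule frames_carrier[OF k_frames])

lemma f_one: "f (1\<^sub>m m) = 1\<^sub>m n"
proof (rule frames_idempotent[OF \<beta> f_frames[OF one_in_frames]])
  show "f (1\<^sub>m m) * f (1\<^sub>m m) = f (1\<^sub>m m)"
    using f_mult[OF one_in_frames one_in_frames] by simp
qed

lemma k_one: "k 1 = 1\<^sub>m n"
  by (rule frames_idempotent[OF \<beta> k_frames]) (simp_all flip: k_mult)

lemma less_n: "m < n" "c < m \<Longrightarrow> c < n"
  by (simp_all add: n)

text \<open>The \<open>n\<close> commuting copies of Sp(1) at once: the first \<open>m\<close>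
  coordinates enter through the diagonal of \<open>f\<close>, the coordinate of index
  \<open>m\<close> through \<open>k\<close>.\<close>

definition \<Theta> :: "(nat \<Rightarrow> quat) \<Rightarrow> quat mat" where
  "\<Theta> d = f (qdiag m d) * k (d m)"

definition units :: "(nat \<Rightarrow> quat) set" where "units = {d. \<forall>c<n. norm (d c) = 1}"

lemma units_qdiag: "d \<in> units \<Longrightarrow> qdiag m d \<in> isom m \<alpha>"
  by (rule qdiag_in_frames) (simp add: units_def less_n)

lemma units_last: "d \<in> units \<Longrightarrow> norm (d m) = 1"
  by (simp add: units_def less_n)

lemma \<Theta>_frames: "d \<in> units \<Longrightarrow> \<Theta> d \<in> isom n \<beta>"
  unfolding \<Theta>_def by (intro frames_mult[OF \<beta> \<beta>] f_frames k_frames units_qdiag units_last)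

lemma \<Theta>_mult:
  assumes "d \<in> units" "d' \<in> units"
  shows "\<Theta> d * \<Theta> d' = \<Theta> (\<lambda>c. d c * d' c)"
proof -
  note c = f_carrier[OF units_qdiag[OF assms(1)]] f_carrier[OF units_qdiag[OF assms(2)]]
    k_carrier[OF units_last[OF assms(1)]] k_carrier[OF units_last[OF assms(2)]]
  have "\<Theta> d * \<Theta> d' = f (qdiag m d) * (k (d m) * f (qdiag m d')) * k (d' m)"
    unfolding \<Theta>_def using c by (simp add: assoc_mult_mat[of _ n n _ n _ n] mult_carrier_mat[of _ n n _ n])
  also have "\<dots> = f (qdiag m d) * (f (qdiag m d') * k (d m)) * k (d' m)"
    using comm[OF units_qdiag[OF assms(2)] units_last[OF assms(1)]] by simp
  also have "\<dots> = (f (qdiag m d) * f (qdiag m d')) * (k (d m) * k (d' m))"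
    using c by (simp add: assoc_mult_mat[of _ n n _ n _ n] mult_carrier_mat[of _ n n _ n])
  also have "\<dots> = \<Theta> (\<lambda>c. d c * d' c)"
    unfolding \<Theta>_def using assms by (simp add: units_qdiag units_last qdiag_mult flip: f_mult k_mult)
  finally show ?thesis .
qed

lemma \<Theta>_one: "\<Theta> (\<lambda>_. 1) = 1\<^sub>m n"
  by (simp add: \<Theta>_def qdiag_one f_one k_one)

text \<open>A trivial product puts \<open>f (qdiag m r)\<close> into both images. By
  \<open>triv\<close> it is the identity, and injectivity of \<open>f\<close> and of
  \<open>k\<close> settles the two parts separately.\<close>

lemma \<Theta>_eq_one:
  assumes r: "r \<in> units" "\<Theta> r = 1\<^sub>m n" and "c < n"
  shows "r c = 1"
proof -
  note q = units_qdiag[OF r(1)] and l = units_last[OF r(1)]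
  note fc = f_carrier[OF q] and kc = k_carrier[OF l] k_carrier[of "qcnj (r m)"]
  have "k (r m) * k (qcnj (r m)) = 1\<^sub>m n"
    using l by (simp add: qcnj_unit k_one flip: k_mult)
  then have "f (qdiag m r) = \<Theta> r * k (qcnj (r m))"
    unfolding \<Theta>_def using fc kc l by (simp add: assoc_mult_mat[of _ n n _ n _ n])
  then have fk: "f (qdiag m r) = k (qcnj (r m))"
    using r(2) kc l by simp
  then have f1: "f (qdiag m r) = 1\<^sub>m n"
    using triv[OF q, of "qcnj (r m)"] l by simp
  then have "f (qdiag m r) = f (1\<^sub>m m)"
    by (simp add: f_one)
  then have q1: "qdiag m r = 1\<^sub>m m"
    using inj_onD[OF f_inj _ q one_in_frames] by simp
  have "k (qcnj (r m)) = k 1"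
    using f1 fk by (simp add: k_one)
  then have "qcnj (r m) = qcnj 1"
    using inj_onD[OF k_inj, of "qcnj (r m)" 1] l by simp
  then have "r m = 1"
    by (simp only: qcnj_eq_iff)
  moreover have "r c = 1" if "c < m"
    using arg_cong[OF q1, of "\<lambda>M. M $$ (c, c)"] that by simp
  ultimately show ?thesis
    using \<open>c < n\<close> n by (cases "c = m") auto
qed

lemma \<Theta>_inj:
  assumes "d \<in> units" "d' \<in> units" "\<Theta> d = \<Theta> d'" and c: "c < n"
  shows "d c = d' c"
proof -
  define h where "h c = qcnj (d' c)" for c
  have h: "h \<in> units"
    using assms(2) by (simp add: units_def h_def)
  have "\<Theta> (\<lambda>c. h c * d c) = \<Theta> (\<lambda>c. h c * d' c)"
    using h assms by (simp flip: \<Theta>_mult)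
  also have "\<dots> = \<Theta> (\<lambda>_. 1)"
  proof -
    have one: "h c * d' c = 1" if "c < n" for c
      using assms(2) that by (simp add: units_def h_def qcnj_unit)
    then have "qdiag m (\<lambda>c. h c * d' c) = qdiag m (\<lambda>_. 1)"
      using n by (intro qdiag_cong) simp
    then show ?thesis
      using one[of m] n by (simp add: \<Theta>_def)
  qed
  finally have "h c * d c = 1"
    using \<Theta>_eq_one[of "\<lambda>c. h c * d c" c] h assms(1) c by (simp add: \<Theta>_one units_def norm_mult)
  moreover have "h c * d' c = 1"
    using assms(2) c by (simp add: units_def h_def qcnj_unit)
  ultimately show ?thesis
    by (metis mult_left_cancel mult_zero_left zero_neq_one)
qed

lemma standard_position:
  obtains P e where "signs e" "P \<in> frames n \<beta> e"
    "\<And>i j. i < m \<Longrightarrow> j < m \<Longrightarrow> e i * e j = \<alpha> i * \<alpha> j"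
    "mconj n \<beta> e P ` f ` isom m \<alpha> = block n e {..<m}"
    "mconj n \<beta> e P ` k ` {x. norm x = 1} = unit_at n m ` {x. norm x = 1}"
proof -
  \<comment> \<open>\<open>one_at i\<close> selects the i-th copy of Sp(1), and
    \<open>neg_at A\<close> the product of the elements -1 of the copies in \<open>A\<close>; these
    are the \<open>T\<close> and \<open>\<tau>\<close> of
    \<open>torus_diagonalization\<close>.\<close>
  define one_at :: "nat \<Rightarrow> quat \<Rightarrow> nat \<Rightarrow> quat" where "one_at i x = (\<lambda>c. if c = i then x else 1)" for i x
  define neg_at :: "nat set \<Rightarrow> nat \<Rightarrow> quat" where "neg_at A = (\<lambda>c. if c \<in> A then - 1 else 1)" for A
  have u: "one_at i x \<in> units" if "norm x = 1" for i x
    using that by (simp add: units_def one_at_def)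
  have v: "neg_at A \<in> units" for A
    by (simp add: units_def neg_at_def)
  show thesis
  proof (rule torus_diagonalization[OF \<beta>, of n "\<lambda>i x. \<Theta> (one_at i x)" "\<lambda>A. \<Theta> (neg_at A)"])
    show "\<Theta> (one_at i x) \<in> isom n \<beta>" if "norm x = 1" for i x
      by (rule \<Theta>_frames[OF u[OF that]])
    show "\<Theta> (one_at i (x * y)) = \<Theta> (one_at i x) * \<Theta> (one_at i y)" if "norm x = 1" "norm y = 1" for i x y
      using that by (simp add: \<Theta>_mult u) (simp add: one_at_def if_distrib cong: if_cong)
    show "\<Theta> (one_at i x) * \<Theta> (one_at j y) = \<Theta> (one_at j y) * \<Theta> (one_at i x)"
      if "i \<noteq> j" "norm x = 1" "norm y = 1" for i j x y
    proof -
      have "(\<lambda>c. one_at i x c * one_at j y c) = (\<lambda>c. one_at j y c * one_at i x c)"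
        using that(1) by (auto simp: one_at_def)
      then show ?thesis
        using that by (simp add: \<Theta>_mult u)
    qed
    show "\<Theta> (neg_at A) \<in> isom n \<beta>" for A
      by (rule \<Theta>_frames[OF v])
    have "(\<lambda>c. neg_at A c * neg_at A c) = (\<lambda>_. 1)" for A
      by (auto simp: neg_at_def)
    then show "\<Theta> (neg_at A) * \<Theta> (neg_at A) = 1\<^sub>m n" for A
      by (simp add: \<Theta>_mult v \<Theta>_one)
    have "(\<lambda>c. neg_at A c * neg_at B c) = (\<lambda>c. neg_at B c * neg_at A c)" for A B
      by (auto simp: neg_at_def)
    then show "\<Theta> (neg_at A) * \<Theta> (neg_at B) = \<Theta> (neg_at B) * \<Theta> (neg_at A)" for A B
      by (simp add: \<Theta>_mult v)
    show "inj_on (\<lambda>A. \<Theta> (neg_at A)) (Pow {..<n})"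
    proof (rule inj_onI)
      fix A B assume AB: "A \<in> Pow {..<n}" "B \<in> Pow {..<n}" "\<Theta> (neg_at A) = \<Theta> (neg_at B)"
      have "c \<in> A \<longleftrightarrow> c \<in> B" if "c < n" for c
        using \<Theta>_inj[OF v v AB(3) that] by (auto simp: neg_at_def split: if_splits)
      then show "A = B"
        using AB(1,2) by auto
    qed
    show "\<Theta> (neg_at {}) = 1\<^sub>m n"
      by (simp add: neg_at_def \<Theta>_one)
    show "\<Theta> (neg_at {i}) = \<Theta> (one_at i (- 1))" for i
      by (simp add: neg_at_def one_at_def)
    show "\<Theta> (one_at i x) * \<Theta> (neg_at A) = \<Theta> (neg_at A) * \<Theta> (one_at i x)" if "norm x = 1" for i x A
    proof -
      have "(\<lambda>c. one_at i x c * neg_at A c) = (\<lambda>c. neg_at A c * one_at i x c)"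
        by (auto simp: one_at_def neg_at_def)
      then show ?thesis
        using that by (simp add: \<Theta>_mult u v)
    qed

    fix P e \<sigma>
    assume e: "signs e" and P: "P \<in> frames n \<beta> e"
      and \<sigma>: "\<And>i x. i < n \<Longrightarrow> norm x = 1 \<Longrightarrow> mconj n \<beta> e P (\<Theta> (one_at i x)) = qdiag n (\<lambda>c. if c = i then \<sigma> i x else 1)"
      and \<sigma>_norm: "\<And>i x. i < n \<Longrightarrow> norm x = 1 \<Longrightarrow> norm (\<sigma> i x) = 1"
      and \<sigma>_mult: "\<And>i x y. i < n \<Longrightarrow> norm x = 1 \<Longrightarrow> norm y = 1 \<Longrightarrow> \<sigma> i (x * y) = \<sigma> i x * \<sigma> i y"
      and \<sigma>_neg: "\<And>i. i < n \<Longrightarrow> \<sigma> i (- 1) = - 1"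
    let ?C = "mconj n \<beta> e P"
    have f_unit: "\<Theta> (one_at i x) = f (unit_at m i x)" if "i < m" "norm x = 1" for i x
    proof -
      have "\<Theta> (one_at i x) = f (unit_at m i x) * k 1"
        using that by (simp add: \<Theta>_def one_at_def unit_at_def)
      then show ?thesis
        using right_mult_one_mat[OF f_carrier[OF unit_at_in_frames[OF that(2), of m i \<alpha>]]] by (simp add: k_one)
    qed
    have k_unit: "\<Theta> (one_at m x) = k x" if "norm x = 1" for x
    proof -
      have "qdiag m (one_at m x) = 1\<^sub>m m"
        unfolding qdiag_one[symmetric] by (rule qdiag_cong) (simp add: one_at_def)
      then show ?thesis
        using left_mult_one_mat[OF k_carrier[OF that]] by (simp add: \<Theta>_def f_one) (simp add: one_at_def)
    qed
    have C_k: "?C (k x) = unit_at n m (\<sigma> m x)" if "norm x = 1" for x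
      using \<sigma>[of m x] that by (simp add: less_n k_unit unit_at_def)
    have C_f: "?C (f (unit_at m i x)) = unit_at n i (\<sigma> i x)" if "i < m" "norm x = 1" for i x
      using \<sigma>[of i x] that by (simp add: less_n f_unit unit_at_def)
    have \<sigma>_cont: "continuous_on UNIV (\<lambda>t. \<sigma> i (\<gamma> t))"
      if i: "i < n" and \<gamma>: "continuous_on UNIV (\<gamma> :: real \<Rightarrow> quat)" "\<And>t. norm (\<gamma> t) = 1" for i \<gamma>
    proof (cases "i = m")
      case True
      have "continuous_on UNIV (\<lambda>t. ?C (k (\<gamma> t)) $$ (m, m))"
        by (rule mconj_entry_continuous[OF P k_carrier[OF \<gamma>(2)] k_cont[OF \<gamma>]]) (simp_all add: n)
      then show ?thesis
        using True by (simp add: C_k \<gamma> less_n)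
    next
      case False
      then have "i < m"
        using i n by simp
      have "continuous_on UNIV (\<lambda>t. f (unit_at m i (\<gamma> t)) $$ (a, c))" if "a < n" "c < n" for a c
      proof (rule f_cont[OF _ _ that])
        show "unit_at m i (\<gamma> t) \<in> isom m \<alpha>" for t
          by (rule unit_at_in_frames[OF \<gamma>(2)])
        show "continuous_on UNIV (\<lambda>t. unit_at m i (\<gamma> t) $$ (a, c))" if "a < m" "c < m" for a c
          using that \<gamma>(1) by (cases "a = c"; cases "a = i") auto
      qed
      then have "continuous_on UNIV (\<lambda>t. ?C (f (unit_at m i (\<gamma> t))) $$ (i, i))"
        using i by (intro mconj_entry_continuous[OF P f_carrier[OF unit_at_in_frames[OF \<gamma>(2)]]])
      then show ?thesis
        using \<open>i < m\<close> i by (simp add: C_f \<gamma>)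
    qed
    have onto: "\<exists>x. norm x = 1 \<and> \<sigma> i x = y" if "i < n" "norm y = 1" for i y
      by (rule continuous_unit_hom_surj[of "\<sigma> i" y])
        (use that \<sigma>_norm \<sigma>_mult \<sigma>_neg \<sigma>_cont in blast)+
    interpret normalized_hom m n \<alpha> e "\<lambda>A. ?C (f A)" \<sigma>
    proof
      show "n = Suc m" "signs \<alpha>" "signs e"
        by (fact n \<alpha> e)+
      show "?C (f A) \<in> isom n e" if "A \<in> isom m \<alpha>" for A
        by (rule mconj_frames[OF \<beta> e P f_frames[OF that]])
      show "?C (f (A * B)) = ?C (f A) * ?C (f B)" if "A \<in> isom m \<alpha>" "B \<in> isom m \<alpha>" for A B
        using that by (simp add: f_mult mconj_mult[OF \<beta> e P] f_carrier)
      show "inj_on (\<lambda>A. ?C (f A)) (isom m \<alpha>)"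
        using comp_inj_on[OF f_inj inj_on_subset[OF mconj_inj[OF \<beta> e P]]] f_carrier by (auto simp: comp_def)
      show "continuous_on UNIV (\<lambda>t. ?C (f (X t)) $$ (i, j))"
        if "\<And>t::real. X t \<in> isom m \<alpha>"
          "\<And>a b. a < m \<Longrightarrow> b < m \<Longrightarrow> continuous_on UNIV (\<lambda>t. X t $$ (a, b))" "i < n" "j < n" for X i j
        by (rule mconj_entry_continuous[OF P f_carrier[OF that(1)] f_cont[OF that(1,2)] that(3,4)])
      show "?C (f (unit_at m i x)) = unit_at n i (\<sigma> i x)" if "i < m" "norm x = 1" for i x
        by (rule C_f[OF that])
      show "\<sigma> i (- 1) = - 1" if "i < m" for i
        using \<sigma>_neg that n by simp
      show "\<exists>x. norm x = 1 \<and> \<sigma> i x = y" if "i < m" "norm y = 1" for i y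
        using onto that less_n by simp
      \<comment> \<open>Every unit of line \<open>m\<close> comes from \<open>k\<close>, because
        \<open>\<sigma> m\<close> is onto.\<close>
      show "?C (f A) * unit_at n m y = unit_at n m y * ?C (f A)" if A: "A \<in> isom m \<alpha>" and y: "norm y = 1" for A y
      proof -
        obtain x where x: "norm x = 1" "\<sigma> m x = y"
          using onto[of m y] y less_n by auto
        have "?C (f A * k x) = ?C (k x * f A)"
          by (simp add: comm A x)
        then show ?thesis
          using x by (simp add: mconj_mult[OF \<beta> e P] f_carrier A k_carrier C_k)
      qed
    qed
    show thesis
    proof (rule that[OF e P])
      show "e i * e j = \<alpha> i * \<alpha> j" if "i < m" "j < m" for i j
        using signs_match[OF that] by (cases "i = j") (simp_all add: signs_square e \<alpha>)
      show "?C ` f ` isom m \<alpha> = block n e {..<m}"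
        using G_image by (simp add: image_image)
      show "?C ` k ` {x. norm x = 1} = unit_at n m ` {x. norm x = 1}"
      proof -
        have "?C ` k ` {x. norm x = 1} = unit_at n m ` \<sigma> m ` {x. norm x = 1}"
          unfolding image_image by (rule image_cong) (simp_all add: C_k)
        moreover have "\<sigma> m ` {x. norm x = 1} = {x. norm x = 1}"
          using onto[OF less_n(1)] \<sigma>_norm[OF less_n(1)] by (auto simp: image_iff)
        ultimately show ?thesis by simp
      qed
    qed
  qed
qed

end

section \<open>The groups Sp(p,q) as isometry groups\<close>

definition sig :: "nat \<Rightarrow> nat \<Rightarrow> real" where "sig p i = (if i < p then 1 else - 1)"

lemma signs_sig: "signs (sig p)"
  by (simp add: signs_def sig_def)

lemma diag_block_mat_two:
  assumes "A \<in> carrier_mat a a" "B \<in> carrier_mat b b"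
  shows "diag_block_mat [A, B] \<in> carrier_mat (a + b) (a + b)"
    and "i < a + b \<Longrightarrow> j < a + b \<Longrightarrow> diag_block_mat [A, B] $$ (i, j) =
      (if i < a then if j < a then A $$ (i, j) else 0 else if j < a then 0 else B $$ (i - a, j - a))"
  using assms by (auto simp: Let_def)

lemma I_sig_eq_qdiag: "I_sig p q = qdiag (p + q) (\<lambda>i. of_real (sig p i))"
proof -
  have c: "1\<^sub>m p \<in> carrier_mat p p" "- 1\<^sub>m q \<in> carrier_mat q q"
    by auto
  show ?thesis
    unfolding I_sig_def
  proof (rule eq_matI)
    fix i j
    assume "i < dim_row (qdiag (p + q) (\<lambda>i. of_real (sig p i)))" "j < dim_col (qdiag (p + q) (\<lambda>i. of_real (sig p i)))"
    then have "i < p + q" "j < p + q" by auto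
    then show "diag_block_mat [1\<^sub>m p, - 1\<^sub>m q] $$ (i, j) = qdiag (p + q) (\<lambda>i. of_real (sig p i)) $$ (i, j)"
      unfolding diag_block_mat_two(2)[OF c \<open>i < p + q\<close> \<open>j < p + q\<close>] by (auto simp: sig_def)
  qed (use diag_block_mat_two(1)[OF c] in auto)
qed

lemma carrier_Sp: "carrier (Sp p q) = isom (p + q) (sig p)"
proof -
  let ?n = "p + q"
  have "qadjoint A * I_sig p q * A = I_sig p q \<longleftrightarrow> A \<in> isom ?n (sig p)"
    if A: "A \<in> carrier_mat ?n ?n" for A
  proof -
    have q: "qadjoint A \<in> carrier_mat ?n ?n"
      using A by (simp add: qadjoint_def)
    have "(qadjoint A * I_sig p q * A) $$ (i, j) = (\<Sum>k<?n. sig p k *\<^sub>R (qcnj (A $$ (k, i)) * A $$ (k, j)))"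
      if "i < ?n" "j < ?n" for i j
      using that A q unfolding I_sig_eq_qdiag
        mat_mult_entry[OF mult_carrier_mat[OF q qdiag_carrier(1)] A that]
      by (simp add: qadjoint_def of_real_def)
    then show ?thesis
      using A q unfolding frames_def I_sig_eq_qdiag by (auto simp: mat_eq_iff)
  qed
  then show ?thesis
    using frames_carrier by (auto simp: Sp_def)
qed

lemma Sp_simps: "A \<otimes>\<^bsub>Sp p q\<^esub> B = A * B" "\<one>\<^bsub>Sp p q\<^esub> = 1\<^sub>m (p + q)"
  by (simp_all add: Sp_def)

lemma carrier_Sp_1: "carrier (Sp 1 0) = unit_at 1 0 ` {x. norm x = 1}"
proof -
  have "A \<in> unit_at 1 0 ` {x. norm x = 1}" if A: "A \<in> isom 1 (sig 1)" for A
  proof -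
    have eq: "A = qdiag 1 (\<lambda>_. A $$ (0, 0))"
      using frames_carrier[OF A] by (intro eq_matI) auto
    then have "norm (A $$ (0, 0)) = 1"
      using qdiag_in_framesD[OF signs_sig, of 1 "\<lambda>_. A $$ (0, 0)" 1 0] A by simp
    moreover have "qdiag 1 (\<lambda>_. A $$ (0, 0)) = unit_at 1 0 (A $$ (0, 0))"
      unfolding unit_at_def by (rule qdiag_cong) simp
    ultimately show ?thesis
      using eq by auto
  qed
  then show ?thesis
    unfolding carrier_Sp by (auto intro: unit_at_in_frames)
qed

text \<open>A form and its negative have the same isometries, so signs matter only up to a common
  factor.\<close>

lemma frames_scale:
  assumes "\<delta> = 1 \<or> \<delta> = (- 1 :: real)" "\<And>i. i < n \<Longrightarrow> e i = \<delta> * b i"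
  shows "isom n e = isom n b"
proof -
  have "(\<Sum>k<n. e k *\<^sub>R h k) = \<delta> *\<^sub>R (\<Sum>k<n. b k *\<^sub>R h k)" for h :: "nat \<Rightarrow> quat"
    by (simp add: assms(2) scaleR_sum_right)
  moreover have "(\<delta> *\<^sub>R x = (if i = j then of_real (e i) else 0)) \<longleftrightarrow> x = (if i = j then of_real (b i) else 0)"
    if "i < n" for x :: quat and i j
    using assms(1) assms(2)[OF that] by auto
  ultimately show ?thesis
    unfolding frames_def by auto
qed

section \<open>Smooth maps\<close>

lemma mat_topology_topspace: "topspace (mat_topology n) = carrier_mat n n"
  by (auto simp: mat_topology_def topspace_pullback_topology)

lemma mat_entry_continuous_map:
  assumes "i < n" "j < n"
  shows "continuous_map (mat_topology n) euclidean (\<lambda>A. A $$ (i, j))"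
proof -
  have "continuous_map (mat_topology n) euclidean
      ((\<lambda>h. h (i, j)) \<circ> (\<lambda>A :: quat mat. restrict (($$) A) ({..<n} \<times> {..<n})))"
    unfolding mat_topology_def
    by (rule continuous_map_pullback, rule continuous_map_product_projection) (use assms in auto)
  then show ?thesis
    using assms by (simp add: comp_def)
qed

lemma continuous_map_into_mat_topology:
  assumes "\<And>t. t \<in> topspace T \<Longrightarrow> X t \<in> carrier_mat n n"
    and "\<And>i j. i < n \<Longrightarrow> j < n \<Longrightarrow> continuous_map T euclidean (\<lambda>t. X t $$ (i, j))"
  shows "continuous_map T (mat_topology n) X"
  unfolding mat_topology_def
proof (rule continuous_map_pullback')
  show "continuous_map T (product_topology (\<lambda>_. euclidean) ({..<n} \<times> {..<n}))
      ((\<lambda>A :: quat mat. restrict (($$) A) ({..<n} \<times> {..<n})) \<circ> X)"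
    unfolding continuous_map_componentwise using assms(2) by (auto simp: comp_def)
qed (use assms(1) in auto)

text \<open>Smoothness provides local extensions \<open>F\<close> only. Order 0 of \<open>Ck\<close>
  makes them continuous on \<open>U\<close>, and the path is in \<open>U\<close> on the open set
  \<open>V\<close> of times, which contains \<open>t0\<close>.\<close>

lemma smooth_path_continuous:
  fixes X :: "real \<Rightarrow> quat mat"
  assumes sm: "smooth_on_mat m n S f" and S: "S \<subseteq> carrier_mat m m" and X: "\<And>t. X t \<in> S"
    and cont: "\<And>a b. a < m \<Longrightarrow> b < m \<Longrightarrow> continuous_on UNIV (\<lambda>t. X t $$ (a, b))"
    and ij: "i < n" "j < n"
  shows "continuous_on UNIV (\<lambda>t. f (X t) $$ (i, j))"
proof (rule continuous_at_imp_continuous_on, rule ballI)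
  fix t0
  have cX: "continuous_map euclidean (mat_topology m) X"
    using X S cont by (intro continuous_map_into_mat_topology) auto
  obtain U F where U: "openin (mat_topology m) U" "X t0 \<in> U"
    and F: "\<forall>i<n. \<forall>j<n. \<forall>k. Ck m k U (\<lambda>B. F B $$ (i, j))" "\<forall>B\<in>S \<inter> U. F B = f B"
    using bspec[OF sm[unfolded smooth_on_mat_def] X[of t0]] by (elim conjE exE) (rule that; assumption)
  have cF: "continuous_map (subtopology (mat_topology m) U) euclidean (\<lambda>B. F B $$ (i, j))"
    using F(1)[rule_format, OF ij, of 0] by simp
  define V where "V = {t. X t \<in> U}"
  have "open V"
    using openin_continuous_map_preimage[OF cX U(1)] by (simp add: V_def)
  have "continuous_map (top_of_set V) (subtopology (mat_topology m) U) X"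
    unfolding continuous_map_in_subtopology
    using continuous_map_from_subtopology[OF cX] by (auto simp: V_def)
  then have "continuous_map (top_of_set V) euclidean ((\<lambda>B. F B $$ (i, j)) \<circ> X)"
    by (rule continuous_map_compose[OF _ cF])
  then have "continuous_on V (\<lambda>t. F (X t) $$ (i, j))"
    by (simp add: comp_def)
  moreover have "F (X t) $$ (i, j) = f (X t) $$ (i, j)" if "t \<in> V" for t
    using F(2) X that by (simp add: V_def)
  ultimately have "continuous_on V (\<lambda>t. f (X t) $$ (i, j))"
    by (metis (no_types, lifting) continuous_on_cong)
  then show "isCont (\<lambda>t. f (X t) $$ (i, j)) t0"
    using \<open>open V\<close> U(2) by (simp add: V_def continuous_on_eq_continuous_at)
qed

section \<open>Smoothness of conjugations\<close>

lemma Ck_const: "Ck n k U (\<lambda>_. c)"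
proof (induction k arbitrary: c)
  case (Suc k)
  then show ?case
    by (auto intro!: exI[of _ "\<lambda>_. 0"])
qed simp

text \<open>The derivative of a linear map in direction \<open>V\<close> is the constant
  \<open>h V\<close>, so \<open>Ck_const\<close> covers all derivatives from the first on.\<close>

lemma Ck_linear:
  fixes n :: nat and l r :: "nat \<Rightarrow> quat"
  defines "h \<equiv> \<lambda>A :: quat mat. \<Sum>b<n. (\<Sum>a<n. l a * A $$ (a, b)) * r b"
  shows "Ck n k (carrier_mat n n) h"
proof (cases k)
  case 0
  have lr: "continuous_map T euclidean (\<lambda>x. u * g x * v)" if "continuous_map T euclidean g"
    for u v :: quat and T and g :: "quat mat \<Rightarrow> quat"
  proof -
    have "continuous_map euclidean euclidean (\<lambda>y :: quat. u * y * v)"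
      by (simp, intro continuous_intros)
    from continuous_map_compose[OF that this] show ?thesis
      by (simp add: comp_def)
  qed
  have "h = (\<lambda>A. \<Sum>b<n. \<Sum>a<n. l a * A $$ (a, b) * r b)"
    by (simp add: h_def sum_distrib_right)
  moreover have "continuous_map (mat_topology n) euclidean (\<lambda>A. \<Sum>b<n. \<Sum>a<n. l a * A $$ (a, b) * r b)"
    by (intro continuous_map_sum lr mat_entry_continuous_map) auto
  ultimately show ?thesis
    using 0 by (simp add: continuous_map_from_subtopology)
next
  case (Suc k')
  have "((\<lambda>t. h (A + of_real t \<cdot>\<^sub>m V)) has_vector_derivative h V) (at 0)"
    if "A \<in> carrier_mat n n" "V \<in> carrier_mat n n" for A V
  proof -
    have "h (A + of_real t \<cdot>\<^sub>m V) = h A + t *\<^sub>R h V" for t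
      using that unfolding h_def
      by (simp add: of_real_def distrib_left distrib_right sum.distrib flip: scaleR_sum_right)
    then show ?thesis
      by (auto intro!: derivative_eq_intros)
  qed
  then show ?thesis
    unfolding Suc by (auto intro!: exI Ck_const)
qed

lemma mconj_smooth:
  assumes "P \<in> carrier_mat n n" "S \<subseteq> carrier_mat n n" and f: "\<And>A. A \<in> S \<Longrightarrow> f A = mconj n b e P A"
  shows "smooth_on_mat n n S f"
  unfolding smooth_on_mat_def
proof (intro ballI conjI)
  fix A assume A: "A \<in> S"
  then show "f A \<in> carrier_mat n n"
    using assms by (auto simp: mconj_def)
  define F where "F B = mat n n (\<lambda>(i, j). \<Sum>b'<n. (\<Sum>a<n. finv n b e P $$ (i, a) * B $$ (a, b')) * P $$ (b', j))" for B
  show "\<exists>U F. openin (mat_topology n) U \<and> A \<in> U \<and>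
      (\<forall>i<n. \<forall>j<n. \<forall>k. Ck n k U (\<lambda>B. F B $$ (i, j))) \<and> (\<forall>B\<in>S \<inter> U. F B = f B)"
  proof (intro exI conjI)
    show "openin (mat_topology n) (carrier_mat n n)"
      using openin_topspace[of "mat_topology n"] by (simp add: mat_topology_topspace)
    show "A \<in> carrier_mat n n"
      using A assms(2) by auto
    show "\<forall>i<n. \<forall>j<n. \<forall>k. Ck n k (carrier_mat n n) (\<lambda>B. F B $$ (i, j))"
    proof (intro allI impI)
      fix i j k assume "i < n" "j < n"
      then show "Ck n k (carrier_mat n n) (\<lambda>B. F B $$ (i, j))"
        using Ck_linear[of n k "\<lambda>a. finv n b e P $$ (i, a)" "\<lambda>b'. P $$ (b', j)"]
        by (simp add: F_def del: finv_entry)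
    qed
    show "\<forall>B\<in>S \<inter> carrier_mat n n. F B = f B"
    proof
      fix B assume B: "B \<in> S \<inter> carrier_mat n n"
      show "F B = f B"
        unfolding f[OF IntD1[OF B]]
        by (rule eq_matI) (use B assms(1) in \<open>auto simp: F_def mconj_def mat_mult_entry[of _ n] mult_carrier_mat[of _ n n _ n]\<close>)
    qed
  qed
qed

text \<open>For \<open>\<delta> = - 1\<close> the frame reverses the form, which by inertia happens
  only if \<open>p = q\<close>; conjugation preserves the group all the same by
  \<open>frames_scale\<close>. The inverse is conjugation with \<open>finv\<close>, again
  linear.\<close>

lemma mconj_Lie_automorphism:
  assumes P: "P \<in> frames (p + q) (sig p) e" and e: "signs e"
    and \<delta>: "\<delta> = 1 \<or> \<delta> = (- 1 :: real)" "\<And>i. i < p + q \<Longrightarrow> e i = \<delta> * sig p i"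
  shows "Lie_automorphism_Sp p q (mconj (p + q) (sig p) e P)"
proof -
  let ?n = "p + q"
  let ?\<phi> = "mconj ?n (sig p) e P" and ?\<psi> = "mconj ?n e (sig p) (finv ?n (sig p) e P)"
  note b = signs_sig[of p]
  have S: "carrier (Sp p q) = isom ?n (sig p)" "carrier (Sp p q) = isom ?n e"
    using carrier_Sp frames_scale[OF \<delta>] by auto
  have car: "carrier (Sp p q) \<subseteq> carrier_mat ?n ?n"
    unfolding S(1) using frames_carrier by blast
  note Pinv = finv_in_frames[OF b e P]
  have \<phi>: "?\<phi> A \<in> carrier (Sp p q)" if "A \<in> carrier (Sp p q)" for A
    using mconj_frames[OF b e P, of A] that S by simp
  have \<psi>: "?\<psi> A \<in> carrier (Sp p q)" if "A \<in> carrier (Sp p q)" for A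
    using mconj_frames[OF e b Pinv, of A] that S by simp
  have \<psi>\<phi>: "?\<psi> (?\<phi> A) = A" if "A \<in> carrier (Sp p q)" for A
    using mconj_inverse[OF b e P, of A] that car by auto
  have \<phi>\<psi>: "?\<phi> (?\<psi> A) = A" if "A \<in> carrier (Sp p q)" for A
    using mconj_inverse[OF e b Pinv, of A] that car finv_finv[OF b e frames_carrier[OF P]] by auto
  have bij: "bij_betw ?\<phi> (carrier (Sp p q)) (carrier (Sp p q))"
    by (rule bij_betw_byWitness[of _ ?\<psi>]) (use \<phi> \<psi> \<psi>\<phi> \<phi>\<psi> in auto)
  moreover have "?\<phi> \<in> hom (Sp p q) (Sp p q)"
    using \<phi> mconj_mult[OF b e P] car by (intro homI) (auto simp: Sp_simps)
  moreover have "smooth_on_mat ?n ?n (carrier (Sp p q)) ?\<phi>"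
    by (rule mconj_smooth[OF frames_carrier[OF P] car]) simp
  moreover have "smooth_on_mat ?n ?n (carrier (Sp p q)) (inv_into (carrier (Sp p q)) ?\<phi>)"
  proof (rule mconj_smooth[OF frames_carrier[OF Pinv] car])
    fix A assume A: "A \<in> carrier (Sp p q)"
    show "inv_into (carrier (Sp p q)) ?\<phi> A = ?\<psi> A"
      using inv_into_f_f[of ?\<phi> "carrier (Sp p q)" "?\<psi> A"] bij \<psi>[OF A] \<phi>\<psi>[OF A] by (simp add: bij_betw_def)
  qed
  ultimately show ?thesis
    unfolding Lie_automorphism_Sp_def iso_def by blast
qed

section \<open>Reordering the lines\<close>

lemma colour_preserving_bij:
  fixes u v :: "'a \<Rightarrow> real"
  assumes "finite A" "finite B" and uv: "\<And>a. u a = 1 \<or> u a = - 1" "\<And>b. v b = 1 \<or> v b = - 1"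
    and card: "card {a \<in> A. u a = 1} = card {b \<in> B. v b = 1}" "card {a \<in> A. u a = - 1} = card {b \<in> B. v b = - 1}"
  obtains \<pi> where "bij_betw \<pi> A B" "\<And>a. a \<in> A \<Longrightarrow> v (\<pi> a) = u a"
proof -
  obtain h1 where h1: "bij_betw h1 {a \<in> A. u a = 1} {b \<in> B. v b = 1}"
    using finite_same_card_bij[OF _ _ card(1)] assms(1,2) by auto
  obtain h2 where h2: "bij_betw h2 {a \<in> A. u a = - 1} {b \<in> B. v b = - 1}"
    using finite_same_card_bij[OF _ _ card(2)] assms(1,2) by auto
  define \<pi> where "\<pi> a = (if u a = 1 then h1 a else h2 a)" for a
  have 1: "bij_betw \<pi> {a \<in> A. u a = 1} {b \<in> B. v b = 1}"
    using h1 by (rule bij_betw_cong[THEN iffD1, rotated]) (simp add: \<pi>_def)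
  have 2: "bij_betw \<pi> {a \<in> A. u a = - 1} {b \<in> B. v b = - 1}"
    using h2 by (rule bij_betw_cong[THEN iffD1, rotated]) (simp add: \<pi>_def)
  have "bij_betw \<pi> ({a \<in> A. u a = 1} \<union> {a \<in> A. u a = - 1}) ({b \<in> B. v b = 1} \<union> {b \<in> B. v b = - 1})"
    by (rule bij_betw_combine[OF 1 2]) auto
  moreover have "{a \<in> A. u a = 1} \<union> {a \<in> A. u a = - 1} = A" "{b \<in> B. v b = 1} \<union> {b \<in> B. v b = - 1} = B"
    using uv by auto
  moreover have "v (\<pi> a) = u a" if "a \<in> A" for a
    using bij_betwE[OF 1] bij_betwE[OF 2] that uv(1)[of a] by auto
  ultimately show thesis
    using that by auto
qed

text \<open>The products fix the first \<open>r + s\<close> signs up to a common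
  \<open>\<tau>\<close>, and inertia ties them to the last one. As \<open>\<kappa>\<close> is the
  sign of the target line of the Sp(1) factor, \<open>\<delta>\<close> must be the last sign times
  \<open>\<kappa>\<close>. If \<open>\<tau>\<close> differs from it, inertia leaves only
  \<open>r = s\<close>, and the two counts are right anyway.\<close>

lemma sign_pattern:
  assumes e: "signs e" and P: "P \<in> frames (p + q) (sig p) e" and n: "p + q = Suc (r + s)" and "0 < r + s"
    and pat: "\<And>i j. i < r + s \<Longrightarrow> j < r + s \<Longrightarrow> e i * e j = sig r i * sig r j"
    and \<kappa>: "(\<kappa> = 1 \<and> p = Suc r) \<or> (\<kappa> = (- 1 :: real) \<and> p = r)"
  obtains \<delta> where "\<delta> = 1 \<or> \<delta> = - 1" "e (r + s) = \<delta> * \<kappa>" "card {i \<in> {..<r + s}. e i = \<delta>} = r"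
    "card {i \<in> {..<r + s}. e i = - \<delta>} = s"
proof -
  define m where "m = r + s"
  define \<tau> where "\<tau> = e 0 * sig r 0"
  have \<tau>: "\<tau> = 1 \<or> \<tau> = - 1"
    unfolding \<tau>_def using e by (auto simp: signs_def sig_def)
  have e\<tau>: "e i = \<tau> * sig r i" if "i < m" for i
  proof -
    have "e i = e i * (e 0 * e 0)"
      by (simp add: signs_square[OF e])
    also have "\<dots> = (e 0 * e i) * e 0"
      by (simp only: ac_simps)
    also have "\<dots> = \<tau> * sig r i"
      using pat[of 0 i] that \<open>0 < r + s\<close> unfolding \<tau>_def m_def by simp
    finally show ?thesis .
  qed
  have r: "card {i \<in> {..<m}. e i = \<tau>} = r"
  proof -
    have "{i \<in> {..<m}. e i = \<tau>} = {..<r}"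
      using e\<tau> \<tau> by (auto simp: sig_def m_def split: if_splits)
    then show ?thesis by simp
  qed
  have s: "card {i \<in> {..<m}. e i = - \<tau>} = s"
  proof -
    have "{i \<in> {..<m}. e i = - \<tau>} = {r..<r + s}"
      using e\<tau> \<tau> by (auto simp: sig_def m_def split: if_splits)
    then show ?thesis by simp
  qed
  have "card {i. i < p + q \<and> e i = 1} = card {i. i < p + q \<and> sig p i = 1}"
    by (rule frames_inertia[OF signs_sig e P])
  also have "{i. i < p + q \<and> sig p i = 1} = {..<p}"
    by (auto simp: sig_def)
  also have "{i. i < p + q \<and> e i = 1} = {i \<in> {..<m}. e i = 1} \<union> (if e m = 1 then {m} else {})"
    by (auto simp: n m_def less_Suc_eq)
  also have "card \<dots> = card {i \<in> {..<m}. e i = 1} + (if e m = 1 then 1 else 0)"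
    by (subst card_Un_disjoint) auto
  finally have p: "card {i \<in> {..<m}. e i = 1} + (if e m = 1 then 1 else 0) = p"
    by simp
  have em: "e m = 1 \<or> e m = - 1"
    using e by (auto simp: signs_def)
  show thesis
  proof (rule that[of "e m * \<kappa>"])
    show "e m * \<kappa> = 1 \<or> e m * \<kappa> = - 1" "e (r + s) = e m * \<kappa> * \<kappa>"
      using em \<kappa> by (auto simp: m_def)
    show "card {i \<in> {..<r + s}. e i = e m * \<kappa>} = r" "card {i \<in> {..<r + s}. e i = - (e m * \<kappa>)} = s"
      using em \<kappa> \<tau> p r s unfolding m_def[symmetric] by (elim disjE conjE; simp)+
  qed
qed

definition mat_permute :: "nat \<Rightarrow> (nat \<Rightarrow> nat) \<Rightarrow> quat mat \<Rightarrow> quat mat" where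
  "mat_permute n \<pi> A = mat n n (\<lambda>(a, b). A $$ (\<pi> a, \<pi> b))"

lemma mat_permute_block:
  assumes \<pi>: "bij_betw \<pi> {..<n} {..<n}" and A: "A \<in> block n e J"
  shows "mat_permute n \<pi> A \<in> block n (e \<circ> \<pi>) {a. a < n \<and> \<pi> a \<in> J}"
proof -
  have lt: "\<pi> a < n" if "a < n" for a
    using bij_betwE[OF \<pi>] that by auto
  have inj: "\<pi> a = \<pi> c \<longleftrightarrow> a = c" if "a < n" "c < n" for a c
    using \<pi> that by (auto simp: bij_betw_def inj_on_def)
  have F: "A \<in> isom n e"
    using A by (simp add: block_def)
  have "(\<Sum>k<n. e (\<pi> k) *\<^sub>R (qcnj (A $$ (\<pi> k, \<pi> i)) * A $$ (\<pi> k, \<pi> j))) =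
      (if i = j then of_real (e (\<pi> i)) else 0)" if "i < n" "j < n" for i j
    using sum.reindex_bij_betw[OF \<pi>, of "\<lambda>k. e k *\<^sub>R (qcnj (A $$ (k, \<pi> i)) * A $$ (k, \<pi> j))"]
      frames_column[OF F lt[OF that(1)] lt[OF that(2)]] inj[OF that] by simp
  then show ?thesis
    using A lt inj by (auto simp: block_def frames_def mat_permute_def)
qed

lemma mat_permute_block_image:
  assumes \<pi>: "bij_betw \<pi> {..<n} {..<n}"
  shows "mat_permute n \<pi> ` block n e J = block n (e \<circ> \<pi>) {a. a < n \<and> \<pi> a \<in> J}"
proof
  show "mat_permute n \<pi> ` block n e J \<subseteq> block n (e \<circ> \<pi>) {a. a < n \<and> \<pi> a \<in> J}"
    using mat_permute_block[OF \<pi>] by blast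
  define \<rho> where "\<rho> = inv_into {..<n} \<pi>"
  have \<rho>: "bij_betw \<rho> {..<n} {..<n}"
    unfolding \<rho>_def by (rule bij_betw_inv_into[OF \<pi>])
  have \<pi>\<rho>: "\<pi> (\<rho> a) = a" "\<rho> a < n" if "a < n" for a
    using bij_betw_inv_into_right[OF \<pi>, of a] bij_betwE[OF \<rho>] that by (auto simp: \<rho>_def)
  have \<rho>\<pi>: "\<rho> (\<pi> a) = a" "\<pi> a < n" if "a < n" for a
    using bij_betw_inv_into_left[OF \<pi>, of a] bij_betwE[OF \<pi>] that by (auto simp: \<rho>_def)
  show "block n (e \<circ> \<pi>) {a. a < n \<and> \<pi> a \<in> J} \<subseteq> mat_permute n \<pi> ` block n e J"
  proof
    fix B assume B: "B \<in> block n (e \<circ> \<pi>) {a. a < n \<and> \<pi> a \<in> J}"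
    have "isom n (e \<circ> \<pi> \<circ> \<rho>) = isom n e"
      by (rule frames_scale[of 1]) (simp_all add: \<pi>\<rho>)
    then have "mat_permute n \<rho> B \<in> block n e J"
      using mat_permute_block[OF \<rho> B] by (auto simp: block_def \<pi>\<rho>)
    moreover have "mat_permute n \<pi> (mat_permute n \<rho> B) = B"
      using B frames_carrier[of B n "e \<circ> \<pi>" "e \<circ> \<pi>"]
      by (intro eq_matI) (auto simp: mat_permute_def \<rho>\<pi> block_def)
    ultimately show "B \<in> mat_permute n \<pi> ` block n e J"
      by (metis imageI)
  qed
qed

lemma block_scale:
  assumes "\<delta> = 1 \<or> \<delta> = (- 1 :: real)" "\<And>i. i < n \<Longrightarrow> e i = \<delta> * b i"
  shows "block n e J = block n b J"
  using frames_scale[OF assms] by (simp add: block_def)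

lemma Sp_standard_position:
  assumes idp: "internal_direct_product (Sp p q) G K" and G: "Lie_subgroup_Sp_iso p q G r s"
    and K: "Lie_subgroup_Sp_iso p q K 1 0" and n: "p + q = Suc (r + s)"
  obtains P e where "signs e" "P \<in> frames (p + q) (sig p) e"
    "\<And>i j. i < r + s \<Longrightarrow> j < r + s \<Longrightarrow> e i * e j = sig r i * sig r j"
    "mconj (p + q) (sig p) e P ` G = block (p + q) e {..<r + s}"
    "mconj (p + q) (sig p) e P ` K = unit_at (p + q) (r + s) ` {x. norm x = 1}"
proof -
  obtain f where f: "f \<in> hom (Sp r s) (Sp p q)" "smooth_on_mat (r + s) (p + q) (carrier (Sp r s)) f"
    "inj_on f (carrier (Sp r s))" "f ` carrier (Sp r s) = G"
    using G unfolding Lie_subgroup_Sp_iso_def by blast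
  obtain k where k: "k \<in> hom (Sp 1 0) (Sp p q)" "smooth_on_mat (1 + 0) (p + q) (carrier (Sp 1 0)) k"
    "inj_on k (carrier (Sp 1 0))" "k ` carrier (Sp 1 0) = K"
    using K unfolding Lie_subgroup_Sp_iso_def by blast
  have Sp1: "unit_at 1 0 x \<in> carrier (Sp 1 0)" if "norm x = 1" for x
    using that unfolding carrier_Sp_1 by simp
  have unit_mult: "unit_at 1 0 (x * y) = unit_at 1 0 x * unit_at 1 0 y" for x y
    by (simp add: unit_at_def qdiag_mult if_distrib cong: if_cong)
  note cG = carrier_Sp[of r s] and cP = carrier_Sp[of p q]
  interpret commuting_homs "r + s" "p + q" "sig r" "sig p" f "\<lambda>x. k (unit_at 1 0 x)"
  proof
    show "p + q = Suc (r + s)" "signs (sig r)" "signs (sig p)"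
      by (fact n signs_sig)+
    show "f A \<in> isom (p + q) (sig p)" if "A \<in> isom (r + s) (sig r)" for A
      using hom_in_carrier[OF f(1), of A] that by (simp add: cG cP)
    show "f (A * B) = f A * f B"
      if "A \<in> isom (r + s) (sig r)" "B \<in> isom (r + s) (sig r)" for A B
      using hom_mult[OF f(1), of A B] that by (simp add: cG Sp_simps)
    show "inj_on f (isom (r + s) (sig r))"
      using f(3) by (simp add: cG)
    show "continuous_on UNIV (\<lambda>t. f (X t) $$ (i, j))"
      if "\<And>t::real. X t \<in> isom (r + s) (sig r)"
        "\<And>a b. a < r + s \<Longrightarrow> b < r + s \<Longrightarrow> continuous_on UNIV (\<lambda>t. X t $$ (a, b))" "i < p + q" "j < p + q"
      for X i j
      by (rule smooth_path_continuous[OF f(2)]) (use that cG frames_carrier in auto)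
    show "k (unit_at 1 0 x) \<in> isom (p + q) (sig p)" if "norm x = 1" for x
      using hom_in_carrier[OF k(1) Sp1[OF that]] by (simp add: cP)
    show "k (unit_at 1 0 (x * y)) = k (unit_at 1 0 x) * k (unit_at 1 0 y)" if "norm x = 1" "norm y = 1" for x y
      using hom_mult[OF k(1) Sp1[OF that(1)] Sp1[OF that(2)]] unfolding Sp_simps unit_mult .
    show "inj_on (\<lambda>x. k (unit_at 1 0 x)) {x. norm x = 1}"
    proof (rule inj_onI)
      fix x y :: quat
      assume xy: "x \<in> {x. norm x = 1}" "y \<in> {x. norm x = 1}" "k (unit_at 1 0 x) = k (unit_at 1 0 y)"
      have "unit_at 1 0 x = unit_at 1 0 y"
        by (rule inj_onD[OF k(3) xy(3)]) (use xy Sp1 in auto)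
      from arg_cong[OF this, of "\<lambda>M. M $$ (0, 0)"] show "x = y"
        by simp
    qed
    show "continuous_on UNIV (\<lambda>t. k (unit_at 1 0 (\<gamma> t)) $$ (i, j))"
      if \<gamma>: "continuous_on UNIV (\<gamma> :: real \<Rightarrow> quat)" "\<And>t. norm (\<gamma> t) = 1" and ij: "i < p + q" "j < p + q" for \<gamma> i j
    proof (rule smooth_path_continuous[OF k(2) _ Sp1[OF \<gamma>(2)] _ ij])
      show "carrier (Sp 1 0) \<subseteq> carrier_mat (1 + 0) (1 + 0)"
        unfolding carrier_Sp_1 by auto
      show "continuous_on UNIV (\<lambda>t. unit_at 1 0 (\<gamma> t) $$ (a, b))" if "a < 1 + 0" "b < 1 + 0" for a b
        using \<gamma>(1) that by simp
    qed
    show "f A * k (unit_at 1 0 x) = k (unit_at 1 0 x) * f A"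
      if "A \<in> isom (r + s) (sig r)" "norm x = 1" for A x
      using idp that Sp1 f(4) k(4) unfolding internal_direct_product_def cG Sp_simps by blast
    show "f A = 1\<^sub>m (p + q)"
      if "A \<in> isom (r + s) (sig r)" "norm x = 1" "f A = k (unit_at 1 0 x)" for A x
    proof -
      have "f A \<in> G \<inter> K"
        using that Sp1 f(4) k(4) unfolding cG by blast
      then show ?thesis
        using idp unfolding internal_direct_product_def Sp_simps by blast
    qed
  qed
  show thesis
  proof (rule standard_position)
    fix P e
    assume *: "signs e" "P \<in> frames (p + q) (sig p) e"
      "\<And>i j. i < r + s \<Longrightarrow> j < r + s \<Longrightarrow> e i * e j = sig r i * sig r j"
      "mconj (p + q) (sig p) e P ` f ` isom (r + s) (sig r) = block (p + q) e {..<r + s}"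
      "mconj (p + q) (sig p) e P ` (\<lambda>x. k (unit_at 1 0 x)) ` {x. norm x = 1} = unit_at (p + q) (r + s) ` {x. norm x = 1}"
    have "G = f ` isom (r + s) (sig r)" "K = (\<lambda>x. k (unit_at 1 0 x)) ` {x. norm x = 1}"
      unfolding f(4)[symmetric] k(4)[symmetric] cG carrier_Sp_1 image_image by (rule refl)+
    then show thesis
      using that[OF *(1-3)] *(4,5) by blast
  qed
qed

text \<open>\<open>c\<close> is the line on which \<open>K\<close> shall act. A bijection
  \<open>\<pi>\<close> sends it to line \<open>r + s\<close> of the adapted basis and pairs the
  other lines by sign, up to \<open>\<delta>\<close>; permuting the columns of the frame by
  \<open>\<pi>\<close> yields the automorphism.\<close>

lemma Sp_block_position:
  assumes idp: "internal_direct_product (Sp p q) G K" and G: "Lie_subgroup_Sp_iso p q G r s"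
    and K: "Lie_subgroup_Sp_iso p q K 1 0" and n: "p + q = Suc (r + s)" and rs: "0 < r + s"
    and c: "c < p + q" "(sig p c = 1 \<and> p = Suc r) \<or> (sig p c = - 1 \<and> p = r)"
    and card: "card {a \<in> {..<p + q} - {c}. sig p a = 1} = r" "card {a \<in> {..<p + q} - {c}. sig p a = - 1} = s"
  obtains \<phi> where "Lie_automorphism_Sp p q \<phi>"
    "\<phi> ` G = block (p + q) (sig p) ({..<p + q} - {c})"
    "\<phi> ` K = unit_at (p + q) c ` {x. norm x = 1}"
proof -
  let ?n = "p + q" and ?m = "r + s"
  have "\<exists>P e. signs e \<and> P \<in> frames ?n (sig p) e \<and>
      (\<forall>i<?m. \<forall>j<?m. e i * e j = sig r i * sig r j) \<and>
      mconj ?n (sig p) e P ` G = block ?n e {..<?m} \<and>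
      mconj ?n (sig p) e P ` K = unit_at ?n ?m ` {x. norm x = 1}"
    by (rule Sp_standard_position[OF idp G K n]) blast
  then obtain P e where e: "signs e" and P: "P \<in> frames ?n (sig p) e"
    and pat': "\<forall>i<?m. \<forall>j<?m. e i * e j = sig r i * sig r j"
    and imG: "mconj ?n (sig p) e P ` G = block ?n e {..<?m}"
    and imK: "mconj ?n (sig p) e P ` K = unit_at ?n ?m ` {x. norm x = 1}"
    by blast
  have pat: "e i * e j = sig r i * sig r j" if "i < ?m" "j < ?m" for i j
    using pat' that by blast
  obtain \<delta> where \<delta>: "\<delta> = 1 \<or> \<delta> = - 1" "e ?m = \<delta> * sig p c" "card {i \<in> {..<?m}. e i = \<delta>} = r"
    "card {i \<in> {..<?m}. e i = - \<delta>} = s"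
    using sign_pattern[OF e P n rs pat c(2)] .
  have "\<exists>\<pi>. bij_betw \<pi> ({..<?n} - {c}) {..<?m} \<and> (\<forall>a\<in>{..<?n} - {c}. \<delta> * e (\<pi> a) = sig p a)"
  proof (rule colour_preserving_bij[of "{..<?n} - {c}" "{..<?m}" "sig p" "\<lambda>i. \<delta> * e i"])
    show "sig p a = 1 \<or> sig p a = - 1" for a
      by (simp add: sig_def)
    show "\<delta> * e i = 1 \<or> \<delta> * e i = - 1" for i
      using e \<delta>(1) by (auto simp: signs_def)
    have "\<delta> * x = 1 \<longleftrightarrow> x = \<delta>" "\<delta> * x = - 1 \<longleftrightarrow> x = - \<delta>" for x
      using \<delta>(1) by auto
    then show "card {a \<in> {..<?n} - {c}. sig p a = 1} = card {i \<in> {..<?m}. \<delta> * e i = 1}"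
      "card {a \<in> {..<?n} - {c}. sig p a = - 1} = card {i \<in> {..<?m}. \<delta> * e i = - 1}"
      using card \<delta>(3,4) by simp_all
  qed auto
  then obtain \<pi>0 where \<pi>0: "bij_betw \<pi>0 ({..<?n} - {c}) {..<?m}"
    "\<And>a. a \<in> {..<?n} - {c} \<Longrightarrow> \<delta> * e (\<pi>0 a) = sig p a"
    by blast
  define \<pi> where "\<pi> = \<pi>0(c := ?m)"
  have "bij_betw \<pi> ({..<?n} - {c}) {..<?m}"
    by (rule bij_betw_cong[THEN iffD1, OF _ \<pi>0(1)]) (simp add: \<pi>_def)
  moreover have "bij_betw \<pi> {c} {?m}"
    by (simp add: \<pi>_def)
  ultimately have "bij_betw \<pi> (({..<?n} - {c}) \<union> {c}) ({..<?m} \<union> {?m})"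
    by (rule bij_betw_combine) auto
  moreover have "({..<?n} - {c}) \<union> {c} = {..<?n}" "{..<?m} \<union> {?m} = {..<?n}"
    using c(1) n by auto
  ultimately have \<pi>: "bij_betw \<pi> {..<?n} {..<?n}"
    by simp
  have \<pi>0_less: "\<pi>0 a < ?m" if "a < ?n" "a \<noteq> c" for a
    using bij_betwE[OF \<pi>0(1)] that by simp
  have \<pi>_c: "\<pi> a = ?m \<longleftrightarrow> a = c" "\<pi> a < ?m \<longleftrightarrow> a \<noteq> c" if "a < ?n" for a
    using \<pi>0_less[of a] that by (cases "a = c"; simp add: \<pi>_def)+
  have e\<pi>: "(e \<circ> \<pi>) a = \<delta> * sig p a" if "a < ?n" for a
  proof (cases "a = c")
    case False
    then have "\<delta> * (\<delta> * e (\<pi> a)) = \<delta> * sig p a"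
      using \<pi>0(2)[of a] that by (simp add: \<pi>_def)
    then show ?thesis
      using \<delta>(1) by auto
  qed (simp add: \<pi>_def \<delta>(2))
  define P' where "P' = mat ?n ?n (\<lambda>(i, j). P $$ (i, \<pi> j))"
  let ?\<phi> = "mconj ?n (sig p) (e \<circ> \<pi>) P'"
  note re = frames_reindex[OF P \<pi>, folded P'_def]
  \<comment> \<open>Permuting the basis permutes rows and columns of the conjugated matrix, which
    moves the known images of \<open>G\<close> and \<open>K\<close> to their final places.\<close>
  have \<phi>: "?\<phi> A = mat_permute ?n \<pi> (mconj ?n (sig p) e P A)" if "A \<in> carrier_mat ?n ?n" for A
    using re(2)[OF that] that frames_carrier[OF re(1)]
    by (intro eq_matI) (auto simp: mat_permute_def mconj_def)
  have "carrier (Sp p q) \<subseteq> carrier_mat ?n ?n"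
    unfolding carrier_Sp using frames_carrier by auto
  moreover have "G \<subseteq> carrier (Sp p q)" "K \<subseteq> carrier (Sp p q)"
    using idp by (simp_all add: internal_direct_product_def subgroup.subset)
  ultimately have GK: "G \<subseteq> carrier_mat ?n ?n" "K \<subseteq> carrier_mat ?n ?n"
    by auto
  show thesis
  proof (rule that[of ?\<phi>])
    show "Lie_automorphism_Sp p q ?\<phi>"
      using e by (intro mconj_Lie_automorphism[OF re(1) _ \<delta>(1) e\<pi>]) (auto simp: signs_def)
    have "?\<phi> ` G = mat_permute ?n \<pi> ` mconj ?n (sig p) e P ` G"
      unfolding image_image using GK by (intro image_cong) (auto simp: \<phi>)
    also have "\<dots> = block ?n (e \<circ> \<pi>) {a. a < ?n \<and> \<pi> a \<in> {..<?m}}"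
      unfolding imG by (rule mat_permute_block_image[OF \<pi>])
    also have "{a. a < ?n \<and> \<pi> a \<in> {..<?m}} = {..<?n} - {c}"
      using \<pi>_c(2) by auto
    also have "block ?n (e \<circ> \<pi>) ({..<?n} - {c}) = block ?n (sig p) ({..<?n} - {c})"
      by (rule block_scale[OF \<delta>(1) e\<pi>])
    finally show "?\<phi> ` G = block ?n (sig p) ({..<?n} - {c})" .
    have "?\<phi> ` K = mat_permute ?n \<pi> ` mconj ?n (sig p) e P ` K"
      unfolding image_image using GK by (intro image_cong) (auto simp: \<phi>)
    also have "\<dots> = (\<lambda>x. mat_permute ?n \<pi> (unit_at ?n ?m x)) ` {x. norm x = 1}"
      unfolding imK image_image ..
    also have "\<dots> = unit_at ?n c ` {x. norm x = 1}"
    proof (rule image_cong[OF refl])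
      fix x :: quat
      show "mat_permute ?n \<pi> (unit_at ?n ?m x) = unit_at ?n c x"
      proof (rule eq_matI)
        fix a b assume "a < dim_row (unit_at ?n c x)" "b < dim_col (unit_at ?n c x)"
        then have ab: "a < ?n" "b < ?n" by auto
        then have "\<pi> a < ?n" "\<pi> b < ?n" "\<pi> a = \<pi> b \<longleftrightarrow> a = b"
          using bij_betwE[OF \<pi>] \<pi> by (auto simp: bij_betw_def inj_on_def)
        then show "mat_permute ?n \<pi> (unit_at ?n ?m x) $$ (a, b) = unit_at ?n c x $$ (a, b)"
          using ab \<pi>_c(1) by (simp add: mat_permute_def)
      qed (auto simp: mat_permute_def)
    qed
    finally show "?\<phi> ` K = unit_at ?n c ` {x. norm x = 1}" .
  qed
qed

section \<open>Block-diagonal embeddings\<close>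

text \<open>One argument for both embeddings, which differ in the position \<open>c\<close> of the
  line of the Sp(1) factor. \<open>E\<close> is described by its restrictions to the two factors and
  by how they multiply.\<close>

lemma Sp_embedding:
  fixes E :: "quat mat \<Rightarrow> quat mat \<Rightarrow> quat mat"
  assumes idp: "internal_direct_product (Sp p q) G K"
    and G: "Lie_subgroup_Sp_iso p q G r s" and K: "Lie_subgroup_Sp_iso p q K 1 0"
    and n: "p + q = Suc (r + s)" and rs: "0 < r + s"
    and c: "c < p + q" "(sig p c = 1 \<and> p = Suc r) \<or> (sig p c = - 1 \<and> p = r)"
    and card: "card {a \<in> {..<p + q} - {c}. sig p a = 1} = r" "card {a \<in> {..<p + q} - {c}. sig p a = - 1} = s"
    and E_left: "block (p + q) (sig p) ({..<p + q} - {c}) = {E h (1\<^sub>m 1) | h. h \<in> carrier (Sp r s)}"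
    and E_right: "\<And>x. E (1\<^sub>m (r + s)) (unit_at 1 0 x) = unit_at (p + q) c x"
    and E_mult: "\<And>h x. h \<in> carrier_mat (r + s) (r + s) \<Longrightarrow>
      E h (1\<^sub>m 1) * unit_at (p + q) c x = E h (unit_at 1 0 x)"
  shows "\<exists>\<phi>. Lie_automorphism_Sp p q \<phi> \<and> maps_onto_embedding (Sp p q) \<phi> G K (Sp r s) (Sp 1 0) E"
proof -
  have "\<exists>\<phi>. Lie_automorphism_Sp p q \<phi> \<and> \<phi> ` G = block (p + q) (sig p) ({..<p + q} - {c}) \<and>
      \<phi> ` K = unit_at (p + q) c ` {x. norm x = 1}"
    by (rule Sp_block_position[OF idp G K n rs c card]) blast
  then obtain \<phi> where \<phi>: "Lie_automorphism_Sp p q \<phi>"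
    and G_block: "\<phi> ` G = block (p + q) (sig p) ({..<p + q} - {c})"
    and K_units: "\<phi> ` K = unit_at (p + q) c ` {x. norm x = 1}"
    by blast
  have imG: "\<phi> ` G = {E h (1\<^sub>m 1) | h. h \<in> carrier (Sp r s)}"
    using G_block E_left by (rule trans)
  have "unit_at (p + q) c = (\<lambda>x. E (1\<^sub>m (r + s)) (unit_at 1 0 x))"
    by (rule ext) (simp only: E_right)
  then have imK: "\<phi> ` K = {E (1\<^sub>m (r + s)) l | l. l \<in> carrier (Sp 1 0)}"
    unfolding K_units carrier_Sp_1 by auto
  have mult: "E h (1\<^sub>m 1) * E (1\<^sub>m (r + s)) l = E h l" if h: "h \<in> carrier (Sp r s)" and l: "l \<in> carrier (Sp 1 0)" for h l
  proof -
    have "h \<in> carrier_mat (r + s) (r + s)"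
      using h frames_carrier unfolding carrier_Sp by blast
    moreover obtain x where "l = unit_at 1 0 x"
      using l unfolding carrier_Sp_1 by blast
    ultimately show ?thesis
      by (simp only: E_mult E_right)
  qed
  have hom: "\<phi> \<in> hom (Sp p q) (Sp p q)"
    using \<phi> by (simp add: Lie_automorphism_Sp_def iso_def)
  have "G \<subseteq> carrier (Sp p q)" "K \<subseteq> carrier (Sp p q)"
    using idp by (simp_all add: internal_direct_product_def subgroup.subset)
  then have "\<phi> (a * b) = \<phi> a * \<phi> b" if "a \<in> G" "b \<in> K" for a b
    using hom_mult[OF hom, of a b] that unfolding Sp_simps by blast
  then have "\<phi> ` (G <#>\<^bsub>Sp p q\<^esub> K) = (\<Union>x\<in>\<phi> ` G. \<Union>y\<in>\<phi> ` K. {x * y})"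
    unfolding set_mult_def Sp_simps image_UN by simp
  also have "\<dots> = {E h l | h l. h \<in> carrier (Sp r s) \<and> l \<in> carrier (Sp 1 0)}"
  proof (intro equalityI subsetI)
    fix z assume "z \<in> {E h l | h l. h \<in> carrier (Sp r s) \<and> l \<in> carrier (Sp 1 0)}"
    then obtain h l where hl: "h \<in> carrier (Sp r s)" "l \<in> carrier (Sp 1 0)" "z = E h (1\<^sub>m 1) * E (1\<^sub>m (r + s)) l"
      using mult by force
    then show "z \<in> (\<Union>x\<in>\<phi> ` G. \<Union>y\<in>\<phi> ` K. {x * y})"
      unfolding imG imK by blast
  next
    fix z assume "z \<in> (\<Union>x\<in>\<phi> ` G. \<Union>y\<in>\<phi> ` K. {x * y})"
    then obtain h l where "h \<in> carrier (Sp r s)" "l \<in> carrier (Sp 1 0)" "z = E h (1\<^sub>m 1) * E (1\<^sub>m (r + s)) l"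
      unfolding imG imK by blast
    then show "z \<in> {E h l | h l. h \<in> carrier (Sp r s) \<and> l \<in> carrier (Sp 1 0)}"
      using mult by blast
  qed
  finally have "maps_onto_embedding (Sp p q) \<phi> G K (Sp r s) (Sp 1 0) E"
    unfolding maps_onto_embedding_def Sp_simps using imG imK by (simp del: One_nat_def)
  then show ?thesis
    using \<phi> by blast
qed

section \<open>Block-diagonal matrices as isometries fixing one basis vector\<close>

lemma sig_Suc: "sig (Suc p) (Suc i) = sig p i" "sig (Suc p) 0 = 1"
  by (simp_all add: sig_def)

lemma block_first:
  "block (Suc (p + q)) (sig (Suc p)) ({..<Suc (p + q)} - {0}) =
    {diag_block_mat [1\<^sub>m 1, g] | g. g \<in> carrier (Sp p q)}"
proof -
  let ?N = "p + q"
  define D where "D g = diag_block_mat [1\<^sub>m 1, g :: quat mat]" for g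
  have D_carrier: "D g \<in> carrier_mat (Suc ?N) (Suc ?N)" if "g \<in> carrier_mat ?N ?N" for g
    using diag_block_mat_two(1)[OF one_carrier_mat that, of 1] by (simp add: D_def)
  have D_entry: "D g $$ (0, 0) = 1" "j < ?N \<Longrightarrow> D g $$ (0, Suc j) = 0" "i < ?N \<Longrightarrow> D g $$ (Suc i, 0) = 0"
    "i < ?N \<Longrightarrow> j < ?N \<Longrightarrow> D g $$ (Suc i, Suc j) = g $$ (i, j)" if "g \<in> carrier_mat ?N ?N" for g i j
    using diag_block_mat_two(2)[OF one_carrier_mat that, of _ 1] by (auto simp: D_def)
  \<comment> \<open>Splitting index 0 off the sums leaves the frame conditions of \<open>g\<close>,
    with the signs shifted by \<open>sig_Suc\<close>.\<close>
  have iff: "D g \<in> frames (Suc ?N) (sig (Suc p)) (sig (Suc p)) \<longleftrightarrow> g \<in> isom ?N (sig p)"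
    if g: "g \<in> carrier_mat ?N ?N" for g
    using g D_carrier[OF g] unfolding frames_def
    by (auto simp: All_less_Suc2 sum.lessThan_Suc_shift D_entry[OF g] sig_Suc simp del: sum.lessThan_Suc)
  have "B \<in> D ` isom ?N (sig p)"
    if B: "B \<in> block (Suc ?N) (sig (Suc p)) ({..<Suc ?N} - {0})" for B
  proof -
    define g where "g = mat ?N ?N (\<lambda>(a, b). B $$ (Suc a, Suc b))"
    have g: "g \<in> carrier_mat ?N ?N"
      by (simp add: g_def)
    have F: "B \<in> frames (Suc ?N) (sig (Suc p)) (sig (Suc p))"
      using B by (simp add: block_def)
    have "B = D g"
    proof (rule eq_matI)
      fix a b assume "a < dim_row (D g)" "b < dim_col (D g)"
      then have ab: "a < Suc ?N" "b < Suc ?N"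
        using D_carrier[OF g] by auto
      then show "B $$ (a, b) = D g $$ (a, b)"
        using B D_entry[OF g] by (cases a; cases b) (auto simp: block_def g_def)
    qed (use D_carrier[OF g] frames_carrier[OF F] in auto)
    then show ?thesis
      using iff[OF g] F by auto
  qed
  moreover have "D g \<in> block (Suc ?N) (sig (Suc p)) ({..<Suc ?N} - {0})"
    if "g \<in> isom ?N (sig p)" for g
    using iff[OF frames_carrier[OF that]] that D_entry[OF frames_carrier[OF that]]
    by (auto simp: block_def All_less_Suc2)
  ultimately show ?thesis
    unfolding carrier_Sp D_def by blast
qed

lemma block_last:
  "block (Suc (p + q)) (sig p) ({..<Suc (p + q)} - {p + q}) =
    {diag_block_mat [g, 1\<^sub>m 1] | g. g \<in> carrier (Sp p q)}"
proof -
  let ?N = "p + q"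
  define D where "D g = diag_block_mat [g :: quat mat, 1\<^sub>m 1]" for g
  have D_carrier: "D g \<in> carrier_mat (Suc ?N) (Suc ?N)" if "g \<in> carrier_mat ?N ?N" for g
    using diag_block_mat_two(1)[OF that one_carrier_mat, of 1] by (simp add: D_def)
  have D_entry: "D g $$ (?N, ?N) = 1" "j < ?N \<Longrightarrow> D g $$ (?N, j) = 0" "i < ?N \<Longrightarrow> D g $$ (i, ?N) = 0"
    "i < ?N \<Longrightarrow> j < ?N \<Longrightarrow> D g $$ (i, j) = g $$ (i, j)" if "g \<in> carrier_mat ?N ?N" for g i j
    using diag_block_mat_two(2)[OF that one_carrier_mat, of _ 1] by (auto simp: D_def)
  have iff: "D g \<in> isom (Suc ?N) (sig p) \<longleftrightarrow> g \<in> isom ?N (sig p)"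
    if g: "g \<in> carrier_mat ?N ?N" for g
    using g D_carrier[OF g] unfolding frames_def
    by (auto simp: All_less_Suc D_entry[OF g] of_real_def)
  have "B \<in> D ` isom ?N (sig p)"
    if B: "B \<in> block (Suc ?N) (sig p) ({..<Suc ?N} - {?N})" for B
  proof -
    define g where "g = mat ?N ?N (\<lambda>(a, b). B $$ (a, b))"
    have g: "g \<in> carrier_mat ?N ?N"
      by (simp add: g_def)
    have F: "B \<in> isom (Suc ?N) (sig p)"
      using B by (simp add: block_def)
    have "B = D g"
    proof (rule eq_matI)
      fix a b assume "a < dim_row (D g)" "b < dim_col (D g)"
      then have ab: "a < Suc ?N" "b < Suc ?N"
        using D_carrier[OF g] by auto
      then show "B $$ (a, b) = D g $$ (a, b)"
        using B D_entry[OF g] by (cases "a = ?N"; cases "b = ?N") (auto simp: block_def g_def)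
    qed (use D_carrier[OF g] frames_carrier[OF F] in auto)
    then show ?thesis
      using iff[OF g] F by auto
  qed
  moreover have "D g \<in> block (Suc ?N) (sig p) ({..<Suc ?N} - {?N})"
    if "g \<in> isom ?N (sig p)" for g
    using iff[OF frames_carrier[OF that]] that D_entry[OF frames_carrier[OF that]]
    by (auto simp: block_def All_less_Suc)
  ultimately show ?thesis
    unfolding carrier_Sp D_def by blast
qed

lemma diag_block_unit_first:
  assumes "g \<in> carrier_mat N N"
  shows "diag_block_mat [1\<^sub>m 1, g] * unit_at (Suc N) 0 x = diag_block_mat [unit_at 1 0 x, g]"
    and "diag_block_mat [unit_at 1 0 x, 1\<^sub>m N] = unit_at (Suc N) 0 x"
proof -
  note c1 = diag_block_mat_two(1)[OF one_carrier_mat assms, of 1]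
    and c2 = diag_block_mat_two(1)[OF unit_at_carrier(1)[of 1 0 x] assms]
    and c3 = diag_block_mat_two(1)[OF unit_at_carrier(1)[of 1 0 x] one_carrier_mat, of N]
  note e1 = diag_block_mat_two(2)[OF one_carrier_mat assms, of _ 1]
    and e2 = diag_block_mat_two(2)[OF unit_at_carrier(1)[of 1 0 x] assms]
    and e3 = diag_block_mat_two(2)[OF unit_at_carrier(1)[of 1 0 x] one_carrier_mat, of _ N]
  show "diag_block_mat [1\<^sub>m 1, g] * unit_at (Suc N) 0 x = diag_block_mat [unit_at 1 0 x, g]"
    by (rule eq_matI) (use c1 c2 e1 e2 in \<open>auto simp del: diag_block_mat.simps\<close>)
  show "diag_block_mat [unit_at 1 0 x, 1\<^sub>m N] = unit_at (Suc N) 0 x"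
    by (rule eq_matI) (use c3 e3 in \<open>auto simp del: diag_block_mat.simps\<close>)
qed

lemma diag_block_unit_last:
  assumes "g \<in> carrier_mat N N"
  shows "diag_block_mat [g, 1\<^sub>m 1] * unit_at (Suc N) N x = diag_block_mat [g, unit_at 1 0 x]"
    and "diag_block_mat [1\<^sub>m N, unit_at 1 0 x] = unit_at (Suc N) N x"
proof -
  note c1 = diag_block_mat_two(1)[OF assms one_carrier_mat, of 1]
    and c2 = diag_block_mat_two(1)[OF assms unit_at_carrier(1)[of 1 0 x]]
    and c3 = diag_block_mat_two(1)[OF one_carrier_mat unit_at_carrier(1)[of 1 0 x], of N]
  note e1 = diag_block_mat_two(2)[OF assms one_carrier_mat, of _ 1]
    and e2 = diag_block_mat_two(2)[OF assms unit_at_carrier(1)[of 1 0 x]]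
    and e3 = diag_block_mat_two(2)[OF one_carrier_mat unit_at_carrier(1)[of 1 0 x], of _ N]
  show "diag_block_mat [g, 1\<^sub>m 1] * unit_at (Suc N) N x = diag_block_mat [g, unit_at 1 0 x]"
    by (rule eq_matI) (use c1 c2 e1 e2 in \<open>auto simp: less_Suc_eq simp del: diag_block_mat.simps\<close>)
  show "diag_block_mat [1\<^sub>m N, unit_at 1 0 x] = unit_at (Suc N) N x"
    by (rule eq_matI) (use c3 e3 in \<open>auto simp: less_Suc_eq simp del: diag_block_mat.simps\<close>)
qed

lemma Sp_embedding_first:
  assumes "q \<ge> 1" "internal_direct_product (Sp (Suc r) q) G K"
    "Lie_subgroup_Sp_iso (Suc r) q G r q" "Lie_subgroup_Sp_iso (Suc r) q K 1 0"
  shows "\<exists>\<phi>. Lie_automorphism_Sp (Suc r) q \<phi> \<and>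
    maps_onto_embedding (Sp (Suc r) q) \<phi> G K (Sp r q) (Sp 1 0) (\<lambda>g \<eta>. diag_block_mat [\<eta>, g])"
proof (rule Sp_embedding[OF assms(2-4), of 0])
  have "{a \<in> {..<Suc r + q} - {0}. sig (Suc r) a = 1} = {1..<Suc r}"
    "{a \<in> {..<Suc r + q} - {0}. sig (Suc r) a = - 1} = {Suc r..<Suc r + q}"
    by (auto simp: sig_def split: if_splits)
  then show "card {a \<in> {..<Suc r + q} - {0}. sig (Suc r) a = 1} = r"
    "card {a \<in> {..<Suc r + q} - {0}. sig (Suc r) a = - 1} = q"
    by simp_all
  show "block (Suc r + q) (sig (Suc r)) ({..<Suc r + q} - {0}) =
      {diag_block_mat [1\<^sub>m 1, h] | h. h \<in> carrier (Sp r q)}"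
    using block_first[of r q] by simp
  show "diag_block_mat [unit_at 1 0 x, 1\<^sub>m (r + q)] = unit_at (Suc r + q) 0 x" for x
    using diag_block_unit_first(2)[OF one_carrier_mat] by simp
  show "diag_block_mat [1\<^sub>m 1, h] * unit_at (Suc r + q) 0 x = diag_block_mat [unit_at 1 0 x, h]"
    if "h \<in> carrier_mat (r + q) (r + q)" for h x
    using diag_block_unit_first(1)[OF that] by simp
qed (use assms(1) in \<open>simp_all add: sig_def\<close>)

text \<open>Here a negative sign is removed, and the reserved line is the last one, of index
  \<open>p + s\<close>.\<close>

lemma Sp_embedding_last:
  assumes "p \<ge> 1" "internal_direct_product (Sp p (Suc s)) G K"
    "Lie_subgroup_Sp_iso p (Suc s) G p s" "Lie_subgroup_Sp_iso p (Suc s) K 1 0"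
  shows "\<exists>\<phi>. Lie_automorphism_Sp p (Suc s) \<phi> \<and>
    maps_onto_embedding (Sp p (Suc s)) \<phi> G K (Sp p s) (Sp 1 0) (\<lambda>g \<eta>. diag_block_mat [g, \<eta>])"
proof (rule Sp_embedding[OF assms(2-4), of "p + s"])
  have "{a \<in> {..<p + Suc s} - {p + s}. sig p a = 1} = {..<p}"
    "{a \<in> {..<p + Suc s} - {p + s}. sig p a = - 1} = {p..<p + s}"
    by (auto simp: sig_def split: if_splits)
  then show "card {a \<in> {..<p + Suc s} - {p + s}. sig p a = 1} = p"
    "card {a \<in> {..<p + Suc s} - {p + s}. sig p a = - 1} = s"
    by simp_all
  show "block (p + Suc s) (sig p) ({..<p + Suc s} - {p + s}) =
      {diag_block_mat [h, 1\<^sub>m 1] | h. h \<in> carrier (Sp p s)}"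
    using block_last[of p s] by simp
  show "diag_block_mat [1\<^sub>m (p + s), unit_at 1 0 x] = unit_at (p + Suc s) (p + s) x" for x
    using diag_block_unit_last(2)[OF one_carrier_mat] by simp
  show "diag_block_mat [h, 1\<^sub>m 1] * unit_at (p + Suc s) (p + s) x = diag_block_mat [h, unit_at 1 0 x]"
    if "h \<in> carrier_mat (p + s) (p + s)" for h x
    using diag_block_unit_last(1)[OF that] by simp
qed (use assms(1) in \<open>simp_all add: sig_def\<close>)

theorem theorem2p16:
  fixes p q :: nat and G K :: "quat mat set"
  assumes "p \<ge> 1" and "q \<ge> 1"
    and "internal_direct_product (Sp p q) G K"
    and "connectedin (mat_topology (p + q)) (G <#>\<^bsub>Sp p q\<^esub> K)"
    and "Lie_subgroup_Sp_iso p q G (p - 1) q \<or> Lie_subgroup_Sp_iso p q G p (q - 1)"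
    and "Lie_subgroup_Sp_iso p q K 1 0"
  shows "(Lie_subgroup_Sp_iso p q G (p - 1) q \<longrightarrow>
           (\<exists>\<phi>. Lie_automorphism_Sp p q \<phi> \<and>
              maps_onto_embedding (Sp p q) \<phi> G K (Sp (p - 1) q) (Sp 1 0)
                (\<lambda>g \<eta>. diag_block_mat [\<eta>, g]))) \<and>
         (Lie_subgroup_Sp_iso p q G p (q - 1) \<longrightarrow>
           (\<exists>\<phi>. Lie_automorphism_Sp p q \<phi> \<and>
              maps_onto_embedding (Sp p q) \<phi> G K (Sp p (q - 1)) (Sp 1 0)
                (\<lambda>g \<eta>. diag_block_mat [g, \<eta>])))"
proof (intro conjI impI)
  \<comment> \<open>The two embedding lemmas are stated with successors; these equations translate
    them back.\<close>
  have p: "p = Suc (p - 1)" and q: "q = Suc (q - 1)"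
    using assms(1,2) by auto
  show "\<exists>\<phi>. Lie_automorphism_Sp p q \<phi> \<and>
      maps_onto_embedding (Sp p q) \<phi> G K (Sp (p - 1) q) (Sp 1 0) (\<lambda>g \<eta>. diag_block_mat [\<eta>, g])"
    if "Lie_subgroup_Sp_iso p q G (p - 1) q"
    using Sp_embedding_first[of q "p - 1" G K] assms(2,3,6) that unfolding p[symmetric] by blast
  show "\<exists>\<phi>. Lie_automorphism_Sp p q \<phi> \<and>
      maps_onto_embedding (Sp p q) \<phi> G K (Sp p (q - 1)) (Sp 1 0) (\<lambda>g \<eta>. diag_block_mat [g, \<eta>])"
    if "Lie_subgroup_Sp_iso p q G p (q - 1)"
    using Sp_embedding_last[of p "q - 1" G K] assms(1,3,6) that unfolding q[symmetric] by blast
qed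

end
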